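(* Let $2<\beta<\infty$, and let $\Psi'=\{Y^{-1}/I : Y\in\Theta\}$ be the STIR process (that is, the STINR process with noise power $W=0$) associated with the Poisson network model with path-loss exponent $\beta$ described in the context. Let $Z'_{(1)}\ge Z'_{(2)}\ge\cdots$ be the points of $\Psi'$ arranged in decreasing order. Then the sequence $(Z'_{(i)})_{i\ge1}$ is equal in distribution to the sequence $(V_i)_{i\ge 1}$ having the two-parameter Poisson-Dirichlet distribution $\mathrm{PD}(\alpha,\theta)$ with $\alpha=2/\beta$ and $\theta=0$. In other words, the STIR process $\Psi'$ is a $\mathrm{PD}(2/\beta,0)$ point process.
   Context: Network model. Fix constants $\lambda>0$, $K>0$ and $2<\beta<\infty$. Let $\Phi$ be a homogeneous Poisson point process on $\mathbb{R}^2$ with intensity $\lambda$. Let $\ell(|x|)=(K|x|)^{\beta}$. Given $\Phi$, let $\{S_X\}_{X\in\Phi}$ be independent, identically distributed positive random variables, with an arbitrary common law, the law of $S$, subject to $\mathbf{E}(S^{2/\beta})<\infty$. The propagation process is the point process on the positive half-line $$\Theta=\{Y\}:=\left\{\frac{\ell(|X|)}{S_X}: X\in\Phi\right\}.$$ Put $I=\sum_{Y\in\Theta}Y^{-1}$. For a constant $W\ge 0$ (the noise power) the STINR process is the point process on $(0,1]$ $$\Psi'=\{Z'\}:=\left\{\frac{Y^{-1}}{W+I}: Y\in\Theta\right\};$$ when $W=0$ it is called the STIR process. Two-parameter Poisson-Dirichlet distribution. For $0\le\alpha<1$ and $\theta>-\alpha$, let $U_1,U_2,\dots$ be independent random variables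 such that $U_i$ has the beta distribution $B(1-\alpha,\theta+i\alpha)$. Set $\tilde V_1=U_1$ and $\tilde V_i=(1-U_1)\cdots(1-U_{i-1})U_i$ for $i\ge2$; then $\sum_i\tilde V_i=1$ almost surely. Let $V_1\ge V_2\ge\cdots$ be the decreasing order statistics of $\{\tilde V_i\}$. The distribution of the sequence $(V_i)_{i\ge1}$ is called $\mathrm{PD}(\alpha,\theta)$; a point process whose atoms, arranged in decreasing order, have this law is called a $\mathrm{PD}(\alpha,\theta)$ point process. *)

theory Defs
  imports "HOL-Probability.Probability"
begin

section \<open>Homogeneous Poisson processes and independent marks\<close>

text \<open>A point process without multiple points is given by its random set of points \<open>\<Phi> \<omega>\<close>;
  a homogeneous Poisson process has this form almost surely. The finiteness clause is needed because
  \<open>card\<close> is 0 on infinite sets. The Poisson probabilities are written out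
  because \<open>poisson_pmf\<close> is specified only for positive rates, whereas \<open>A\<close> may be a null set.\<close>

definition homogeneous_poisson_process ::
    "'w measure \<Rightarrow> real \<Rightarrow> ('w \<Rightarrow> 'a::euclidean_space set) \<Rightarrow> bool" where
  "homogeneous_poisson_process M lam \<Phi> \<longleftrightarrow>
     (\<forall>A\<in>sets borel. emeasure lborel A < \<infinity> \<longrightarrow>
        (AE \<omega> in M. finite (\<Phi> \<omega> \<inter> A)) \<and>
        (\<lambda>\<omega>. card (\<Phi> \<omega> \<inter> A)) \<in> measurable M (count_space UNIV) \<and>
        (\<forall>k. measure M {\<omega> \<in> space M. card (\<Phi> \<omega> \<inter> A) = k} =
             (lam * measure lborel A) ^ k / fact k * exp (- (lam * measure lborel A)))) \<and>
     (\<forall>A :: nat \<Rightarrow> 'a set.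
        (\<forall>i. A i \<in> sets borel \<and> emeasure lborel (A i) < \<infinity>) \<and> disjoint_family A \<longrightarrow>
        prob_space.indep_vars M (\<lambda>_. count_space UNIV) (\<lambda>i \<omega>. card (\<Phi> \<omega> \<inter> A i)) UNIV)"

text \<open>The marks \<open>S \<omega> x\<close>, for \<open>x \<in> \<Phi> \<omega>\<close>, are i.i.d. with law \<open>\<mu>\<close> given \<open>\<Phi>\<close>: along a measurable
  enumeration of the (almost surely infinitely many) points without repetition, they form an
  i.i.d. sequence that is independent of the sequence of points.
  The values \<open>S \<omega> x\<close> for \<open>x \<notin> \<Phi> \<omega>\<close> play no role.\<close>

definition iid_marks ::
    "'w measure \<Rightarrow> ('w \<Rightarrow> 'a::euclidean_space set) \<Rightarrow> ('w \<Rightarrow> 'a \<Rightarrow> real) \<Rightarrow> real measure \<Rightarrow> bool" where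
  "iid_marks M \<Phi> S \<mu> \<longleftrightarrow>
     (\<exists>X :: nat \<Rightarrow> 'w \<Rightarrow> 'a.
        (\<forall>n. X n \<in> borel_measurable M) \<and>
        (AE \<omega> in M. bij_betw (\<lambda>n. X n \<omega>) UNIV (\<Phi> \<omega>)) \<and>
        (\<forall>n. distr M borel (\<lambda>\<omega>. S \<omega> (X n \<omega>)) = \<mu>) \<and>
        prob_space.indep_vars M (\<lambda>_. borel) (\<lambda>n \<omega>. S \<omega> (X n \<omega>)) UNIV \<and>
        prob_space.indep_set M
          (sets (vimage_algebra (space M) (\<lambda>\<omega> n. X n \<omega>) (PiM UNIV (\<lambda>_. borel))))
          (sets (vimage_algebra (space M) (\<lambda>\<omega> n. S \<omega> (X n \<omega>)) (PiM UNIV (\<lambda>_. borel)))))"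

section \<open>Point processes on the line as counting measures\<close>

text \<open>A point process on the line is represented by its counting measure, so that points may
  have multiplicities. The points of a family \<open>f\<close> indexed by \<open>A\<close> have counting measure
  \<open>distr (count_space A) borel f\<close>: it sends a Borel set \<open>B\<close> to the number of \<open>i \<in> A\<close> with \<open>f i \<in> B\<close>.\<close>

definition points :: "'i set \<Rightarrow> ('i \<Rightarrow> real) \<Rightarrow> real measure" where
  "points A f = distr (count_space A) borel f"

definition decreasing_arrangement :: "(nat \<Rightarrow> real) \<Rightarrow> real measure \<Rightarrow> bool" where
  "decreasing_arrangement z N \<longleftrightarrow> decseq z \<and> points UNIV z = N"

section \<open>Propagation and STINR processes\<close>

definition path_loss :: "real \<Rightarrow> real \<Rightarrow> real \<Rightarrow> real" where
  "path_loss K \<beta> r = (K * r) powr \<beta>"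

definition propagation :: "real \<Rightarrow> real \<Rightarrow> 'a::euclidean_space set \<Rightarrow> ('a \<Rightarrow> real) \<Rightarrow> real measure" where
  "propagation K \<beta> P s = points P (\<lambda>x. path_loss K \<beta> (norm x) / s x)"

text \<open>The integral of \<open>1 / y\<close> against the counting measure is the sum over the points, with
  multiplicity (and 0 by convention if the sum diverges).\<close>

definition interference :: "real measure \<Rightarrow> real" where
  "interference \<Theta> = (\<integral>y. inverse y \<partial>\<Theta>)"

definition stinr :: "real \<Rightarrow> real measure \<Rightarrow> real measure" where
  "stinr W \<Theta> = distr \<Theta> borel (\<lambda>y. inverse y / (W + interference \<Theta>))"

abbreviation stir :: "real measure \<Rightarrow> real measure" where
  "stir \<equiv> stinr 0"

section \<open>The two-parameter Poisson-Dirichlet distribution\<close>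

definition beta_distribution :: "real \<Rightarrow> real \<Rightarrow> real measure" where
  "beta_distribution a b =
     density lborel (\<lambda>x. ennreal (indicator {0<..<1} x *
       (x powr (a - 1) * (1 - x) powr (b - 1) / Beta a b)))"

text \<open>Indices start at 0, so \<open>u i\<close> is the stick-breaking variable usually numbered \<open>i + 1\<close>, hence the second
  beta parameter \<open>\<theta> + (i + 1) \<alpha>\<close>.\<close>

definition stick_variables :: "real \<Rightarrow> real \<Rightarrow> (nat \<Rightarrow> real) measure" where
  "stick_variables \<alpha> \<theta> = PiM UNIV (\<lambda>i. beta_distribution (1 - \<alpha>) (\<theta> + real (i + 1) * \<alpha>))"

definition stick_breaking :: "(nat \<Rightarrow> real) \<Rightarrow> nat \<Rightarrow> real" where
  "stick_breaking u i = (\<Prod>j<i. 1 - u j) * u i"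

text \<open>The law of the decreasing order statistics, meant for \<open>0 \<le> \<alpha> < 1\<close> and \<open>\<theta> > - \<alpha>\<close>. A decreasing
  arrangement is unique if it exists, and it exists for almost every \<open>u\<close>.\<close>

definition PD :: "real \<Rightarrow> real \<Rightarrow> (nat \<Rightarrow> real) measure" where
  "PD \<alpha> \<theta> = distr (stick_variables \<alpha> \<theta>) (PiM UNIV (\<lambda>_. borel))
     (\<lambda>u. THE v. decreasing_arrangement v (points UNIV (stick_breaking u)))"

definition PD_point_process :: "'w measure \<Rightarrow> ('w \<Rightarrow> real measure) \<Rightarrow> real \<Rightarrow> real \<Rightarrow> bool" where
  "PD_point_process M \<Psi> \<alpha> \<theta> \<longleftrightarrow>
     (\<exists>Z \<in> measurable M (PiM UNIV (\<lambda>_. borel)).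
        (AE \<omega> in M. decreasing_arrangement (Z \<omega>) (\<Psi> \<omega>)) \<and>
        distr M (PiM UNIV (\<lambda>_. borel)) Z = PD \<alpha> \<theta>)"

end

theory Submission
  imports Defs
begin

text \<open>Up to a constant factor, the inverse propagation losses are the points \<open>q i = \<Gamma> i powr (- 1 / \<alpha>)\<close>, where
  \<open>\<alpha> = 2 / \<beta>\<close> and \<open>\<Gamma>\<close> are the arrival times of a unit-rate Poisson process: both have the same Laplace functional,
  since the planar intensity and the marks only enter through a scale. Let \<open>T = (\<Sum>i. q i)\<close>. Weight the law of the \<open>q i\<close> by
  \<open>T powr (- k \<alpha>)\<close> and remove a point chosen with probability \<open>q i / T\<close>. By the Mecke formula the removed fraction
  has the beta distribution with parameters \<open>1 - \<alpha>\<close> and \<open>(k + 1) \<alpha>\<close>, and independently of it the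
  normalised remaining points have the law weighted by \<open>T powr (- (k + 1) \<alpha>)\<close>. Iterating from \<open>k = 0\<close> breaks sticks as in
  \<open>PD(\<alpha>, 0)\<close>; functionals that ignore points below a fixed level only see finitely many steps,
  because the remaining mass tends to 0.\<close>

section \<open>Point configurations and their decreasing arrangement\<close>

text \<open>The two comparisons are made by one criterion, \<open>ranked_law_eq\<close>: two random
  sequences of positive points have equally distributed rankings once \<open>gprod g\<close> has
  equal expectations for all \<open>g\<close> that are at most 1 and equal 1 below some positive
  level. Such \<open>g\<close> involve only finitely many points of a null sequence and leave the
  order of the points open, so sticks and network points never have to be matched one by one. The
  price is that they do not see the total mass. Network and arrivals are therefore compared before
  normalisation, where both functionals are explicit exponentials, and the law of the whole ranked
  sequence is then pushed through \<open>normalise\<close>. Arrivals and sticks are compared after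
  normalisation. No random size-biased permutation is constructed: a removal is an identity between
  expectations. The weight \<open>T powr (- k \<alpha>)\<close> comes from scaling: measuring the
  removed arrival in units of \<open>T powr (- \<alpha>)\<close> makes its share of the total
  independent of the rest, and the Jacobian of this change adds one more factor
  \<open>T powr (- \<alpha>)\<close> at each removal.\<close>

lemma points_bij:
  assumes "bij_betw h A B"
  shows "points A (\<lambda>i. f (h i)) = points B f"
proof -
  have "points B f = distr (distr (count_space A) (count_space B) h) borel f"
    unfolding points_def by (subst distr_bij_count_space[OF assms]) simp
  also have "\<dots> = distr (count_space A) borel (f \<circ> h)"
    using assms by (intro distr_distr) (auto simp: bij_betw_def)
  finally show ?thesis by (simp add: points_def comp_def)
qed

lemma distr_points:
  assumes "g \<in> borel_measurable borel"
  shows "distr (points A f) borel g = points A (\<lambda>i. g (f i))"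
  unfolding points_def by (subst distr_distr) (use assms in \<open>auto simp: comp_def\<close>)

lemma emeasure_points:
  "B \<in> sets borel \<Longrightarrow> emeasure (points A f) B = emeasure (count_space A) {i\<in>A. f i \<in> B}"
  unfolding points_def by (subst emeasure_distr) (auto intro!: arg_cong[where f="emeasure _"])

lemma emeasure_points_suminf:
  "B \<in> sets borel \<Longrightarrow> emeasure (points UNIV f) B = (\<Sum>i. indicator B (f i))"
  by (subst emeasure_points, simp, subst nn_integral_indicator[symmetric])
     (auto simp: nn_integral_count_space_nat indicator_def intro!: suminf_cong)

text \<open>The indices of entries at or above \<open>x\<close> form an initial segment, so
  \<open>n\<close> belongs to it exactly when its size is at least \<open>n + 1\<close>. Each entry
  is thus read off from the counting measure, which yields both uniqueness and measurability of the
  arrangement.\<close>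

lemma decseq_ge_iff:
  assumes "decseq v"
  shows "x \<le> v n \<longleftrightarrow> of_nat (Suc n) \<le> emeasure (points UNIV v) {x..}"
proof
  assume *: "x \<le> v n"
  have "{..n} \<subseteq> {i. x \<le> v i}"
    using assms * by (auto simp: decseq_def intro: order_trans)
  then have "emeasure (count_space UNIV) {..n} \<le> emeasure (count_space UNIV) {i. x \<le> v i}"
    by (intro emeasure_mono) auto
  then show "of_nat (Suc n) \<le> emeasure (points UNIV v) {x..}"
    by (simp add: emeasure_points del: of_nat_Suc)
next
  assume *: "of_nat (Suc n) \<le> emeasure (points UNIV v) {x..}"
  show "x \<le> v n"
  proof (rule ccontr)
    assume "\<not> x \<le> v n"
    then have "{i. x \<le> v i} \<subseteq> {..<n}"
      using assms by (auto simp: decseq_def not_le) (meson leI order.strict_trans2 not_le order_trans)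
    then have "emeasure (count_space UNIV) {i. x \<le> v i} \<le> emeasure (count_space UNIV) {..<n}"
      by (intro emeasure_mono) auto
    also have "\<dots> = of_nat n" by simp
    finally have "emeasure (points UNIV v) {x..} \<le> of_nat n"
      by (simp add: emeasure_points)
    from order_trans[OF * this] have "Suc n \<le> n" by (simp only: of_nat_le_iff)
    then show False by simp
  qed
qed

lemma decreasing_arrangement_unique:
  assumes "decreasing_arrangement v N" "decreasing_arrangement w N"
  shows "v = w"
proof
  fix n
  have "x \<le> v n \<longleftrightarrow> x \<le> w n" for x
    using assms decseq_ge_iff unfolding decreasing_arrangement_def by metis
  then show "v n = w n" by (meson order.antisym order_refl)
qed

text \<open>An entry \<open>v k = f j\<close> leaves room for at most \<open>k\<close> strictly
  larger points. Conversely, finiteness lets the points be numbered by rank. The inequality is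
  strict because infinitely many ties are harmless at the lowest value.\<close>

lemma ex_decreasing_arrangement_iff:
  "(\<exists>v. decreasing_arrangement v (points UNIV f)) \<longleftrightarrow> (\<forall>j. finite {i::nat. f j < f i})"
proof safe
  fix v j assume *: "decreasing_arrangement v (points UNIV f)"
  have eq: "emeasure (count_space UNIV) {i. v i \<in> B} = emeasure (count_space UNIV) {i. f i \<in> B}"
    if "B \<in> sets borel" for B
    using * that emeasure_points[of B UNIV v] emeasure_points[of B UNIV f]
    by (simp add: decreasing_arrangement_def)
  have "\<exists>k. v k = f j"
  proof (rule ccontr)
    assume "\<not> (\<exists>k. v k = f j)"
    then have "emeasure (count_space UNIV) {i. f i \<in> {f j}} = 0"
      by (subst eq[symmetric]) auto
    then have "{i. f i = f j} = {}"
      by (simp add: emeasure_count_space_eq_0)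
    then show False by auto
  qed
  then obtain k where k: "v k = f j" ..
  have "{i. v i \<in> {f j<..}} \<subseteq> {..<k}"
    using * k unfolding decreasing_arrangement_def decseq_def
    by auto (metis k leI linorder_not_le)
  then have "finite {i. v i \<in> {f j<..}}" by (rule finite_subset) simp
  then have "emeasure (count_space UNIV) {i. f i \<in> {f j<..}} < \<infinity>"
    by (subst eq[symmetric]) (auto simp: of_nat_less_top)
  then show "finite {i. f j < f i}" by (simp add: emeasure_count_space split: if_splits)
next
  assume fin: "\<forall>j. finite {i. f j < f i}"
  \<comment> \<open>The predecessors of \<open>j\<close> in a total order of the indices: larger
    value first, ties by index. Their number \<open>r j\<close> is the rank of
    \<open>j\<close>.\<close>
  define P where "P j = {i. f j < f i \<or> (f i = f j \<and> i < j)}" for j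
  define r where "r j = card (P j)" for j
  have finP: "finite (P j)" for j
    by (rule finite_subset[of _ "{i. f j < f i} \<union> {..<j}"]) (use fin in \<open>auto simp: P_def\<close>)
  have r_less: "r i < r j" if "i \<in> P j" for i j
    unfolding r_def using that finP by (intro psubset_card_mono) (auto simp: P_def)
  have tri: "i \<in> P j \<or> j \<in> P i \<or> i = j" for i j
    by (auto simp: P_def)
  have inj: "inj r"
    by (rule injI) (metis tri r_less less_irrefl)
  \<comment> \<open>The ranks of the \<open>r j\<close> predecessors are distinct and below
    \<open>r j\<close>, hence exhaust these numbers. So the range of \<open>r\<close> is closed
    downwards, and being infinite it is everything.\<close>
  have rP: "r ` P j = {..<r j}" for j
    by (rule card_subset_eq) (auto simp: r_less card_image inj_on_subset[OF inj] r_def[symmetric])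
  have "surj r"
  unfolding surj_def proof
    fix n
    have "infinite (range r)" using inj by (simp add: finite_image_iff)
    then obtain m where "m \<in> range r" "n < m"
      by (meson finite_nat_iff_bounded_le infinite_nat_iff_unbounded)
    then show "\<exists>x. n = r x" using rP by (metis imageE lessThan_iff)
  qed
  then have bij: "bij r" using inj by (simp add: bij_def)
  have "decseq (\<lambda>n. f (inv r n))"
  proof (rule decseq_SucI)
    fix n
    define i j where "i = inv r n" and "j = inv r (Suc n)"
    have "r i = n" "r j = Suc n" using bij by (auto simp: i_def j_def bij_def surj_f_inv_f)
    then have "i \<in> P j" using tri[of i j] r_less by force
    then show "f (inv r (Suc n)) \<le> f (inv r n)"
      by (auto simp: P_def i_def[symmetric] j_def[symmetric])
  qed
  moreover have "points UNIV (\<lambda>n. f (inv r n)) = points UNIV f"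
    by (rule points_bij) (rule bij_imp_bij_inv[OF bij])
  ultimately show "\<exists>v. decreasing_arrangement v (points UNIV f)"
    unfolding decreasing_arrangement_def by blast
qed

text \<open>The same definite description as inside \<open>PD\<close>, so that \<open>PD\<close> is
  by unfolding the law of \<open>ranked (stick_breaking u)\<close>.\<close>

definition ranked :: "(nat \<Rightarrow> real) \<Rightarrow> nat \<Rightarrow> real" where
  "ranked f = (THE v. decreasing_arrangement v (points UNIV f))"

lemma ranked_eqI: "decreasing_arrangement v (points UNIV f) \<Longrightarrow> ranked f = v"
  unfolding ranked_def by (rule the_equality) (auto intro: decreasing_arrangement_unique)

lemma decreasing_arrangement_ranked:
  "(\<And>j. finite {i. f j < f i}) \<Longrightarrow> decreasing_arrangement (ranked f) (points UNIV f)"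
  using ex_decreasing_arrangement_iff[of f] ranked_eqI by blast

lemma ranked_decseq: "decseq f \<Longrightarrow> ranked f = f"
  by (rule ranked_eqI) (simp add: decreasing_arrangement_def)

lemma finite_above_of_tendsto_0:
  fixes f :: "nat \<Rightarrow> real"
  assumes "f \<longlonglongrightarrow> 0" "0 < x"
  shows "finite {i. x \<le> f i}"
proof -
  have "eventually (\<lambda>n. f n < x) sequentially" using assms by (rule order_tendstoD)
  then obtain N where "\<And>n. N \<le> n \<Longrightarrow> f n < x" by (auto simp: eventually_sequentially)
  then have "{i. x \<le> f i} \<subseteq> {..<N}" by (auto simp: not_le[symmetric])
  then show ?thesis by (rule finite_subset) simp
qed

lemma tendsto_0_of_finite_above:
  fixes f :: "nat \<Rightarrow> real"
  assumes "\<And>x. 0 < x \<Longrightarrow> finite {i. x \<le> f i}" "\<And>i. 0 < f i"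
  shows "f \<longlonglongrightarrow> 0"
proof (rule order_tendstoI)
  fix a :: real assume "0 < a"
  then have "finite {i. a \<le> f i}" by (rule assms)
  then show "eventually (\<lambda>n. f n < a) sequentially"
    by (simp add: cofinite_eq_sequentially[symmetric] eventually_cofinite not_less)
next
  fix a :: real assume "a < 0"
  then show "eventually (\<lambda>n. a < f n) sequentially"
    using assms(2) by (intro always_eventually) (auto intro: less_trans)
qed

lemma decreasing_arrangement_ranked_tendsto:
  fixes f :: "nat \<Rightarrow> real"
  assumes "f \<longlonglongrightarrow> 0" "\<And>i. 0 < f i"
  shows "decreasing_arrangement (ranked f) (points UNIV f)"
proof (rule decreasing_arrangement_ranked)
  fix j
  show "finite {i. f j < f i}"
    by (rule finite_subset[OF _ finite_above_of_tendsto_0[OF assms(1) assms(2)[of j]]]) auto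
qed

abbreviation seq_borel :: "(nat \<Rightarrow> real) measure" where
  "seq_borel \<equiv> PiM UNIV (\<lambda>_. borel)"

text \<open>Sequences with an arrangement form a measurable set, on which the level events of an
  entry are conditions on counts. Off this set the value is one fixed unspecified sequence.\<close>

lemma measurable_ranked [measurable]: "ranked \<in> measurable seq_borel seq_borel"
proof (rule measurable_PiM_single')
  fix n :: nat
  \<comment> \<open>Existence of an arrangement, with finiteness spelled out by quantifiers over
    \<open>nat\<close> so that measurability is a matter of countable operations.\<close>
  define G where "G f \<longleftrightarrow> (\<forall>j. \<exists>m. \<forall>i\<ge>m. \<not> f j < f i)" for f :: "nat \<Rightarrow> real"
  have G: "G f \<longleftrightarrow> (\<exists>v. decreasing_arrangement v (points UNIV f))" for f
  proof -
    have "(\<exists>m. \<forall>i\<ge>m. \<not> f j < f i) \<longleftrightarrow> finite {i. f j < f i}" for j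
      unfolding finite_nat_set_iff_bounded mem_Collect_eq Ball_def by (metis not_le)
    then show ?thesis by (simp add: ex_decreasing_arrangement_iff G_def)
  qed
  have [measurable]: "Measurable.pred seq_borel G"
    unfolding G_def by measurable
  have eq: "x \<le> ranked f n \<longleftrightarrow>
      (if G f then of_nat (Suc n) \<le> (\<Sum>i. indicator {x..} (f i) :: ennreal)
       else x \<le> (THE v. False) n)" for f x
  proof (cases "G f")
    case True
    then obtain v where v: "decreasing_arrangement v (points UNIV f)" by (auto simp: G)
    then show ?thesis
      using True decseq_ge_iff[of v x n]
      by (simp add: ranked_eqI decreasing_arrangement_def emeasure_points_suminf del: of_nat_Suc)
  next
    case False
    then have "(\<lambda>v. decreasing_arrangement v (points UNIV f)) = (\<lambda>v. False)" by (auto simp: G)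
    then show ?thesis using False by (simp add: ranked_def)
  qed
  have "{f \<in> space seq_borel. x \<le> ranked f n} \<in> sets seq_borel" for x
    unfolding eq by measurable
  then show "(\<lambda>f. ranked f n) \<in> measurable seq_borel borel"
    by (auto simp: borel_measurable_iff_ge space_PiM)
qed (auto simp: space_PiM)

section \<open>Products over points and uniqueness of the law\<close>

text \<open>For factors at most 1 the partial products decrease, so the infimum is the infinite
  product. As an infimum it is defined and measurable without any convergence hypothesis.\<close>

definition gprod :: "('a \<Rightarrow> ennreal) \<Rightarrow> (nat \<Rightarrow> 'a) \<Rightarrow> ennreal" where
  "gprod g x = (INF n. \<Prod>i<n. g (x i))"

lemma prod_le_1_ennreal: "(\<And>i. i \<in> A \<Longrightarrow> f i \<le> (1::ennreal)) \<Longrightarrow> prod f A \<le> 1"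
  using prod_mono_ennreal[of A f "\<lambda>_. 1"] by simp

lemma decseq_prod_ennreal:
  fixes f :: "nat \<Rightarrow> ennreal"
  assumes "\<And>i. f i \<le> 1"
  shows "decseq (\<lambda>n. \<Prod>i<n. f i)"
  proof (rule decseq_SucI)
  fix n
  show "(\<Prod>i<Suc n. f i) \<le> (\<Prod>i<n. f i)"
    using mult_left_mono[OF assms[of n], of "\<Prod>i<n. f i"] by simp
qed

lemma gprod_le_prod: "gprod g x \<le> (\<Prod>i<n. g (x i))"
  unfolding gprod_def by (rule INF_lower) simp

lemma gprod_le_1: "gprod g x \<le> 1"
  using gprod_le_prod[of g x 0] by simp

lemma gprod_LIMSEQ:
  assumes "\<And>q. g q \<le> 1"
  shows "(\<lambda>n. \<Prod>i<n. g (x i)) \<longlonglongrightarrow> gprod g x"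
  unfolding gprod_def by (rule LIMSEQ_INF) (rule decseq_prod_ennreal[OF assms])

lemma gprod_eq_prod:
  assumes "\<And>q. g q \<le> 1" "\<And>n. N \<le> n \<Longrightarrow> g (x n) = 1"
  shows "gprod g x = (\<Prod>i<N. g (x i))"
proof (rule LIMSEQ_unique[OF gprod_LIMSEQ[OF assms(1)]])
  have "(\<Prod>i<n. g (x i)) = (\<Prod>i<N. g (x i))" if "N \<le> n" for n
  proof (rule prod.mono_neutral_right)
    show "\<forall>i\<in>{..<n} - {..<N}. g (x i) = 1"
      by (intro ballI assms(2)) (simp add: not_less)
  qed (use that in simp_all)
  then show "(\<lambda>n. \<Prod>i<n. g (x i)) \<longlonglongrightarrow> (\<Prod>i<N. g (x i))"
    by (intro tendsto_eventually eventually_sequentiallyI)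
qed

lemma measurable_gprod [measurable]:
  assumes [measurable]: "g \<in> borel_measurable M"
  shows "(\<lambda>x. gprod g x) \<in> borel_measurable (PiM UNIV (\<lambda>_. M))"
  unfolding gprod_def by measurable

text \<open>Any \<open>k\<close> of the infinitely many factors \<open>z\<close> already bound the
  product by \<open>z ^ k\<close>. This makes the functional detect configurations with infinitely
  many points above a level.\<close>

lemma gprod_const_eq_0:
  fixes p :: "nat \<Rightarrow> real"
  assumes "z < 1" "infinite {i. x \<le> p i}"
  shows "gprod (\<lambda>q. if x \<le> q then z else 1) p = 0"
proof -
  have "gprod (\<lambda>q. if x \<le> q then z else 1) p \<le> z ^ k" for k
  proof -
    obtain A where A: "A \<subseteq> {i. x \<le> p i}" "finite A" "card A = k"
      using infinite_arbitrarily_large[OF assms(2)] by metis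
    then obtain n where n: "A \<subseteq> {..<n}" using finite_nat_iff_bounded by blast
    have "(\<Prod>i<n. if x \<le> p i then z else 1) = (\<Prod>i\<in>{..<n} - A. if x \<le> p i then z else 1) *
        (\<Prod>i\<in>A. if x \<le> p i then z else 1)"
      by (rule prod.subset_diff[OF n]) simp
    also have "\<dots> \<le> 1 * (\<Prod>i\<in>A. if x \<le> p i then z else 1)"
      using assms(1) by (intro mult_right_mono prod_le_1_ennreal) auto
    also have "(\<Prod>i\<in>A. if x \<le> p i then z else 1) = (\<Prod>i\<in>A. z)"
      using A by (intro prod.cong) auto
    finally have "(\<Prod>i<n. if x \<le> p i then z else 1) \<le> z ^ k" using A by simp
    with gprod_le_prod[of _ p n] show ?thesis by (rule order_trans)
  qed
  moreover have "(\<lambda>k. z ^ k) \<longlonglongrightarrow> 0"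
  proof -
    obtain r where r: "z = ennreal r" "0 \<le> r" "r < 1"
      using assms(1) by (cases z) (auto simp: ennreal_less_one_iff)
    have "(\<lambda>k. ennreal (r ^ k)) \<longlonglongrightarrow> ennreal 0"
      using r by (intro tendsto_ennrealI LIMSEQ_realpow_zero)
    then show ?thesis using r by (simp add: ennreal_power)
  qed
  ultimately have "gprod (\<lambda>q. if x \<le> q then z else 1) p \<le> 0"
    by (intro LIMSEQ_le_const) auto
  then show ?thesis by simp
qed

text \<open>Only finitely many points of a null sequence reach the lowest level, so the product is
  finite and can be regrouped level by level. The expectation of the right-hand side is a joint
  generating function of the counts.\<close>

lemma gprod_step:
  fixes p :: "nat \<Rightarrow> real"
  assumes "p \<longlonglongrightarrow> 0" "\<And>i. i \<in> I \<Longrightarrow> 0 < x i" "\<And>i. i \<in> I \<Longrightarrow> z i \<le> 1" "finite I"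
  shows "gprod (\<lambda>q. \<Prod>i\<in>I. if x i \<le> q then z i else 1) p = (\<Prod>i\<in>I. z i ^ card {n. x i \<le> p n})"
proof -
  have "finite (\<Union>i\<in>I. {n. x i \<le> p n})"
    using assms by (intro finite_UN_I finite_above_of_tendsto_0) auto
  then obtain N where N: "(\<Union>i\<in>I. {n. x i \<le> p n}) \<subseteq> {..<N}"
    using finite_nat_iff_bounded by blast
  have "gprod (\<lambda>q. \<Prod>i\<in>I. if x i \<le> q then z i else 1) p =
      (\<Prod>n<N. \<Prod>i\<in>I. if x i \<le> p n then z i else 1)"
  proof (rule gprod_eq_prod)
    show "(\<Prod>i\<in>I. if x i \<le> q then z i else 1) \<le> 1" for q
      using assms(3) by (intro prod_le_1_ennreal) auto
    show "(\<Prod>i\<in>I. if x i \<le> p n then z i else 1) = 1" if "N \<le> n" for n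
      using N that by (intro prod.neutral) (auto simp: subset_eq, meson leD)
  qed
  also have "\<dots> = (\<Prod>i\<in>I. \<Prod>n<N. if x i \<le> p n then z i else 1)"
    by (rule prod.swap)
  also have "\<dots> = (\<Prod>i\<in>I. z i ^ card {n. x i \<le> p n})"
  proof (rule prod.cong[OF refl])
    fix i assume "i \<in> I"
    then have "{n. n < N \<and> x i \<le> p n} = {n. x i \<le> p n}" using N by auto
    then have "{..<N} \<inter> {n. x i \<le> p n} = {n. x i \<le> p n}" by auto
    then show "(\<Prod>n<N. if x i \<le> p n then z i else 1) = z i ^ card {n. x i \<le> p n}"
      by (subst prod.If_cases) simp_all
  qed
  finally show ?thesis .
qed

section \<open>Generating functions and the joint law of the counts above finitely many
  levels\<close>

lemma power_series_coeff_eq_0: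
  fixes d :: "nat \<Rightarrow> real"
  assumes "\<And>n. \<bar>d n\<bar> \<le> B" "\<And>z. 0 < z \<Longrightarrow> z < 1 \<Longrightarrow> (\<lambda>n. d n * z ^ n) sums 0"
  shows "d m = 0"
proof (induction m rule: less_induct)
  case (less m)
  have B: "0 \<le> B" using assms(1)[of 0] by linarith
  \<comment> \<open>The earlier coefficients vanish by induction. After division by
    \<open>z ^ m\<close> the tail of the series equals \<open>- d m\<close>, and it is at most
    \<open>B * z / (1 - z)\<close>, which tends to 0 with \<open>z\<close>.\<close>
  have bound: "\<bar>d m\<bar> \<le> B * z / (1 - z)" if z: "0 < z" "z < 1" for z
  proof -
    have "(\<lambda>n. d (n + m) * z ^ (n + m)) sums (0 - (\<Sum>n<m. d n * z ^ n))"
      using assms(2)[OF z] by (rule sums_split_initial_segment)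
    then have "(\<lambda>n. d (n + m) * z ^ (n + m) / z ^ m) sums ((0 - (\<Sum>n<m. d n * z ^ n)) / z ^ m)"
      by (rule sums_divide)
    moreover have "(\<Sum>n<m. d n * z ^ n) = 0" using less.IH by simp
    ultimately have "(\<lambda>n. d (n + m) * z ^ n) sums 0" using z by (simp add: power_add)
    then have "(\<lambda>n. d (Suc n + m) * z ^ Suc n) sums (0 - d (0 + m) * z ^ 0)"
      by (subst sums_Suc_iff) simp
    then have s: "(\<lambda>n. d (Suc n + m) * z ^ Suc n) sums (- d m)" by simp
    have g: "(\<lambda>n. B * z * z ^ n) sums (B * z * (1 / (1 - z)))"
      using z by (intro sums_mult geometric_sums) auto
    have "norm (\<Sum>n. d (Suc n + m) * z ^ Suc n) \<le> (\<Sum>n. B * z * z ^ n)"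
    proof (rule order_trans[OF summable_norm suminf_le])
      have le: "norm (d (Suc n + m) * z ^ Suc n) \<le> B * z * z ^ n" for n
        using z mult_right_mono[OF assms(1)[of "Suc n + m"], of "z ^ Suc n"] by (simp add: abs_mult ac_simps)
      then show "summable (\<lambda>n. norm (d (Suc n + m) * z ^ Suc n))"
        using g by (intro summable_comparison_test'[OF sums_summable[OF g]]) auto
      then show "summable (\<lambda>n. norm (d (Suc n + m) * z ^ Suc n))" .
      show "norm (d (Suc n + m) * z ^ Suc n) \<le> B * z * z ^ n" for n by (rule le)
      show "summable (\<lambda>n. B * z * z ^ n)" using g by (rule sums_summable)
    qed
    then show ?thesis using s g by (simp add: sums_iff)
  qed
  have "((\<lambda>z. B * z / (1 - z)) \<longlongrightarrow> B * 0 / (1 - 0)) (at_right 0)"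
    by (intro tendsto_intros) auto
  moreover have "eventually (\<lambda>z. \<bar>d m\<bar> \<le> B * z / (1 - z)) (at_right 0)"
    unfolding eventually_at_right_field using bound by (intro exI[of _ 1]) auto
  ultimately have "\<bar>d m\<bar> \<le> B * 0 / (1 - 0)"
    by (rule tendsto_lowerbound) simp
  then show ?case by simp
qed

lemma nn_integral_weighted_nat:
  fixes C :: "'a \<Rightarrow> nat"
  assumes [measurable]: "C \<in> measurable M (count_space UNIV)" "W \<in> borel_measurable M"
  shows "(\<integral>\<^sup>+w. W w * \<phi> (C w) \<partial>M) = (\<Sum>n. (\<integral>\<^sup>+w. W w * indicator {n} (C w) \<partial>M) * \<phi> n)"
proof -
  have C: "(\<lambda>w. h (C w)) \<in> borel_measurable M" for h :: "nat \<Rightarrow> ennreal"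
    by (rule measurable_compose[OF assms(1)]) simp
  have "W w * \<phi> (C w) = (\<Sum>n. W w * indicator {n} (C w) * \<phi> n)" for w
    by (subst suminf_finite[where N="{C w}"]) auto
  then have "(\<integral>\<^sup>+w. W w * \<phi> (C w) \<partial>M) = (\<integral>\<^sup>+w. (\<Sum>n. W w * indicator {n} (C w) * \<phi> n) \<partial>M)"
    by (intro nn_integral_cong)
  also have "\<dots> = (\<Sum>n. (\<integral>\<^sup>+w. W w * indicator {n} (C w) * \<phi> n \<partial>M))"
    by (intro nn_integral_suminf borel_measurable_times_ennreal C borel_measurable_const assms(2))
  finally show ?thesis using C assms(2) by (simp add: nn_integral_multc)
qed

text \<open>Both sides of the hypothesis are power series in \<open>z\<close> whose bounded
  coefficients are the weighted masses of the events that the count is \<open>n\<close>; equal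
  series have equal coefficients. The weight allows the factors of all other levels to be carried
  along while one level is treated.\<close>

lemma weighted_nat_law_unique:
  fixes C :: "'a \<Rightarrow> nat" and C' :: "'b \<Rightarrow> nat"
  assumes C: "C \<in> measurable M (count_space UNIV)" "W \<in> borel_measurable M"
    and C': "C' \<in> measurable N (count_space UNIV)" "W' \<in> borel_measurable N"
    and fin: "integral\<^sup>N M W < \<infinity>" "integral\<^sup>N N W' < \<infinity>"
    and eq: "\<And>z::real. 0 < z \<Longrightarrow> z < 1 \<Longrightarrow>
      (\<integral>\<^sup>+w. W w * ennreal z ^ C w \<partial>M) = (\<integral>\<^sup>+w. W' w * ennreal z ^ C' w \<partial>N)"
  shows "(\<integral>\<^sup>+w. W w * \<phi> (C w) \<partial>M) = (\<integral>\<^sup>+w. W' w * \<phi> (C' w) \<partial>N)"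
proof -
  define a where "a n = (\<integral>\<^sup>+w. W w * indicator {n} (C w) \<partial>M)" for n
  define b where "b n = (\<integral>\<^sup>+w. W' w * indicator {n} (C' w) \<partial>N)" for n
  have a: "a n \<le> integral\<^sup>N M W" for n
    unfolding a_def by (intro nn_integral_mono) (auto simp: indicator_def)
  have b: "b n \<le> integral\<^sup>N N W'" for n
    unfolding b_def by (intro nn_integral_mono) (auto simp: indicator_def)
  obtain A where A: "integral\<^sup>N M W = ennreal A" "0 \<le> A"
    using fin(1) by (cases "integral\<^sup>N M W") auto
  obtain B where B: "integral\<^sup>N N W' = ennreal B" "0 \<le> B"
    using fin(2) by (cases "integral\<^sup>N N W'") auto
  have "\<exists>r\<ge>0. r \<le> A \<and> a n = ennreal r" for n
    using a[of n] A by (cases "a n") (auto simp: top_unique)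
  then obtain \<alpha> where \<alpha>: "\<And>n. 0 \<le> \<alpha> n" "\<And>n. \<alpha> n \<le> A" "\<And>n. a n = ennreal (\<alpha> n)" by metis
  have "\<exists>r\<ge>0. r \<le> B \<and> b n = ennreal r" for n
    using b[of n] B by (cases "b n") (auto simp: top_unique)
  then obtain \<beta> where \<beta>: "\<And>n. 0 \<le> \<beta> n" "\<And>n. \<beta> n \<le> B" "\<And>n. b n = ennreal (\<beta> n)" by metis
  have "\<alpha> m - \<beta> m = 0" for m
  proof (rule power_series_coeff_eq_0)
    show "\<bar>\<alpha> n - \<beta> n\<bar> \<le> A + B" for n
      using \<alpha>(1,2)[of n] \<beta>(1,2)[of n] by linarith
  next
    fix z :: real assume z: "0 < z" "z < 1"
    have summ: "summable (\<lambda>n. c n * z ^ n)" if "\<And>n. c n \<le> D" "\<And>n. 0 \<le> c n" for c :: "nat \<Rightarrow> real" and D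
    proof (rule summable_comparison_test')
      show "summable (\<lambda>n. D * z ^ n)" using z by (intro summable_mult summable_geometric) auto
      show "norm (c n * z ^ n) \<le> D * z ^ n" if "n \<ge> 0" for n
        using z \<open>c n \<le> D\<close> \<open>0 \<le> c n\<close> by (simp add: abs_mult mult_right_mono)
    qed
    have sum: "summable (\<lambda>n. \<alpha> n * z ^ n)" "summable (\<lambda>n. \<beta> n * z ^ n)"
      by (rule summ, rule \<alpha>, rule \<alpha>) (rule summ, rule \<beta>, rule \<beta>)
    have conv: "(\<Sum>n. ennreal (c n) * ennreal z ^ n) = ennreal (\<Sum>n. c n * z ^ n)"
      if "\<And>n. 0 \<le> c n" "summable (\<lambda>n. c n * z ^ n)" for c
    proof -
      have "ennreal (c n) * ennreal z ^ n = ennreal (c n * z ^ n)" for n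
        using z that(1) by (simp add: ennreal_power ennreal_mult)
      then show ?thesis using z that by (simp add: suminf_ennreal2)
    qed
    have "(\<Sum>n. a n * ennreal z ^ n) = (\<Sum>n. b n * ennreal z ^ n)"
      using eq[OF z] nn_integral_weighted_nat[OF C, of "\<lambda>n. ennreal z ^ n"]
        nn_integral_weighted_nat[OF C', of "\<lambda>n. ennreal z ^ n"]
      unfolding a_def b_def by simp
    then have "ennreal (\<Sum>n. \<alpha> n * z ^ n) = ennreal (\<Sum>n. \<beta> n * z ^ n)"
      unfolding \<alpha>(3) \<beta>(3) using conv[of \<alpha>] conv[of \<beta>] \<alpha>(1) \<beta>(1) sum by simp
    then have "(\<Sum>n. \<alpha> n * z ^ n) = (\<Sum>n. \<beta> n * z ^ n)"
      using z \<alpha>(1) \<beta>(1) sum by (subst (asm) ennreal_inj) (auto intro!: suminf_nonneg)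
    then show "(\<lambda>n. (\<alpha> n - \<beta> n) * z ^ n) sums 0"
      using sums_diff[OF summable_sums[OF sum(1)] summable_sums[OF sum(2)]]
      by (simp add: left_diff_distrib)
  qed
  then have "a m = b m" for m unfolding \<alpha>(3) \<beta>(3) by simp
  then show ?thesis
    using nn_integral_weighted_nat[OF C, of \<phi>] nn_integral_weighted_nat[OF C', of \<phi>]
    unfolding a_def b_def by simp
qed

lemma measurable_count_above [measurable]:
  "(\<lambda>p. card {n. x \<le> p n}) \<in> measurable seq_borel (count_space UNIV)"
proof -
  \<comment> \<open>Correct for infinite sets as well: \<open>card\<close> is 0 there, and
    \<open>enn2real\<close> sends the infinite sum to 0.\<close>
  have "card {n. x \<le> p n} = nat \<lfloor>enn2real (\<Sum>n. indicator {x..} (p n))\<rfloor>" for p :: "nat \<Rightarrow> real"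
  proof -
    have "(\<Sum>n. indicator {x..} (p n)) = emeasure (count_space UNIV) {n. x \<le> p n}"
      by (subst emeasure_points_suminf[symmetric]) (auto simp: emeasure_points)
    then show ?thesis by (simp add: emeasure_count_space)
  qed
  then show ?thesis by simp
qed

text \<open>Step functions \<open>g\<close> give the joint generating function of the numbers of points above finitely many
  levels, which determine the ranked points.\<close>

context
  fixes M :: "'a measure" and N :: "'b measure" and P :: "'a \<Rightarrow> nat \<Rightarrow> real" and Q :: "'b \<Rightarrow> nat \<Rightarrow> real"
  assumes prob: "prob_space M" "prob_space N"
    and P [measurable]: "P \<in> measurable M seq_borel" and Q [measurable]: "Q \<in> measurable N seq_borel"
    and pos: "AE w in M. \<forall>n. 0 < P w n" "AE w in N. \<forall>n. 0 < Q w n"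
    and Q0: "AE w in N. Q w \<longlonglongrightarrow> 0"
    and eq: "\<And>g \<epsilon>. g \<in> borel_measurable borel \<Longrightarrow> (\<And>q. g q \<le> 1) \<Longrightarrow> 0 < \<epsilon> \<Longrightarrow> (\<And>q. q < \<epsilon> \<Longrightarrow> g q = 1) \<Longrightarrow>
      (\<integral>\<^sup>+w. gprod g (P w) \<partial>M) = (\<integral>\<^sup>+w. gprod g (Q w) \<partial>N)"
begin

interpretation M: prob_space M by (rule prob)
interpretation N: prob_space N by (rule prob)

text \<open>Convergence to 0 is assumed for \<open>Q\<close> only and is inherited by
  \<open>P\<close> through the functionals. For \<open>g m\<close> the functional of
  \<open>P\<close> is at most 1 and vanishes if infinitely many points reach \<open>x\<close>, so
  its expectation is a lower bound for the probability of finiteness; for \<open>Q\<close> this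
  expectation tends to 1 as \<open>m\<close> grows.\<close>

lemma AE_finite_above:
  assumes x: "0 < x"
  shows "AE w in M. finite {n. x \<le> P w n}"
proof -
  \<comment> \<open>The factor increases to 1 with \<open>m\<close>; the summand 2 keeps it strictly
    between 0 and 1 already for \<open>m = 0\<close>.\<close>
  define g where "g m = (\<lambda>q. if x \<le> q then ennreal (1 - 1 / (real m + 2)) else 1)" for m :: nat
  have g_le: "g m q \<le> 1" for m q by (auto simp: g_def)
  have [measurable]: "g m \<in> borel_measurable borel" for m unfolding g_def by measurable
  have eqg: "(\<integral>\<^sup>+w. gprod (g m) (P w) \<partial>M) = (\<integral>\<^sup>+w. gprod (g m) (Q w) \<partial>N)" for m
    by (rule eq[OF _ g_le x]) (auto simp: g_def)
  have "gprod (g m) p = ennreal (1 - 1 / (real m + 2)) ^ card {n. x \<le> p n}" if "p \<longlonglongrightarrow> 0" for m p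
    using gprod_step[OF that, of "{0::nat}" "\<lambda>_. x" "\<lambda>_. ennreal (1 - 1 / (real m + 2))"] x
    by (simp add: g_def)
  moreover have "(\<lambda>m. ennreal (1 - 1 / (real m + 2)) ^ k) \<longlonglongrightarrow> 1" for k
  proof -
    have "(\<lambda>m. (1 - 1 / (real m + 2)) ^ k) \<longlonglongrightarrow> (1 - 0) ^ k"
      by (intro tendsto_power tendsto_diff tendsto_const) real_asymp
    then have "(\<lambda>m. ennreal ((1 - 1 / (real m + 2)) ^ k)) \<longlonglongrightarrow> ennreal 1"
      by (intro tendsto_ennrealI) simp
    then show ?thesis by (subst ennreal_power) (auto simp: field_simps)
  qed
  ultimately have lim: "(\<lambda>m. gprod (g m) p) \<longlonglongrightarrow> 1" if "p \<longlonglongrightarrow> 0" for p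
    using that by simp
  have "(\<lambda>m. \<integral>\<^sup>+w. gprod (g m) (Q w) \<partial>N) \<longlonglongrightarrow> (\<integral>\<^sup>+w. 1 \<partial>N)"
    by (rule nn_integral_dominated_convergence[where w="\<lambda>_. 1"])
       (use Q0 lim gprod_le_1 in \<open>auto simp: N.emeasure_space_1\<close>)
  then have "(\<lambda>m. \<integral>\<^sup>+w. gprod (g m) (P w) \<partial>M) \<longlonglongrightarrow> 1"
    by (simp add: eqg N.emeasure_space_1)
  moreover have "(\<integral>\<^sup>+w. gprod (g m) (P w) \<partial>M) \<le> emeasure M {w\<in>space M. finite {n. x \<le> P w n}}" for m
  proof -
    have *: "Measurable.pred M (\<lambda>w. finite {n. x \<le> P w n})"
      unfolding finite_nat_set_iff_bounded mem_Collect_eq Ball_def by measurable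
    have "(\<integral>\<^sup>+w. gprod (g m) (P w) \<partial>M) \<le> (\<integral>\<^sup>+w. indicator {w\<in>space M. finite {n. x \<le> P w n}} w \<partial>M)"
      using gprod_le_1 gprod_const_eq_0[of "ennreal (1 - 1 / (real m + 2))" x]
      by (intro nn_integral_mono) (auto simp: g_def indicator_def ennreal_less_one_iff)
    then show ?thesis using * by (simp add: pred_def)
  qed
  ultimately have "1 \<le> emeasure M {w\<in>space M. finite {n. x \<le> P w n}}"
    by (intro LIMSEQ_le_const2) auto
  then have "emeasure M {w\<in>space M. finite {n. x \<le> P w n}} = 1"
    using M.emeasure_le_1 by (rule antisym[rotated])
  then have "AE w in M. w \<in> {w\<in>space M. finite {n. x \<le> P w n}}"
    by (intro M.AE_prob_1) (simp add: measure_def)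
  then show ?thesis by auto
qed

lemma AE_tendsto_0: "AE w in M. P w \<longlonglongrightarrow> 0"
proof -
  have "AE w in M. \<forall>k. finite {n. 1 / real (Suc k) \<le> P w n}"
    unfolding AE_all_countable by (intro allI AE_finite_above) simp
  then show ?thesis using pos(1)
  proof eventually_elim
    case (elim w)
    show ?case
    proof (rule tendsto_0_of_finite_above)
      fix x :: real assume "0 < x"
      then obtain k where "1 / real (Suc k) < x" using nat_approx_posE by blast
      then have "{n. x \<le> P w n} \<subseteq> {n. 1 / real (Suc k) \<le> P w n}" by auto
      then show "finite {n. x \<le> P w n}" by (rule finite_subset) (use elim in blast)
    qed (use elim in blast)
  qed
qed

text \<open>The powers in the joint generating function are replaced by arbitrary functions of the
  counts one level at a time. In each step the factors of the other levels serve as the weight in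
  \<open>weighted_nat_law_unique\<close>.\<close>

lemma count_laws_eq:
  fixes x :: "nat \<Rightarrow> real" and \<phi> :: "nat \<Rightarrow> nat \<Rightarrow> ennreal"
  assumes "finite I" "\<And>i. i \<in> I \<Longrightarrow> 0 < x i" "\<And>i k. \<phi> i k \<le> 1"
  shows "(\<integral>\<^sup>+w. (\<Prod>i\<in>I. \<phi> i (card {n. x i \<le> P w n})) \<partial>M) = (\<integral>\<^sup>+w. (\<Prod>i\<in>I. \<phi> i (card {n. x i \<le> Q w n})) \<partial>N)"
proof -
  define C where "C i w = card {n. x i \<le> P w n}" for i w
  define D where "D i w = card {n. x i \<le> Q w n}" for i w
  have mC [measurable]: "C i \<in> measurable M (count_space UNIV)" for i
    unfolding C_def by measurable
  have mD [measurable]: "D i \<in> measurable N (count_space UNIV)" for i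
    unfolding D_def by measurable
  have mC' [measurable]: "(\<lambda>w. h (C i w)) \<in> borel_measurable M" for i and h :: "nat \<Rightarrow> ennreal"
    by (rule measurable_compose[OF mC]) simp
  have mD' [measurable]: "(\<lambda>w. h (D i w)) \<in> borel_measurable N" for i and h :: "nat \<Rightarrow> ennreal"
    by (rule measurable_compose[OF mD]) simp
  \<comment> \<open>\<open>J\<close> is the set of levels already treated; the others still carry
    the factor of the generating function.\<close>
  define \<psi> where "\<psi> J z i k = (if i \<in> J then \<phi> i k else ennreal (z i) ^ k)" for J :: "nat set" and z :: "nat \<Rightarrow> real" and i k
  have "(\<integral>\<^sup>+w. (\<Prod>i\<in>I. \<psi> J z i (C i w)) \<partial>M) = (\<integral>\<^sup>+w. (\<Prod>i\<in>I. \<psi> J z i (D i w)) \<partial>N)"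
    if "finite J" "J \<subseteq> I" "\<And>i. 0 < z i \<and> z i < 1" for J z
    using that
  proof (induction J arbitrary: z)
    case empty
    define g where "g = (\<lambda>q. \<Prod>i\<in>I. if x i \<le> q then ennreal (z i) else 1)"
    \<comment> \<open>The element 1 only keeps the minimum meaningful and positive when
      \<open>I\<close> is empty.\<close>
    define \<epsilon> where "\<epsilon> = Min (insert 1 (x ` I))"
    have \<epsilon>: "0 < \<epsilon>" "\<And>i. i \<in> I \<Longrightarrow> \<epsilon> \<le> x i" using assms(1,2) by (auto simp: \<epsilon>_def)
    have "(\<integral>\<^sup>+w. gprod g (P w) \<partial>M) = (\<integral>\<^sup>+w. gprod g (Q w) \<partial>N)"
    proof (rule eq[OF _ _ \<epsilon>(1)])
      show "g \<in> borel_measurable borel" unfolding g_def by measurable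
      show "g q \<le> 1" for q unfolding g_def
        using empty(2) by (intro prod_le_1_ennreal) (auto intro: less_imp_le)
      show "g q = 1" if "q < \<epsilon>" for q unfolding g_def
        using \<epsilon>(2) that by (intro prod.neutral) force
    qed
    moreover have "gprod g p = (\<Prod>i\<in>I. ennreal (z i) ^ card {n. x i \<le> p n})" if "p \<longlonglongrightarrow> 0" for p
      unfolding g_def using that assms(1,2) empty(2) by (intro gprod_step) (auto intro: less_imp_le)
    then have "(\<integral>\<^sup>+w. gprod g (P w) \<partial>M) = (\<integral>\<^sup>+w. (\<Prod>i\<in>I. ennreal (z i) ^ C i w) \<partial>M)"
        "(\<integral>\<^sup>+w. gprod g (Q w) \<partial>N) = (\<integral>\<^sup>+w. (\<Prod>i\<in>I. ennreal (z i) ^ D i w) \<partial>N)"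
      using AE_tendsto_0 Q0 by (auto intro!: nn_integral_cong_AE simp: C_def D_def)
    ultimately show ?case by (simp add: \<psi>_def)
  next
    case (insert j J)
    then have j: "j \<in> I" "J \<subseteq> I" by auto
    define V where "V w = (\<Prod>i\<in>I - {j}. \<psi> J z i (C i w))" for w
    define W where "W w = (\<Prod>i\<in>I - {j}. \<psi> J z i (D i w))" for w
    have \<psi>_le: "\<psi> J z i k \<le> 1" for i k
      unfolding \<psi>_def using assms(3) insert.prems(2)[of i]
      by (auto intro!: power_le_one simp: ennreal_power power_le_one)
    have mV [measurable]: "V \<in> borel_measurable M" and mW [measurable]: "W \<in> borel_measurable N"
      unfolding V_def W_def by (intro borel_measurable_prod_ennreal mC' mD')+
    have fin: "integral\<^sup>N M V < \<infinity>" "integral\<^sup>N N W < \<infinity>"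
    proof -
      have "integral\<^sup>N M V \<le> (\<integral>\<^sup>+w. 1 \<partial>M)"
        unfolding V_def by (intro nn_integral_mono prod_le_1_ennreal \<psi>_le)
      also have "\<dots> < \<infinity>" by (simp add: M.emeasure_space_1)
      finally show "integral\<^sup>N M V < \<infinity>" .
      have "integral\<^sup>N N W \<le> (\<integral>\<^sup>+w. 1 \<partial>N)"
        unfolding W_def by (intro nn_integral_mono prod_le_1_ennreal \<psi>_le)
      also have "\<dots> < \<infinity>" by (simp add: N.emeasure_space_1)
      finally show "integral\<^sup>N N W < \<infinity>" .
    qed
    have split: "(\<Prod>i\<in>I. \<psi> J' z' i (c i)) = (\<Prod>i\<in>I - {j}. \<psi> J z i (c i)) * \<psi> J' z' j (c j)"
      if "\<And>i k. i \<noteq> j \<Longrightarrow> \<psi> J' z' i k = \<psi> J z i k" for J' z' and c :: "nat \<Rightarrow> nat"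
      using that by (subst prod.remove[OF assms(1) j(1)]) (simp add: mult.commute)
    have "(\<integral>\<^sup>+w. V w * \<phi> j (C j w) \<partial>M) = (\<integral>\<^sup>+w. W w * \<phi> j (D j w) \<partial>N)"
    proof (rule weighted_nat_law_unique[OF mC mV mD mW fin])
      fix y :: real assume y: "0 < y" "y < 1"
      \<comment> \<open>Since \<open>j\<close> is not in \<open>J\<close>, changing \<open>z\<close>
        at \<open>j\<close> affects the factor of level \<open>j\<close> alone. The induction
        hypothesis for all such changes is the equality of generating functions in
        \<open>y\<close>.\<close>
      have e: "(\<Prod>i\<in>I. \<psi> J (z(j := y)) i (c i)) = (\<Prod>i\<in>I - {j}. \<psi> J z i (c i)) * ennreal y ^ c j" for c
        using insert.hyps(2) by (subst split) (simp_all add: \<psi>_def)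
      have "(\<integral>\<^sup>+w. (\<Prod>i\<in>I. \<psi> J (z(j := y)) i (C i w)) \<partial>M) = (\<integral>\<^sup>+w. (\<Prod>i\<in>I. \<psi> J (z(j := y)) i (D i w)) \<partial>N)"
        by (rule insert.IH[OF j(2)]) (use insert.prems(2) y in simp)
      then show "(\<integral>\<^sup>+w. V w * ennreal y ^ C j w \<partial>M) = (\<integral>\<^sup>+w. W w * ennreal y ^ D j w \<partial>N)"
        unfolding e V_def W_def .
    qed
    moreover have "(\<Prod>i\<in>I. \<psi> (Set.insert j J) z i (c i)) = (\<Prod>i\<in>I - {j}. \<psi> J z i (c i)) * \<phi> j (c j)" for c
      by (subst split) (simp_all add: \<psi>_def)
    ultimately show ?case
      unfolding V_def W_def by simp
  qed
  from this[of I "\<lambda>_. 1/2"] assms(1) show ?thesis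
    by (simp add: \<psi>_def C_def D_def)
qed

text \<open>Lower bounds on finitely many ranked entries define an intersection-stable generator of
  the product sigma-algebra, and each such event is a condition on finitely many counts.\<close>

theorem ranked_law_eq: "distr M seq_borel (\<lambda>w. ranked (P w)) = distr N seq_borel (\<lambda>w. ranked (Q w))"
proof -
  define E where "E = {{v :: nat \<Rightarrow> real. \<forall>n\<in>I. y n \<le> v n} | I y. finite I}"
  \<comment> \<open>For \<open>x \<le> 0\<close> the left side always holds as all points are
    positive, but infinitely many points reach \<open>x\<close> and \<open>card\<close> is 0; hence
    the guard \<open>0 < x\<close>.\<close>
  have ranked_iff: "x \<le> ranked p n \<longleftrightarrow> (0 < x \<longrightarrow> n < card {m. x \<le> p m})"
    if p: "p \<longlonglongrightarrow> 0" "\<forall>n. 0 < p n" for p x n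
  proof (cases "0 < x")
    case True
    have v: "decreasing_arrangement (ranked p) (points UNIV p)"
      using p by (intro decreasing_arrangement_ranked_tendsto) auto
    have fin: "finite {m. x \<le> p m}" by (rule finite_above_of_tendsto_0[OF p(1) True])
    have "x \<le> ranked p n \<longleftrightarrow> of_nat (Suc n) \<le> (of_nat (card {m. x \<le> p m}) :: ennreal)"
      using v decseq_ge_iff[of "ranked p" x n] fin
      by (simp add: decreasing_arrangement_def emeasure_points del: of_nat_Suc)
    also have "\<dots> \<longleftrightarrow> n < card {m. x \<le> p m}"
      by (simp only: of_nat_le_iff Suc_le_eq)
    finally show ?thesis using True by simp
  next
    case False
    have v: "decreasing_arrangement (ranked p) (points UNIV p)"
      using p by (intro decreasing_arrangement_ranked_tendsto) auto
    have "{m. x \<le> p m} = UNIV"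
      using False p(2) by (auto intro: less_imp_le order.trans simp: not_less)
    then have "x \<le> ranked p n"
      using v decseq_ge_iff[of "ranked p" x n]
      by (simp add: decreasing_arrangement_def emeasure_points emeasure_count_space del: of_nat_Suc)
    then show ?thesis using False by simp
  qed
  have "Int_stable E"
  proof (rule Int_stableI)
    fix a b assume "a \<in> E" "b \<in> E"
    then obtain I y J z where ab: "a = {v. \<forall>n\<in>I. y n \<le> v n}" "b = {v. \<forall>n\<in>J. z n \<le> v n}"
      and fin: "finite I" "finite J"
      by (auto simp: E_def)
    define u where "u n = (if n \<in> I then if n \<in> J then max (y n) (z n) else y n else z n)" for n
    have "a \<inter> b = {v. \<forall>n\<in>I \<union> J. u n \<le> v n}"
      unfolding ab u_def by (auto split: if_splits)
    then show "a \<inter> b \<in> E" using fin unfolding E_def by blast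
  qed
  have E_sets: "E \<subseteq> sets seq_borel"
  proof
    fix a assume "a \<in> E"
    then obtain I y where a: "a = {v \<in> space seq_borel. \<forall>n\<in>I. y n \<le> v n}" and "finite I"
      by (auto simp: E_def space_PiM)
    then show "a \<in> sets seq_borel" unfolding a by measurable
  qed
  have sets_eq: "sets seq_borel = sigma_sets UNIV E"
  proof
    show "sigma_sets UNIV E \<subseteq> sets seq_borel"
      using sets.sigma_sets_subset[OF E_sets] by (simp add: space_PiM)
    have "(\<lambda>v. v) \<in> measurable (sigma UNIV E) seq_borel"
    proof (rule measurable_PiM_single')
      fix n :: nat
      have "{v. x \<le> v n} \<in> E" for x :: real
        unfolding E_def mem_Collect_eq by (intro exI[of _ "{n}"] exI[of _ "\<lambda>_. x"]) auto
      then show "(\<lambda>v. v n) \<in> measurable (sigma UNIV E) borel"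
        unfolding borel_measurable_iff_ge by (auto simp: space_measure_of_conv)
    qed auto
    from measurable_sets[OF this] show "sets seq_borel \<subseteq> sigma_sets UNIV E" by auto
  qed
  show ?thesis
  proof (rule measure_eqI_generator_eq[OF \<open>Int_stable E\<close>, of UNIV _ _ "\<lambda>_. UNIV"])
    fix a assume "a \<in> E"
    then have [measurable]: "a \<in> sets seq_borel" using E_sets by auto
    obtain I y where a: "a = {v. \<forall>n\<in>I. y n \<le> v n}" and "finite I"
      using \<open>a \<in> E\<close> by (auto simp: E_def)
    \<comment> \<open>Only positive levels constrain the ranked points, and only for these does
      \<open>card\<close> count correctly.\<close>
    define J where "J = {n\<in>I. 0 < y n}"
    define \<phi> :: "nat \<Rightarrow> nat \<Rightarrow> ennreal" where "\<phi> n k = indicator {n<..} k" for n k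
    have ind: "indicator a (ranked p) = (\<Prod>n\<in>J. \<phi> n (card {m. y n \<le> p m}))"
      if "p \<longlonglongrightarrow> 0" "\<forall>n. 0 < p n" for p
    proof -
      have "ranked p \<in> a \<longleftrightarrow> (\<forall>n\<in>J. n < card {m. y n \<le> p m})"
        using ranked_iff[OF that] by (auto simp: a J_def)
      moreover have "(\<Prod>n\<in>J. \<phi> n (card {m. y n \<le> p m})) = of_bool (\<forall>n\<in>J. n < card {m. y n \<le> p m})"
        using \<open>finite I\<close> by (auto simp: \<phi>_def J_def intro!: prod.neutral)
      ultimately show ?thesis by (simp add: indicator_def)
    qed
    have "emeasure (distr M seq_borel (\<lambda>w. ranked (P w))) a = (\<integral>\<^sup>+w. indicator a (ranked (P w)) \<partial>M)"
      by (subst nn_integral_distr[symmetric, of _ _ seq_borel]) simp_all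
    also have "\<dots> = (\<integral>\<^sup>+w. (\<Prod>n\<in>J. \<phi> n (card {m. y n \<le> P w m})) \<partial>M)"
      using AE_tendsto_0 pos(1) ind by (intro nn_integral_cong_AE) auto
    also have "\<dots> = (\<integral>\<^sup>+w. (\<Prod>n\<in>J. \<phi> n (card {m. y n \<le> Q w m})) \<partial>N)"
      by (rule count_laws_eq) (use \<open>finite I\<close> in \<open>auto simp: J_def \<phi>_def indicator_def\<close>)
    also have "\<dots> = (\<integral>\<^sup>+w. indicator a (ranked (Q w)) \<partial>N)"
      using Q0 pos(2) ind by (intro nn_integral_cong_AE) auto
    also have "\<dots> = emeasure (distr N seq_borel (\<lambda>w. ranked (Q w))) a"
      by (subst nn_integral_distr[symmetric, of _ _ seq_borel]) simp_all
    finally show "emeasure (distr M seq_borel (\<lambda>w. ranked (P w))) a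
      = emeasure (distr N seq_borel (\<lambda>w. ranked (Q w))) a" .
  next
    interpret D: prob_space "distr M seq_borel (\<lambda>w. ranked (P w))"
      by (rule M.prob_space_distr) measurable
    show "emeasure (distr M seq_borel (\<lambda>w. ranked (P w))) UNIV \<noteq> \<infinity>"
      by (simp add: D.emeasure_finite)
  qed (auto simp: sets_eq E_def)
qed

end

section \<open>The Mecke formula for the unit-rate Poisson process on the half-line\<close>

lemma product_prob_spaceI: "(\<And>i. prob_space (M i)) \<Longrightarrow> product_prob_space M"
  by (simp add: product_prob_space_def product_prob_space_axioms_def product_sigma_finite_def prob_space_imp_sigma_finite)

definition exp_law :: "real measure" where
  "exp_law = density lborel (\<lambda>x. ennreal (exponential_density 1 x))"

definition exp_seq :: "(nat \<Rightarrow> real) measure" where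
  "exp_seq = PiM UNIV (\<lambda>_. exp_law)"

definition arrivals :: "(nat \<Rightarrow> real) \<Rightarrow> nat \<Rightarrow> real" where
  "arrivals u n = (\<Sum>j\<le>n. u j)"

definition delete_at :: "nat \<Rightarrow> (nat \<Rightarrow> 'a) \<Rightarrow> nat \<Rightarrow> 'a" where
  "delete_at i x n = (if n < i then x n else x (Suc n))"

definition insert_at :: "nat \<Rightarrow> 'a \<Rightarrow> (nat \<Rightarrow> 'a) \<Rightarrow> nat \<Rightarrow> 'a" where
  "insert_at i y x n = (if n < i then x n else if n = i then y else x (n - 1))"

lemma sets_exp_law [measurable_cong, simp]: "sets exp_law = sets borel"
  by (simp add: exp_law_def)

lemma space_exp_law [simp]: "space exp_law = UNIV"
  by (simp add: exp_law_def)

lemma prob_space_exp_law: "prob_space exp_law"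
  unfolding exp_law_def by (rule prob_space_exponential_density) simp

lemma sets_exp_seq [measurable_cong, simp]: "sets exp_seq = sets seq_borel"
  unfolding exp_seq_def by (rule sets_PiM_cong) auto

lemma space_exp_seq [simp]: "space exp_seq = UNIV"
  using sets_eq_imp_space_eq[OF sets_exp_seq] by (simp add: space_PiM)

lemma prob_space_exp_seq: "prob_space exp_seq"
  unfolding exp_seq_def by (rule prob_space_PiM) (rule prob_space_exp_law)

interpretation exp_law: prob_space exp_law by (rule prob_space_exp_law)

interpretation exp_seq: prob_space exp_seq by (rule prob_space_exp_seq)

lemma emeasure_exp_seq_UNIV [simp]: "emeasure exp_seq UNIV = 1"
  using exp_seq.emeasure_space_1 by simp

lemma nn_integral_exp_law:
  "f \<in> borel_measurable borel \<Longrightarrow>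
    (\<integral>\<^sup>+x. f x \<partial>exp_law) = (\<integral>\<^sup>+x. ennreal (exponential_density 1 x) * f x \<partial>lborel)"
  unfolding exp_law_def by (rule nn_integral_density) auto

lemma measurable_arrivals [measurable]: "arrivals \<in> measurable seq_borel seq_borel"
  by (rule measurable_PiM_single') (auto simp: arrivals_def)

lemma in_space_seq_borel [measurable, simp]: "u \<in> space seq_borel"
  by (simp add: space_PiM)

lemma measurable_fun_upd_seq [measurable]:
  assumes [measurable]: "f \<in> measurable M seq_borel" "g \<in> borel_measurable M"
  shows "(\<lambda>x. (f x)(i := g x)) \<in> measurable M seq_borel"
proof (rule measurable_PiM_single')
  fix j show "(\<lambda>x. ((f x)(i := g x)) j) \<in> measurable M borel" by (cases "j = i") auto
qed (auto simp: space_PiM)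

lemma measurable_delete_at [measurable]: "delete_at i \<in> measurable seq_borel seq_borel"
  by (rule measurable_PiM_single') (auto simp: delete_at_def)

lemma measurable_insert_at [measurable]:
  assumes [measurable]: "f \<in> measurable M seq_borel" "g \<in> borel_measurable M"
  shows "(\<lambda>x. insert_at i (g x) (f x)) \<in> measurable M seq_borel"
proof (rule measurable_PiM_single')
  fix j show "(\<lambda>x. insert_at i (g x) (f x) j) \<in> measurable M borel"
    by (cases "j < i"; cases "j = i") (auto simp: insert_at_def)
qed (auto simp: space_PiM)

text \<open>Coordinate \<open>k\<close> is independent of the others, so it may be resampled. This
  isolates one variable of integration while staying on the full sequence space.\<close>

lemma nn_integral_PiM_update:
  assumes M: "\<And>i::nat. prob_space (M i)" and f [measurable]: "f \<in> borel_measurable (PiM UNIV M)"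
  shows "(\<integral>\<^sup>+u. f u \<partial>PiM UNIV M) = (\<integral>\<^sup>+u. \<integral>\<^sup>+y. f (u(k := y)) \<partial>M k \<partial>PiM UNIV M)"
proof -
  let ?D = "distr (M k \<Otimes>\<^sub>M PiM UNIV M) (PiM UNIV M) (\<lambda>(y, u). u(k := y))"
  interpret P: prob_space "PiM UNIV M" by (rule prob_space_PiM) (rule M)
  interpret K: prob_space "M k" by (rule M)
  interpret KP: pair_sigma_finite "M k" "PiM UNIV M" ..
  have [measurable]: "(\<lambda>(y, u). u(k := y)) \<in> measurable (M k \<Otimes>\<^sub>M PiM UNIV M) (PiM UNIV M)"
    using measurable_compose[OF measurable_pair_swap' measurable_add_dim[of k UNIV M]]
    by (simp add: case_prod_unfold)
  have "PiM UNIV M = ?D"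
    using distr_pair_PiM_eq_PiM[of UNIV M k] M by simp
  then have "(\<integral>\<^sup>+u. f u \<partial>PiM UNIV M) = (\<integral>\<^sup>+u. f u \<partial>?D)"
    by simp
  also have "\<dots> = (\<integral>\<^sup>+x. f ((snd x)(k := fst x)) \<partial>(M k \<Otimes>\<^sub>M PiM UNIV M))"
    by (subst nn_integral_distr) (auto simp: case_prod_unfold)
  also have "\<dots> = (\<integral>\<^sup>+u. \<integral>\<^sup>+y. f (u(k := y)) \<partial>M k \<partial>PiM UNIV M)"
    by (subst KP.nn_integral_snd[symmetric]) (auto simp: case_prod_unfold)
  finally show ?thesis .
qed

lemma nn_integral_exp_seq_update:
  assumes "f \<in> borel_measurable seq_borel"
  shows "(\<integral>\<^sup>+u. f u \<partial>exp_seq) = (\<integral>\<^sup>+u. \<integral>\<^sup>+y. f (u(k := y)) \<partial>exp_law \<partial>exp_seq)"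
  unfolding exp_seq_def
  by (rule nn_integral_PiM_update[OF prob_space_exp_law])
     (use assms in \<open>simp add: exp_seq_def[symmetric] measurable_cong_sets[OF sets_exp_seq refl]\<close>)

text \<open>An i.i.d. sequence keeps its law when a fresh independent value is put in at position
  \<open>i\<close> and the later entries move up: reading an i.i.d. sequence along an injection of
  indices again gives an i.i.d. sequence.\<close>

lemma nn_integral_exp_seq_insert:
  assumes f [measurable]: "f \<in> borel_measurable seq_borel"
  shows "(\<integral>\<^sup>+u. f u \<partial>exp_seq) = (\<integral>\<^sup>+u. \<integral>\<^sup>+x. f (insert_at i x u) \<partial>exp_law \<partial>exp_seq)"
proof -
  define J where "J = UNIV - {i}"
  let ?PJ = "PiM J (\<lambda>_. exp_law)"
  let ?D = "distr (exp_law \<Otimes>\<^sub>M ?PJ) exp_seq (\<lambda>(y, u). u(i := y))"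
  \<comment> \<open>The position in the original sequence from which position \<open>n\<close> other
    than \<open>i\<close> is filled; it is injective there.\<close>
  define s where "s n = (if n < i then n else n - 1)" for n :: nat
  interpret X: prob_space exp_law by (rule prob_space_exp_law)
  interpret E: prob_space exp_seq by (rule prob_space_exp_seq)
  interpret XE: pair_sigma_finite exp_law exp_seq ..
  have 1: "?PJ = distr exp_seq (?PJ) (\<lambda>w. \<lambda>n\<in>J. w (s n))"
    unfolding exp_seq_def
    by (rule distr_PiM_reindex[symmetric]) (auto simp: inj_on_def s_def J_def prob_space_exp_law split: if_splits)
  interpret PJ: prob_space "?PJ" by (rule prob_space_PiM) (rule prob_space_exp_law)
  interpret XJ: pair_sigma_finite exp_law "?PJ" ..
  have upd: "(\<lambda>(y, u). u(i := y)) \<in> measurable (exp_law \<Otimes>\<^sub>M ?PJ) exp_seq"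
  proof -
    have "insert i J = UNIV" by (auto simp: J_def)
    then show ?thesis
      using measurable_compose[OF measurable_pair_swap' measurable_add_dim[of i J "\<lambda>_. exp_law"]]
      by (simp add: case_prod_unfold exp_seq_def)
  qed
  have "exp_seq = ?D"
    using distr_pair_PiM_eq_PiM[of J "\<lambda>_. exp_law" i] prob_space_exp_law
    by (simp add: exp_seq_def J_def insert_absorb)
  then have "(\<integral>\<^sup>+u. f u \<partial>exp_seq) = (\<integral>\<^sup>+u. f u \<partial>?D)"
    by simp
  also have "\<dots> = (\<integral>\<^sup>+z. f ((snd z)(i := fst z)) \<partial>(exp_law \<Otimes>\<^sub>M ?PJ))"
    by (subst nn_integral_distr[OF upd]) (auto simp: case_prod_unfold)
  also have "\<dots> = (\<integral>\<^sup>+x. \<integral>\<^sup>+v. f (v(i := x)) \<partial>?PJ \<partial>exp_law)"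
    using measurable_compose[OF upd, of f] 
    by (subst PJ.nn_integral_fst[symmetric]) (auto simp: case_prod_unfold)
  also have "\<dots> = (\<integral>\<^sup>+x. \<integral>\<^sup>+u. f ((\<lambda>n\<in>J. u (s n))(i := x)) \<partial>exp_seq \<partial>exp_law)"
  proof (rule nn_integral_cong)
    fix x
    have "(\<lambda>v. f (v(i := x))) \<in> borel_measurable (?PJ)"
    proof (rule measurable_compose[where g=f])
      show "(\<lambda>v. v(i := x)) \<in> measurable (?PJ) exp_seq"
        using measurable_compose[OF measurable_Pair1' upd, of x] by simp
    qed measurable
    moreover have "(\<lambda>w. \<lambda>n\<in>J. w (s n)) \<in> measurable exp_seq (?PJ)"
      unfolding exp_seq_def by (rule measurable_restrict) auto
    ultimately show "(\<integral>\<^sup>+v. f (v(i := x)) \<partial>?PJ) = (\<integral>\<^sup>+u. f ((\<lambda>n\<in>J. u (s n))(i := x)) \<partial>exp_seq)"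
      by (subst 1, subst nn_integral_distr) auto
  qed
  also have "\<dots> = (\<integral>\<^sup>+x. \<integral>\<^sup>+u. f (insert_at i x u) \<partial>exp_seq \<partial>exp_law)"
    by (intro nn_integral_cong arg_cong[where f=f]) (auto simp: J_def s_def insert_at_def fun_eq_iff)
  also have "\<dots> = (\<integral>\<^sup>+u. \<integral>\<^sup>+x. f (insert_at i x u) \<partial>exp_law \<partial>exp_seq)"
    by (rule XE.Fubini'[symmetric]) (auto simp: case_prod_unfold)
  finally show ?thesis .
qed

text \<open>The product of the densities of \<open>z - x\<close> and \<open>x\<close> is
  \<open>exp (- z)\<close>, free of \<open>x\<close>. Hence Lebesgue measure on
  \<open>{0<..z}\<close> appears for \<open>x\<close>, and \<open>z\<close> keeps the factor of a
  single exponential gap.\<close>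

lemma nn_integral_exp_fuse:
  assumes [measurable]: "case_prod K \<in> borel_measurable (borel \<Otimes>\<^sub>M borel)"
  shows "(\<integral>\<^sup>+y. \<integral>\<^sup>+x. K x (y + x) \<partial>exp_law \<partial>exp_law) =
    (\<integral>\<^sup>+z. \<integral>\<^sup>+x. K x z * indicator {0<..z} x \<partial>lborel \<partial>exp_law)"
proof -
  let ?d = "\<lambda>x. ennreal (exponential_density 1 x)"
  have "(\<integral>\<^sup>+y. \<integral>\<^sup>+x. K x (y + x) \<partial>exp_law \<partial>exp_law) =
      (\<integral>\<^sup>+y. \<integral>\<^sup>+x. ?d y * (?d x * K x (y + x)) \<partial>lborel \<partial>lborel)"
    by (simp add: nn_integral_exp_law nn_integral_cmult)
  also have "\<dots> = (\<integral>\<^sup>+x. \<integral>\<^sup>+y. ?d y * (?d x * K x (y + x)) \<partial>lborel \<partial>lborel)"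
    by (rule lborel_pair.Fubini') measurable
  also have "\<dots> = (\<integral>\<^sup>+x. \<integral>\<^sup>+z. ?d (z - x) * (?d x * K x z) \<partial>lborel \<partial>lborel)"
  proof (rule nn_integral_cong)
    fix x :: real
    have "(\<integral>\<^sup>+z. ?d (z - x) * (?d x * K x z) \<partial>lborel) =
        ennreal \<bar>1\<bar> * (\<integral>\<^sup>+y. ?d ((x + 1 * y) - x) * (?d x * K x (x + 1 * y)) \<partial>lborel)"
      by (rule nn_integral_real_affine) simp_all
    then show "(\<integral>\<^sup>+y. ?d y * (?d x * K x (y + x)) \<partial>lborel) = (\<integral>\<^sup>+z. ?d (z - x) * (?d x * K x z) \<partial>lborel)"
      by (simp add: add.commute)
  qed
  also have "\<dots> = (\<integral>\<^sup>+z. \<integral>\<^sup>+x. ?d (z - x) * (?d x * K x z) \<partial>lborel \<partial>lborel)"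
    by (rule lborel_pair.Fubini') measurable
  also have "\<dots> = (\<integral>\<^sup>+z. ?d z * (\<integral>\<^sup>+x. K x z * indicator {0<..z} x \<partial>lborel) \<partial>lborel)"
  proof (rule nn_integral_cong)
    fix z :: real
    \<comment> \<open>At \<open>x = 0\<close> the exponential density is 1 but the indicator is 0;
      this null set is excluded.\<close>
    have "?d (z - x) * (?d x * K x z) = ?d z * (K x z * indicator {0<..z} x)" if "x \<noteq> 0" for x
    proof (cases "0 < x \<and> x \<le> z")
      case True
      then have "?d (z - x) * ?d x = ?d z"
        by (simp add: exponential_density_def ennreal_mult[symmetric] exp_add[symmetric])
      then show ?thesis using True by (simp add: mult.assoc[symmetric])
    next
      case False
      then show ?thesis using that by (auto simp: exponential_density_def indicator_def not_le)
    qed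
    then have "(\<integral>\<^sup>+x. ?d (z - x) * (?d x * K x z) \<partial>lborel) = (\<integral>\<^sup>+x. ?d z * (K x z * indicator {0<..z} x) \<partial>lborel)"
      using AE_lborel_singleton[of 0] by (intro nn_integral_cong_AE) auto
    then show "(\<integral>\<^sup>+x. ?d (z - x) * (?d x * K x z) \<partial>lborel) = ?d z * (\<integral>\<^sup>+x. K x z * indicator {0<..z} x \<partial>lborel)"
      by (simp add: nn_integral_cmult)
  qed
  also have "\<dots> = (\<integral>\<^sup>+z. \<integral>\<^sup>+x. K x z * indicator {0<..z} x \<partial>lborel \<partial>exp_law)"
    unfolding indicator_def greaterThanAtMost_iff
    by (rule nn_integral_exp_law[symmetric]) measurable
  finally show ?thesis .
qed


text \<open>The inserted gap \<open>x\<close> ends at arrival \<open>i\<close> and is followed by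
  the old gap \<open>u i\<close>. Deleting that arrival joins the two gaps and leaves all later
  arrivals in place.\<close>

lemma arrivals_insert_at:
  "arrivals (insert_at i x u) i = (\<Sum>j<i. u j) + x"
  "delete_at i (arrivals (insert_at i x u)) = arrivals (u(i := u i + x))"
proof -
  have pre: "(\<Sum>j<n. insert_at i x u j) = (\<Sum>j<n. u j)" if "n \<le> i" for n
    using that by (intro sum.cong) (auto simp: insert_at_def)
  have pre': "(\<Sum>j<n. (u(i := u i + x)) j) = (\<Sum>j<n. u j)" if "n \<le> i" for n
    using that by (intro sum.cong) auto
  have "(\<Sum>j<Suc i. insert_at i x u j) = (\<Sum>j<i. u j) + x"
    by (simp add: pre) (simp add: insert_at_def)
  then show "arrivals (insert_at i x u) i = (\<Sum>j<i. u j) + x"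
    by (simp add: arrivals_def lessThan_Suc_atMost del: sum.lessThan_Suc)
  have post: "(\<Sum>j<Suc (Suc (i + k)). insert_at i x u j) = (\<Sum>j<Suc (i + k). (u(i := u i + x)) j)" for k
  proof (induction k)
    case 0
    show ?case by (simp add: pre pre') (simp add: insert_at_def)
  next
    case (Suc k)
    have "(\<Sum>j<Suc (Suc (i + Suc k)). insert_at i x u j) =
        (\<Sum>j<Suc (Suc (i + k)). insert_at i x u j) + insert_at i x u (Suc (Suc (i + k)))"
      by simp
    also have "\<dots> = (\<Sum>j<Suc (i + k). (u(i := u i + x)) j) + u (Suc (i + k))"
      unfolding Suc.IH by (simp add: insert_at_def)
    also have "\<dots> = (\<Sum>j<Suc (i + Suc k). (u(i := u i + x)) j)" by simp
    finally show ?case .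
  qed
  show "delete_at i (arrivals (insert_at i x u)) = arrivals (u(i := u i + x))"
  proof
    fix n
    show "delete_at i (arrivals (insert_at i x u)) n = arrivals (u(i := u i + x)) n"
    proof (cases "n < i")
      case True
      then have "Suc n \<le> i" by simp
      from pre[OF this] pre'[OF this] show ?thesis
        using True by (simp add: delete_at_def arrivals_def lessThan_Suc_atMost[symmetric] del: sum.lessThan_Suc)
    next
      case False
      then obtain k where "n = i + k" by (metis le_iff_add not_less)
      then show ?thesis
        using post[of k] by (simp add: delete_at_def arrivals_def lessThan_Suc_atMost[symmetric] del: sum.lessThan_Suc)
    qed
  qed
qed

lemma AE_exp_seq_pos: "AE u in exp_seq. \<forall>n. 0 < u n"
proof -
  interpret product_prob_space "\<lambda>_. exp_law" UNIV
    by (intro product_prob_spaceI prob_space_exp_law)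
  have "AE x in exp_law. 0 < x"
    unfolding exp_law_def using AE_lborel_singleton[of "0::real"]
    by (subst AE_density) (auto simp: exponential_density_def)
  then show ?thesis
    unfolding exp_seq_def AE_all_countable by (intro allI AE_component) auto
qed

text \<open>Each independent gap contributes 1/2, because \<open>exp (- x)\<close> times the
  unit-rate density is half the density of rate 2.\<close>

lemma nn_integral_exp_neg_arrivals: "(\<integral>\<^sup>+u. ennreal (exp (- arrivals u n)) \<partial>exp_seq) = ennreal ((1 / 2) ^ Suc n)"
proof -
  interpret product_prob_space "\<lambda>_. exp_law" "{..n}"
    by (intro product_prob_spaceI prob_space_exp_law)
  interpret U: product_prob_space "\<lambda>_. exp_law" "UNIV :: nat set"
    by (intro product_prob_spaceI prob_space_exp_law)
  have half: "(\<integral>\<^sup>+x. ennreal (exp (- x)) \<partial>exp_law) = ennreal (1 / 2)"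
  proof -
    interpret D: prob_space "density lborel (exponential_density 2)"
      by (rule prob_space_exponential_density) simp
    have "(\<integral>\<^sup>+x. ennreal (exp (- x)) \<partial>exp_law) = (\<integral>\<^sup>+x. ennreal (1 / 2) * ennreal (exponential_density 2 x) \<partial>lborel)"
      by (subst nn_integral_exp_law)
         (auto intro!: nn_integral_cong simp del: ennreal_half simp: ennreal_mult'[symmetric],
          auto simp: exponential_density_def exp_add[symmetric])
    also have "\<dots> = ennreal (1 / 2)"
      using D.emeasure_space_1 by (subst nn_integral_cmult) (auto simp: emeasure_density)
    finally show ?thesis .
  qed
  have "(\<integral>\<^sup>+u. ennreal (exp (- arrivals u n)) \<partial>exp_seq) = (\<integral>\<^sup>+u. (\<Prod>j\<le>n. ennreal (exp (- u j))) \<partial>exp_seq)"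
    by (simp add: arrivals_def prod_ennreal exp_sum sum_negf[symmetric])
  also have "\<dots> = (\<integral>\<^sup>+u. (\<Prod>j\<le>n. ennreal (exp (- u j))) \<partial>PiM {..n} (\<lambda>_. exp_law))"
    unfolding exp_seq_def
    by (subst U.distr_PiM_restrict_finite[symmetric, of "{..n}"]) (auto simp: nn_integral_distr intro!: nn_integral_cong)
  also have "\<dots> = ennreal ((1 / 2) ^ Suc n)"
    by (subst product_nn_integral_prod) (simp_all add: half ennreal_power del: ennreal_half power_Suc)
  finally show ?thesis .
qed

text \<open>The expectations of \<open>exp (- arrivals u n)\<close> have a finite sum, so almost
  surely the series converges and its terms tend to 0.\<close>

lemma AE_arrivals_at_top: "AE u in exp_seq. filterlim (arrivals u) at_top sequentially"
proof -
  have "(\<integral>\<^sup>+u. (\<Sum>n. ennreal (exp (- arrivals u n))) \<partial>exp_seq) = (\<Sum>n. ennreal ((1 / 2) ^ Suc n))"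
    by (subst nn_integral_suminf) (auto simp: nn_integral_exp_neg_arrivals)
  also have "\<dots> = 1"
    using sums_unique[OF power_half_series] sums_summable[OF power_half_series]
    by (subst suminf_ennreal2) auto
  finally have "AE u in exp_seq. (\<Sum>n. ennreal (exp (- arrivals u n))) \<noteq> \<infinity>"
    by (intro nn_integral_PInf_AE) auto
  then show ?thesis
  proof eventually_elim
    case (elim u)
    then have "summable (\<lambda>n. exp (- arrivals u n))" by (intro summable_suminf_not_top) auto
    then have "(\<lambda>n. exp (- arrivals u n)) \<longlonglongrightarrow> 0" by (rule summable_LIMSEQ_zero)
    then have "filterlim (\<lambda>n. ln (exp (- arrivals u n))) at_bot sequentially"
      by (intro filterlim_compose[OF ln_at_0]) (simp add: filterlim_at)
    then show ?case by (simp add: filterlim_uminus_at_top)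
  qed
qed

lemma suminf_indicator_intervals:
  fixes a :: "nat \<Rightarrow> real"
  assumes a: "strict_mono a" "filterlim a at_top sequentially"
  shows "(\<Sum>i. indicator {a i<..a (Suc i)} \<gamma>) = (indicator {a 0<..} \<gamma> :: ennreal)"
proof (cases "a 0 < \<gamma>")
  case True
  define n where "n = (LEAST n. \<gamma> \<le> a n)"
  have "\<exists>n. \<gamma> \<le> a n"
    using a(2) by (auto simp: filterlim_at_top eventually_sequentially)
  then have n: "\<gamma> \<le> a n" "\<And>m. m < n \<Longrightarrow> \<not> \<gamma> \<le> a m"
    unfolding n_def by (auto intro: LeastI dest: not_less_Least)
  then obtain k where k: "n = Suc k" using True by (cases n) auto
  have "indicator {a i<..a (Suc i)} \<gamma> = (if i = k then 1 else 0 :: ennreal)" for i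
  proof -
    have "\<gamma> \<le> a (Suc i)" if "i \<ge> k"
      using n(1) strict_mono_leD[OF a(1), of n "Suc i"] that k by simp
    moreover have "a i < \<gamma>" if "i \<le> k" using n(2)[of i] that k by simp
    moreover have "\<not> a i < \<gamma>" if "i > k"
      using n(1) strict_mono_leD[OF a(1), of n i] that k by simp
    moreover have "\<not> \<gamma> \<le> a (Suc i)" if "i < k" using n(2)[of "Suc i"] that k by simp
    ultimately show ?thesis by (cases i k rule: linorder_cases) auto
  qed
  then have "(\<Sum>i. indicator {a i<..a (Suc i)} \<gamma>) = (\<Sum>i. (if i = k then 1 else 0 :: ennreal))" by simp
  also have "\<dots> = 1" by (subst suminf_finite[of "{k}"]) auto
  finally show ?thesis using True by simp
next
  case False
  then have "indicator {a i<..a (Suc i)} \<gamma> = (0 :: ennreal)" for i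
    using strict_mono_leD[OF a(1), of 0 i] by (auto simp: indicator_def)
  then show ?thesis using False by simp
qed

text \<open>Removing the \<open>i\<close>-th arrival merges two exponential gaps into one, inside which the removed point
  is uniform.\<close>

theorem Mecke_arrivals:
  assumes G [measurable]: "case_prod G \<in> borel_measurable (borel \<Otimes>\<^sub>M seq_borel)"
  shows "(\<integral>\<^sup>+u. (\<Sum>i. G (arrivals u i) (delete_at i (arrivals u))) \<partial>exp_seq) =
    (\<integral>\<^sup>+u. \<integral>\<^sup>+y. G y (arrivals u) * indicator {0<..} y \<partial>lborel \<partial>exp_seq)"
proof -
  \<comment> \<open>The left end of gap \<open>i\<close>: the preceding arrival, or 0 for
    \<open>i = 0\<close>. The right end \<open>A u (Suc i)\<close> is
    \<open>arrivals u i\<close>.\<close>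
  define A where "A u i = (\<Sum>j<i. u j)" for u :: "nat \<Rightarrow> real" and i
  have [measurable]: "(\<lambda>u. A u i) \<in> borel_measurable seq_borel" for i
    unfolding A_def by measurable
  have A_upd: "A (u(i := y)) i = A u i" for u i y
    unfolding A_def by (intro sum.cong) auto
  let ?I = "\<lambda>u i y. indicator {A u i<..A u (Suc i)} y :: ennreal"
  \<comment> \<open>The term of the \<open>i\<close>-th arrival yields the integral over the
    \<open>i\<close>-th gap alone. Almost surely the gaps tile the positive half-line, which gives
    the full integral after summation.\<close>
  have summand: "(\<integral>\<^sup>+u. G (arrivals u i) (delete_at i (arrivals u)) \<partial>exp_seq) =
      (\<integral>\<^sup>+u. \<integral>\<^sup>+y. G y (arrivals u) * ?I u i y \<partial>lborel \<partial>exp_seq)" for i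
  proof -
    define K where "K u x z = G (A u i + x) (arrivals (u(i := z)))" for u x z
    have K [measurable]: "case_prod (K u) \<in> borel_measurable (borel \<Otimes>\<^sub>M borel)" for u
      unfolding K_def by measurable
    have "(\<integral>\<^sup>+u. G (arrivals u i) (delete_at i (arrivals u)) \<partial>exp_seq) =
        (\<integral>\<^sup>+u. \<integral>\<^sup>+x. K u x (u i + x) \<partial>exp_law \<partial>exp_seq)"
      by (subst nn_integral_exp_seq_insert[of _ i]) (auto simp: arrivals_insert_at K_def A_def)
    also have "\<dots> = (\<integral>\<^sup>+u. \<integral>\<^sup>+y. \<integral>\<^sup>+x. K u x (y + x) \<partial>exp_law \<partial>exp_law \<partial>exp_seq)"
      unfolding K_def by (subst nn_integral_exp_seq_update[of _ i]) (auto simp: A_upd)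
    also have "\<dots> = (\<integral>\<^sup>+u. \<integral>\<^sup>+z. \<integral>\<^sup>+x. K u x z * indicator {0<..z} x \<partial>lborel \<partial>exp_law \<partial>exp_seq)"
      by (intro nn_integral_cong nn_integral_exp_fuse K)
    also have "\<dots> = (\<integral>\<^sup>+u. \<integral>\<^sup>+x. K u x (u i) * indicator {0<..u i} x \<partial>lborel \<partial>exp_seq)"
    proof -
      have "(\<lambda>u. \<integral>\<^sup>+x. G (A u i + x) (arrivals (u(i := u i))) * indicator {0<..u i} x \<partial>lborel) \<in> borel_measurable seq_borel"
      proof -
        have [measurable]: "(\<lambda>p. fst p i) \<in> borel_measurable (seq_borel \<Otimes>\<^sub>M borel)"
          by (rule measurable_compose[OF measurable_fst]) simp
        have [measurable]: "Measurable.pred (seq_borel \<Otimes>\<^sub>M borel) (\<lambda>p. snd p \<in> {0<..fst p i})"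
          unfolding greaterThanAtMost_iff by measurable
        show ?thesis by measurable
      qed
      \<comment> \<open>Resampling read backwards: the fused gap \<open>z\<close> becomes coordinate
        \<open>i\<close> of the sequence again.\<close>
      from nn_integral_exp_seq_update[OF this, of i] show ?thesis
        by (simp add: K_def A_upd)
    qed
    also have "\<dots> = (\<integral>\<^sup>+u. \<integral>\<^sup>+y. G y (arrivals u) * ?I u i y \<partial>lborel \<partial>exp_seq)"
    proof (rule nn_integral_cong)
      fix u :: "nat \<Rightarrow> real"
      have "(\<integral>\<^sup>+y. G y (arrivals u) * ?I u i y \<partial>lborel) = ennreal \<bar>1\<bar> *
          (\<integral>\<^sup>+x. G (A u i + 1 * x) (arrivals u) * ?I u i (A u i + 1 * x) \<partial>lborel)"
        by (rule nn_integral_real_affine) simp_all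
      also have "\<dots> = (\<integral>\<^sup>+x. K u x (u i) * indicator {0<..u i} x \<partial>lborel)"
        by (auto intro!: nn_integral_cong simp: K_def indicator_def A_def)
      finally show "(\<integral>\<^sup>+x. K u x (u i) * indicator {0<..u i} x \<partial>lborel) =
        (\<integral>\<^sup>+y. G y (arrivals u) * ?I u i y \<partial>lborel)" ..
    qed
    finally show ?thesis .
  qed
  have "(\<integral>\<^sup>+u. (\<Sum>i. G (arrivals u i) (delete_at i (arrivals u))) \<partial>exp_seq) =
      (\<Sum>i. \<integral>\<^sup>+u. G (arrivals u i) (delete_at i (arrivals u)) \<partial>exp_seq)"
    by (rule nn_integral_suminf) measurable
  also have "\<dots> = (\<Sum>i. \<integral>\<^sup>+u. \<integral>\<^sup>+y. G y (arrivals u) * ?I u i y \<partial>lborel \<partial>exp_seq)"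
    by (simp only: summand)
  also have "\<dots> = (\<integral>\<^sup>+u. (\<Sum>i. \<integral>\<^sup>+y. G y (arrivals u) * ?I u i y \<partial>lborel) \<partial>exp_seq)"
    unfolding indicator_def greaterThanAtMost_iff by (rule nn_integral_suminf[symmetric]) measurable
  also have "\<dots> = (\<integral>\<^sup>+u. \<integral>\<^sup>+y. (\<Sum>i. G y (arrivals u) * ?I u i y) \<partial>lborel \<partial>exp_seq)"
    by (intro nn_integral_cong nn_integral_suminf[symmetric]) measurable
  also have "\<dots> = (\<integral>\<^sup>+u. \<integral>\<^sup>+y. G y (arrivals u) * indicator {0<..} y \<partial>lborel \<partial>exp_seq)"
  proof (rule nn_integral_cong_AE)
    show "AE u in exp_seq. (\<integral>\<^sup>+y. (\<Sum>i. G y (arrivals u) * ?I u i y) \<partial>lborel) =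
        (\<integral>\<^sup>+y. G y (arrivals u) * indicator {0<..} y \<partial>lborel)"
      using AE_exp_seq_pos AE_arrivals_at_top
    proof eventually_elim
      case (elim u)
      have "strict_mono (A u)" using elim by (auto simp: strict_mono_Suc_iff A_def)
      moreover have "filterlim (A u) at_top sequentially"
        using elim(2) by (subst filterlim_sequentially_Suc[symmetric])
          (simp add: A_def arrivals_def[abs_def] lessThan_Suc_atMost del: sum.lessThan_Suc)
      ultimately show ?case
        by (simp add: suminf_indicator_intervals) (simp add: A_def)
    qed
  qed
  finally show ?thesis .
qed

section \<open>The Laplace functional of the arrivals, and their summability\<close>

lemma prod_delete_at:
  assumes "i \<le> n"
  shows "(\<Prod>j<n. g (delete_at i x j)) = (\<Prod>j\<in>{..<Suc n} - {i}. (g (x j) :: 'b::comm_monoid_mult))"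
  by (rule prod.reindex_bij_witness[of _ "\<lambda>j. if j < i then j else j - 1" "\<lambda>j. if j < i then j else Suc j"])
     (use assms in \<open>auto simp: delete_at_def split: if_splits\<close>)

lemma gprod_delete_at:
  assumes "\<And>q. g q \<le> 1"
  shows "gprod g x = g (x i) * gprod g (delete_at i x)"
proof (rule LIMSEQ_unique)
  show "(\<lambda>n. \<Prod>j<Suc n. g (x j)) \<longlonglongrightarrow> gprod g x"
    using gprod_LIMSEQ[where g=g and x=x, OF assms] by (rule LIMSEQ_Suc)
  have fin: "g (x i) \<noteq> top" using assms[of "x i"] by (auto simp: top_unique)
  have "(\<lambda>n. g (x i) * (\<Prod>j<n. g (delete_at i x j))) \<longlonglongrightarrow> g (x i) * gprod g (delete_at i x)"
    using fin gprod_le_1[of g "delete_at i x"]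
    by (intro ennreal_tendsto_cmult gprod_LIMSEQ[OF assms]) (auto simp: less_top)
  moreover have "eventually (\<lambda>n. g (x i) * (\<Prod>j<n. g (delete_at i x j)) = (\<Prod>j<Suc n. g (x j))) sequentially"
    using eventually_ge_at_top[of i]
  proof eventually_elim
    case (elim n)
    then have "i \<in> {..<Suc n}" by simp
    then show ?case
      unfolding prod_delete_at[OF elim] by (subst (2) prod.remove[of _ i]) auto
  qed
  ultimately show "(\<lambda>n. \<Prod>j<Suc n. g (x j)) \<longlonglongrightarrow> g (x i) * gprod g (delete_at i x)"
    by (blast intro: Lim_transform_eventually)
qed

text \<open>The derivative in \<open>t\<close> of the product of the factors
  \<open>1 - t * f (x i)\<close> is minus the sum, over the points, of \<open>f (x i)\<close> times
  the product over the others. Integration from 0 to \<open>s\<close> gives the identity, written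
  additively to avoid subtraction in \<open>ennreal\<close>; the integrand has the form required by
  the Mecke formula.\<close>

lemma gprod_one_minus:
  fixes f :: "'a \<Rightarrow> real"
  assumes f: "\<And>q. 0 \<le> f q" "\<And>q. f q \<le> 1" and N: "\<And>n. N \<le> n \<Longrightarrow> f (x n) = 0" and s: "0 \<le> s" "s \<le> 1"
  shows "1 = gprod (\<lambda>q. ennreal (1 - s * f q)) x +
    (\<integral>\<^sup>+t. (\<Sum>i. ennreal (f (x i)) * gprod (\<lambda>q. ennreal (1 - t * f q)) (delete_at i x)) * indicator {0..s} t \<partial>lborel)"
proof -
  let ?G = "\<lambda>t. gprod (\<lambda>q. ennreal (1 - t * f q))"
  let ?S = "\<lambda>t. \<Sum>i. ennreal (f (x i)) * ?G t (delete_at i x)"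
  \<comment> \<open>The sign makes \<open>F\<close> increasing, since the fundamental theorem for
    \<open>nn_integral\<close> needs a nonnegative derivative.\<close>
  define F where "F t = - (\<Prod>i<N. 1 - t * f (x i))" for t
  define F' where "F' t = (\<Sum>i<N. f (x i) * (\<Prod>j\<in>{..<N} - {i}. 1 - t * f (x j)))" for t
  have nn: "0 \<le> 1 - t * f q" "1 - t * f q \<le> 1" if "0 \<le> t" "t \<le> s" for t q
    using mult_mono[of t 1 "f q" 1] f[of q] that s by auto
  have gp: "?G t x = ennreal (- F t)" if "0 \<le> t" "t \<le> s" for t
  proof -
    have "?G t x = (\<Prod>i<N. ennreal (1 - t * f (x i)))"
      using nn[OF that] N by (intro gprod_eq_prod) auto
    then show ?thesis using nn[OF that] by (simp add: F_def prod_ennreal)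
  qed
  have gd: "?S t = ennreal (F' t)"
    if t: "0 \<le> t" "t \<le> s" for t
  proof -
    have "ennreal (f (x i)) * ?G t (delete_at i x) =
        ennreal (f (x i) * (\<Prod>j\<in>{..<N} - {i}. 1 - t * f (x j)))" if i: "i < N" for i
    proof -
      have "?G t (delete_at i x) = (\<Prod>j<N - 1. ennreal (1 - t * f (delete_at i x j)))"
        using nn[OF t] N i by (intro gprod_eq_prod) (auto simp: delete_at_def)
      also have "\<dots> = (\<Prod>j\<in>{..<Suc (N - 1)} - {i}. ennreal (1 - t * f (x j)))"
        using i by (intro prod_delete_at) auto
      also have "\<dots> = ennreal (\<Prod>j\<in>{..<N} - {i}. 1 - t * f (x j))"
        using nn[OF t] i by (subst prod_ennreal) auto
      finally show ?thesis using f nn[OF t] by (simp add: ennreal_mult prod_nonneg)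
    qed
    then have "(\<Sum>i<N. ennreal (f (x i)) * ?G t (delete_at i x)) = ennreal (F' t)"
      using f nn[OF t] by (simp add: F'_def sum_ennreal prod_nonneg)
    moreover have "?S t =
        (\<Sum>i<N. ennreal (f (x i)) * ?G t (delete_at i x))"
      using N by (intro suminf_finite) (auto simp: not_less)
    ultimately show ?thesis by simp
  qed
  have "(\<integral>\<^sup>+t. ?S t * indicator {0..s} t \<partial>lborel) =
      (\<integral>\<^sup>+t. ennreal (F' t) * indicator {0..s} t \<partial>lborel)"
    using gd by (intro nn_integral_cong) (auto simp: indicator_def)
  also have "\<dots> = ennreal (F s - F 0)"
  proof (rule nn_integral_FTC_Icc)
    show "F' \<in> borel_measurable borel" unfolding F'_def by measurable
    show "(F has_real_derivative F' t) (at t)" if "t \<in> {0..s}" for t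
    proof -
      have "((\<lambda>t. \<Prod>i<N. 1 - t * f (x i)) has_field_derivative
          (\<Sum>i<N. - f (x i) * (\<Prod>j\<in>{..<N} - {i}. 1 - t * f (x j)))) (at t)"
        by (intro has_field_derivative_prod) (auto intro!: derivative_eq_intros)
      from DERIV_minus[OF this] show ?thesis
        unfolding F_def F'_def by (simp add: sum_negf)
    qed
    show "0 \<le> F' t" if "t \<in> {0..s}" for t
      unfolding F'_def using nn(1)[of t] that f by (intro sum_nonneg mult_nonneg_nonneg prod_nonneg) auto
  qed (use s in auto)
  finally have *: "(\<integral>\<^sup>+t. ?S t * indicator {0..s} t \<partial>lborel) =
    ennreal (F s - F 0)" .
  have "F 0 = -1" by (simp add: F_def)
  moreover have "F s \<le> 0" "-1 \<le> F s"
    using nn[of s] s by (auto simp: F_def intro!: prod_nonneg prod_le_1)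
  ultimately show ?thesis
    unfolding * using gp[of s] s by (simp flip: ennreal_plus)
qed

text \<open>Regularity is bootstrapped: a bounded measurable solution has a continuous indefinite
  integral, so it is continuous, hence differentiable. Then \<open>\<psi> s * exp (c * s)\<close>
  has derivative 0 on the unit interval.\<close>

lemma integral_equation_exp:
  fixes \<psi> :: "real \<Rightarrow> real"
  assumes meas [measurable]: "\<psi> \<in> borel_measurable borel" and \<psi>: "\<And>s. 0 \<le> \<psi> s" "\<And>s. \<psi> s \<le> 1"
    and c: "0 \<le> c"
    and eq: "\<And>s. 0 \<le> s \<Longrightarrow> s \<le> 1 \<Longrightarrow> 1 = ennreal (\<psi> s) + (\<integral>\<^sup>+t. ennreal (c * \<psi> t) * indicator {0..s} t \<partial>lborel)"
  shows "\<psi> 1 = exp (- c)"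
proof -
  have int: "set_integrable lborel {0..s} \<psi>" for s
    unfolding set_integrable_def
  proof (rule integrableI_bounded_set_indicator[where B=1])
    show "AE x in lborel. x \<in> {0..s} \<longrightarrow> norm (\<psi> x) \<le> 1" using \<psi> by simp
  qed (auto simp: emeasure_lborel_Icc_eq)
  have hk: "\<psi> integrable_on {0..s}" for s
    using set_borel_integral_eq_integral(1)[OF int] .
  have eq': "\<psi> s = 1 - c * integral {0..s} \<psi>" if "0 \<le> s" "s \<le> 1" for s
  proof -
    have "(\<integral>\<^sup>+t. ennreal (c * \<psi> t) * indicator {0..s} t \<partial>lborel) = (\<integral>\<^sup>+t. ennreal (c * (\<psi> t * indicator {0..s} t)) \<partial>lborel)"
      by (intro nn_integral_cong) (auto simp: indicator_def)
    also have "\<dots> = ennreal (\<integral>t. c * (\<psi> t * indicator {0..s} t) \<partial>lborel)"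
      using int[of s] \<psi>(1) c
      by (intro nn_integral_eq_integral integrable_mult_right)
         (auto simp: set_integrable_def mult.commute[of "indicator _ _"])
    also have "(\<integral>t. c * (\<psi> t * indicator {0..s} t) \<partial>lborel) = c * integral {0..s} \<psi>"
      using set_borel_integral_eq_integral(2)[OF int[of s]]
      by (simp add: set_lebesgue_integral_def mult.commute[of "indicator _ _"])
    finally have "1 = ennreal (\<psi> s) + ennreal (c * integral {0..s} \<psi>)"
      using eq[OF that] by simp
    moreover have "0 \<le> c * integral {0..s} \<psi>"
      using c \<psi>(1) by (intro mult_nonneg_nonneg integral_nonneg hk) auto
    ultimately have "1 = \<psi> s + c * integral {0..s} \<psi>"
      using \<psi>(1)[of s] by (simp flip: ennreal_plus add: ennreal_eq_1)
    then show ?thesis by simp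
  qed
  have cont: "continuous_on {0..1} \<psi>"
  proof (rule continuous_on_eq)
    show "continuous_on {0..1} (\<lambda>s. 1 - c * integral {0..s} \<psi>)"
      by (intro continuous_intros indefinite_integral_continuous_1 hk)
  qed (use eq' in auto)
  have der: "(\<psi> has_real_derivative - c * \<psi> s) (at s within {0..1})" if s: "s \<in> {0..1}" for s
  proof (rule has_field_derivative_transform_within[OF _ zero_less_one s])
    have "((\<lambda>s. integral {0..s} \<psi>) has_real_derivative \<psi> s) (at s within {0..1})"
      by (rule integral_has_real_derivative[OF cont s])
    from DERIV_diff[OF DERIV_const[of 1] DERIV_cmult[OF this, of c]]
    show "((\<lambda>s. 1 - c * integral {0..s} \<psi>) has_real_derivative - c * \<psi> s) (at s within {0..1})"
      by simp
  qed (use eq' in auto)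
  have "\<exists>k. \<forall>s\<in>{0..1}. \<psi> s * exp (c * s) = k"
  proof (rule has_field_derivative_zero_constant)
    fix s :: real assume s: "s \<in> {0..1}"
    show "((\<lambda>s. \<psi> s * exp (c * s)) has_real_derivative 0) (at s within {0..1})"
      by (rule derivative_eq_intros der[OF s] refl)+ simp
  qed simp
  then obtain k where "\<And>s. s \<in> {0..1} \<Longrightarrow> \<psi> s * exp (c * s) = k" by blast
  from this[of 0] this[of 1] have "\<psi> 1 * exp (c * 1) = \<psi> 0 * exp (c * 0)" by simp
  moreover have "\<psi> 0 = 1" using eq'[of 0] by simp
  ultimately show ?thesis by (simp add: exp_minus field_simps)
qed

lemma integrable_bounded_support:
  fixes f :: "real \<Rightarrow> real"
  assumes [measurable]: "f \<in> borel_measurable borel" and f: "\<And>x. 0 \<le> f x" "\<And>x. f x \<le> 1"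
    and b: "\<And>x. b < x \<Longrightarrow> f x = 0"
  shows "integrable lborel (\<lambda>x. f x * indicator {0<..} x)"
proof (rule Bochner_Integration.integrable_bound)
  show "integrable lborel (\<lambda>x. indicator {0..b} x :: real)"
    by (intro integrable_real_indicator) (auto simp: emeasure_lborel_Icc_eq)
  show "AE x in lborel. norm (f x * indicator {0<..} x) \<le> norm (indicator {0..b} x :: real)"
    using f b by (intro AE_I2) (auto simp: indicator_def not_le)
qed measurable

text \<open>With \<open>\<psi> s = E (gprod (1 - s f))\<close>, the Mecke formula gives \<open>\<psi>' = - c \<psi>\<close> for \<open>c\<close> the integral of \<open>f\<close>.\<close>

lemma Laplace_arrivals:
  fixes f :: "real \<Rightarrow> real"
  assumes [measurable]: "f \<in> borel_measurable borel" and f: "\<And>x. 0 \<le> f x" "\<And>x. f x \<le> 1"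
    and b: "\<And>x. b < x \<Longrightarrow> f x = 0"
  shows "(\<integral>\<^sup>+u. gprod (\<lambda>x. ennreal (1 - f x)) (arrivals u) \<partial>exp_seq) =
    ennreal (exp (- (\<integral>x. f x * indicator {0<..} x \<partial>lborel)))"
proof -
  define \<Psi> where "\<Psi> t = (\<integral>\<^sup>+u. gprod (\<lambda>x. ennreal (1 - t * f x)) (arrivals u) \<partial>exp_seq)" for t
  define \<psi> where "\<psi> t = enn2real (\<Psi> t)" for t
  define c where "c = (\<integral>x. f x * indicator {0<..} x \<partial>lborel)"
  have le1: "\<Psi> t \<le> 1" for t
  proof -
    have "\<Psi> t \<le> (\<integral>\<^sup>+u. 1 \<partial>exp_seq)"
      unfolding \<Psi>_def by (intro nn_integral_mono gprod_le_1)
    then show ?thesis by (simp)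
  qed
  have \<Psi>_eq: "\<Psi> t = ennreal (\<psi> t)" for t
    using le_less_trans[OF le1[of t] ennreal_one_less_top] by (simp add: \<psi>_def)
  have m\<Psi> [measurable]: "\<Psi> \<in> borel_measurable borel"
    unfolding \<Psi>_def gprod_def by measurable
  have int_f: "integrable lborel (\<lambda>x. f x * indicator {0<..} x)"
    by (rule integrable_bounded_support[OF _ f b]) measurable
  have c0: "0 \<le> c" unfolding c_def using f by (intro integral_nonneg_AE) auto
  have "\<psi> 1 = exp (- c)"
  proof (rule integral_equation_exp)
    show "\<psi> \<in> borel_measurable borel" unfolding \<psi>_def by measurable
    show "0 \<le> \<psi> s" "\<psi> s \<le> 1" for s using le1[of s] enn2real_mono[of "\<Psi> s" 1] by (auto simp: \<psi>_def)
    show "0 \<le> c" by (rule c0)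
    fix s :: real assume s: "0 \<le> s" "s \<le> 1"
    define H where "H t u = (\<Sum>i. ennreal (f (arrivals u i)) * gprod (\<lambda>q. ennreal (1 - t * f q)) (delete_at i (arrivals u)))" for t u
    have [measurable]: "case_prod H \<in> borel_measurable (borel \<Otimes>\<^sub>M seq_borel)"
      unfolding H_def gprod_def case_prod_unfold by measurable
    have "1 = (\<integral>\<^sup>+u. 1 \<partial>exp_seq)" by (simp)
    also have "\<dots> = (\<integral>\<^sup>+u. gprod (\<lambda>q. ennreal (1 - s * f q)) (arrivals u) + (\<integral>\<^sup>+t. H t u * indicator {0..s} t \<partial>lborel) \<partial>exp_seq)"
    proof (rule nn_integral_cong_AE)
      show "AE u in exp_seq. 1 = gprod (\<lambda>q. ennreal (1 - s * f q)) (arrivals u) + (\<integral>\<^sup>+t. H t u * indicator {0..s} t \<partial>lborel)"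
        using AE_arrivals_at_top
      proof eventually_elim
        case (elim u)
        then have "eventually (\<lambda>n. b < arrivals u n) sequentially" by (simp add: filterlim_at_top_dense)
        then obtain N where "\<And>n. N \<le> n \<Longrightarrow> b < arrivals u n" by (auto simp: eventually_sequentially)
        then show ?case unfolding H_def by (intro gprod_one_minus f s b) auto
      qed
    qed
    also have "\<dots> = \<Psi> s + (\<integral>\<^sup>+u. \<integral>\<^sup>+t. H t u * indicator {0..s} t \<partial>lborel \<partial>exp_seq)"
      unfolding \<Psi>_def by (rule nn_integral_add) (auto simp: case_prod_unfold)
    also have "(\<integral>\<^sup>+u. \<integral>\<^sup>+t. H t u * indicator {0..s} t \<partial>lborel \<partial>exp_seq) = (\<integral>\<^sup>+t. \<integral>\<^sup>+u. H t u * indicator {0..s} t \<partial>exp_seq \<partial>lborel)"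
    proof -
      interpret pair_sigma_finite lborel exp_seq ..
      show ?thesis by (rule Fubini') (measurable)
    qed
    also have "\<dots> = (\<integral>\<^sup>+t. ennreal (c * \<psi> t) * indicator {0..s} t \<partial>lborel)"
    proof (rule nn_integral_cong)
      fix t :: real
      have "(\<integral>\<^sup>+u. H t u \<partial>exp_seq) = (\<integral>\<^sup>+u. \<integral>\<^sup>+y. ennreal (f y) * gprod (\<lambda>q. ennreal (1 - t * f q)) (arrivals u) * indicator {0<..} y \<partial>lborel \<partial>exp_seq)"
        unfolding H_def by (rule Mecke_arrivals) (measurable)
      also have "\<dots> = (\<integral>\<^sup>+u. (\<integral>\<^sup>+y. ennreal (f y * indicator {0<..} y) \<partial>lborel) * gprod (\<lambda>q. ennreal (1 - t * f q)) (arrivals u) \<partial>exp_seq)"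
        by (subst nn_integral_multc[symmetric], measurable)
           (auto intro!: nn_integral_cong simp: indicator_def)
      also have "\<dots> = ennreal c * \<Psi> t"
        unfolding \<Psi>_def c_def using int_f f
        by (subst nn_integral_cmult) (auto simp: nn_integral_eq_integral)
      finally show "(\<integral>\<^sup>+u. H t u * indicator {0..s} t \<partial>exp_seq) = ennreal (c * \<psi> t) * indicator {0..s} t"
        unfolding \<Psi>_eq using c0 by (simp add: nn_integral_multc ennreal_mult')
    qed
    finally show "1 = ennreal (\<psi> s) + (\<integral>\<^sup>+t. ennreal (c * \<psi> t) * indicator {0..s} t \<partial>lborel)"
      unfolding \<Psi>_eq .
  qed
  then show ?thesis using \<Psi>_eq[of 1] unfolding \<Psi>_def c_def by simp
qed

text \<open>By the Mecke formula with a function of the point alone, the sum over arrivals beyond 1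
  has as expectation the integral of \<open>x powr (- 1 / \<alpha>)\<close> from 1, finite because
  \<open>1 / \<alpha> > 1\<close>. Only finitely many arrivals lie below 1.\<close>

lemma AE_summable_arrivals:
  assumes \<alpha>: "0 < \<alpha>" "\<alpha> < 1"
  shows "AE u in exp_seq. summable (\<lambda>n. arrivals u n powr (- 1 / \<alpha>))"
proof -
  define h where "h x = ennreal (x powr (- 1 / \<alpha>)) * indicator {1..} x" for x :: real
  have [measurable]: "h \<in> borel_measurable borel" unfolding h_def by measurable
  have "(\<integral>\<^sup>+u. (\<Sum>i. h (arrivals u i)) \<partial>exp_seq) = (\<integral>\<^sup>+u. \<integral>\<^sup>+y. h y * indicator {0<..} y \<partial>lborel \<partial>exp_seq)"
    by (rule Mecke_arrivals) measurable
  also have "\<dots> = (\<integral>\<^sup>+y. h y \<partial>lborel)"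
    by (auto intro!: nn_integral_cong simp: h_def indicator_def)
  also have "\<dots> = ennreal (0 - 1 powr (1 - 1 / \<alpha>) / (1 - 1 / \<alpha>))"
    unfolding h_def
  proof (rule nn_integral_FTC_atLeast[where F="\<lambda>x. x powr (1 - 1 / \<alpha>) / (1 - 1 / \<alpha>)"])
    fix x :: real assume "1 \<le> x"
    then show "((\<lambda>x. x powr (1 - 1 / \<alpha>) / (1 - 1 / \<alpha>)) has_real_derivative x powr (- 1 / \<alpha>)) (at x)"
    proof -
      define e where "e = 1 - 1 / \<alpha>"
      have "e \<noteq> 0" using \<alpha> by (simp add: e_def)
      moreover have "((\<lambda>x. x powr e / e) has_real_derivative e * x powr (e - 1) / e) (at x)"
        using \<open>1 \<le> x\<close> by (intro DERIV_cdivide has_real_derivative_powr) auto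
      ultimately show ?thesis by (simp add: e_def)
    qed
  next
    show "((\<lambda>x. x powr (1 - 1 / \<alpha>) / (1 - 1 / \<alpha>)) \<longlongrightarrow> 0) at_top"
      using \<alpha> by (intro tendsto_divide_zero tendsto_neg_powr filterlim_ident) (auto simp: field_simps)
  qed auto
  finally have "AE u in exp_seq. (\<Sum>i. h (arrivals u i)) \<noteq> \<infinity>"
    by (intro nn_integral_PInf_AE) auto
  then show ?thesis using AE_arrivals_at_top
  proof eventually_elim
    case (elim u)
    have "h x = ennreal (x powr (- 1 / \<alpha>) * indicator {1..} x)" for x
      by (auto simp: h_def indicator_def)
    then have s: "summable (\<lambda>n. arrivals u n powr (- 1 / \<alpha>) * indicator {1..} (arrivals u n))"
      using elim(1) by (intro summable_suminf_not_top) auto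
    have "eventually (\<lambda>n. 1 \<le> arrivals u n) sequentially" using elim(2) by (simp add: filterlim_at_top)
    then have "eventually (\<lambda>n. arrivals u n powr (- 1 / \<alpha>) * indicator {1..} (arrivals u n) = arrivals u n powr (- 1 / \<alpha>)) sequentially"
      by eventually_elim simp
    from summable_cong[OF this] s show ?case by simp
  qed
qed

section \<open>Stick breaking by size-biased removal of points\<close>

lemma incseq_indicator_interval:
  fixes a b :: "nat \<Rightarrow> real"
  assumes "decseq a" "incseq b"
  shows "incseq (\<lambda>n x. f x * (indicator {a n..b n} x :: ennreal))"
  using assms unfolding incseq_def decseq_def le_fun_def
  by (intro allI impI mult_left_mono) (auto simp: indicator_def intro: order_trans)

lemma nn_integral_LIMSEQ:
  assumes "incseq f" "\<And>i. f i \<in> borel_measurable M" "\<And>x. (\<lambda>i. f i x) \<longlonglongrightarrow> (u x :: ennreal)"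
  shows "(\<lambda>n. integral\<^sup>N M (f n)) \<longlonglongrightarrow> integral\<^sup>N M u"
proof -
  have "(\<lambda>n. integral\<^sup>N M (f n)) \<longlonglongrightarrow> (SUP n. integral\<^sup>N M (f n))"
    using assms(1) by (intro LIMSEQ_SUP) (auto simp: incseq_def le_fun_def intro!: nn_integral_mono)
  also have "(SUP n. integral\<^sup>N M (f n)) = (\<integral>\<^sup>+x. (SUP n. f n x) \<partial>M)"
    using assms by (intro nn_integral_monotone_convergence_SUP[symmetric]) auto
  also have "(\<lambda>x. SUP n. f n x) = u"
  proof
    fix x
    have "incseq (\<lambda>n. f n x)" using assms(1) by (auto simp: incseq_def le_fun_def)
    from LIMSEQ_unique[OF LIMSEQ_SUP[OF this] assms(3)] show "(SUP n. f n x) = u x" .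
  qed
  finally show ?thesis .
qed

text \<open>The change of variables \<open>w = ((1 - v) / v) powr \<alpha>\<close>, written with
  \<open>y = 1 - v\<close> so that it is increasing. Its derivative may blow up at the ends of the
  unit interval, so it is carried out on compact subintervals that exhaust the interval.\<close>

lemma nn_integral_substitution_ratio:
  fixes h :: "real \<Rightarrow> ennreal"
  assumes \<alpha>: "0 < \<alpha>" and [measurable]: "h \<in> borel_measurable borel"
  shows "(\<integral>\<^sup>+w. h (1 / (1 + w powr (1 / \<alpha>))) * indicator {0<..} w \<partial>lborel) =
    (\<integral>\<^sup>+v. h v * ennreal (\<alpha> * v powr (- \<alpha> - 1) * (1 - v) powr (\<alpha> - 1)) * indicator {0<..<1} v \<partial>lborel)"
proof -
  define \<phi> where "\<phi> y = (y / (1 - y)) powr \<alpha>" for y :: real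
  define \<phi>' where "\<phi>' y = \<alpha> * y powr (\<alpha> - 1) * (1 - y) powr (- \<alpha> - 1)" for y :: real
  define f where "f w = h (1 / (1 + w powr (1 / \<alpha>)))" for w
  \<comment> \<open>The summand 3 ensures \<open>a n < b n\<close> already for
    \<open>n = 0\<close>.\<close>
  define a where "a n = 1 / (real n + 3)" for n
  define b where "b n = 1 - 1 / (real n + 3)" for n
  have [measurable]: "f \<in> borel_measurable borel" unfolding f_def by measurable
  have ab: "0 < a n" "a n < b n" "b n < 1" for n
    by (auto simp: a_def b_def field_simps)
  have mono: "decseq a" "incseq b"
    by (auto simp: a_def b_def decseq_def incseq_def field_simps)
  have lim: "a \<longlonglongrightarrow> 0" "b \<longlonglongrightarrow> 1"
    unfolding a_def b_def by real_asymp+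
  have ev: "eventually (\<lambda>n. y \<in> {a n..b n}) sequentially" if "0 < y" "y < 1" for y
    using order_tendstoD(2)[OF lim(1) that(1)] order_tendstoD(1)[OF lim(2) that(2)]
    by eventually_elim auto
  \<comment> \<open>The inverse of \<open>\<phi>\<close> on the positive half-line.\<close>
  define Y where "Y w = w powr (1 / \<alpha>) / (1 + w powr (1 / \<alpha>))" for w
  have Y: "0 < Y w" "Y w < 1" if "0 < w" for w
    using that by (auto simp: Y_def intro!: divide_pos_pos add_pos_pos) (simp add: add_pos_pos)
  have \<phi>Y: "\<phi> (Y w) = w" if "0 < w" for w
  proof -
    have "1 + w powr (1 / \<alpha>) > 0" using that by (simp add: add_pos_pos)
    then have "Y w / (1 - Y w) = w powr (1 / \<alpha>)"
      by (simp add: Y_def field_simps)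
    then show ?thesis using that \<alpha> by (simp add: \<phi>_def powr_powr)
  qed
  have \<phi>_pos: "0 < \<phi> y" if "0 < y" "y < 1" for y using that by (simp add: \<phi>_def)
  have \<phi>_mono: "\<phi> x \<le> \<phi> y \<longleftrightarrow> x \<le> y" if "0 < x" "x < 1" "0 < y" "y < 1" for x y
  proof -
    have "\<phi> x \<le> \<phi> y \<longleftrightarrow> x / (1 - x) \<le> y / (1 - y)"
    proof
      have pos: "0 \<le> x / (1 - x)" "0 \<le> y / (1 - y)" using that by auto
      show "x / (1 - x) \<le> y / (1 - y)" if "\<phi> x \<le> \<phi> y"
        using powr_less_mono2[OF \<alpha> pos(2), of "x / (1 - x)"] that unfolding \<phi>_def by linarith
      show "\<phi> x \<le> \<phi> y" if "x / (1 - x) \<le> y / (1 - y)"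
        using powr_mono2[OF _ pos(1) that] \<alpha> unfolding \<phi>_def by simp
    qed
    also have "\<dots> \<longleftrightarrow> x \<le> y" using that by (simp add: field_simps)
    finally show ?thesis .
  qed
  have ind: "indicator {\<phi> (a n)..\<phi> (b n)} w = (indicator {a n..b n} (Y w) * indicator {0<..} w :: ennreal)" for n w
  proof (cases "0 < w")
    case True
    then show ?thesis
      using \<phi>_mono[of "a n" "Y w"] \<phi>_mono[of "Y w" "b n"] ab[of n] Y[OF True] \<phi>Y[OF True]
      by (auto simp: indicator_def)
  next
    case False
    then show ?thesis using \<phi>_pos[of "a n"] ab[of n] by (auto simp: indicator_def)
  qed
  have eq: "(\<integral>\<^sup>+w. f w * indicator {\<phi> (a n)..\<phi> (b n)} w \<partial>lborel) =
      (\<integral>\<^sup>+y. f (\<phi> y) * \<phi>' y * indicator {a n..b n} y \<partial>lborel)" for n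
  proof (rule nn_integral_substitution_aux)
    fix y assume "y \<in> {a n..b n}"
    then have y: "0 < y" "y < 1" using ab[of n] by auto
    have "((\<lambda>y. y / (1 - y)) has_real_derivative (1 * (1 - y) - y * (0 - 1)) / ((1 - y) * (1 - y))) (at y)"
      using y by (intro derivative_intros) auto
    then have "((\<lambda>y. y / (1 - y)) has_real_derivative 1 / (1 - y)\<^sup>2) (at y)"
      by (simp add: power2_eq_square)
    then have "(\<phi> has_real_derivative \<alpha> * (y / (1 - y)) powr (\<alpha> - 1) * (1 / (1 - y)\<^sup>2)) (at y)"
      unfolding \<phi>_def using y DERIV_fun_powr[of "\<lambda>y. y / (1 - y)" "1 / (1 - y)\<^sup>2" y \<alpha>] by simp
    moreover have "\<alpha> * (y / (1 - y)) powr (\<alpha> - 1) * (1 / (1 - y)\<^sup>2) = \<phi>' y"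
    proof -
      have "(y / (1 - y)) powr (\<alpha> - 1) * (1 / (1 - y)\<^sup>2) =
          y powr (\<alpha> - 1) * ((1 - y) powr (- (\<alpha> - 1)) * (1 - y) powr (- 2))"
        unfolding powr_minus[of "1 - y"] using y by (simp add: powr_divide powr_numeral) (simp add: divide_inverse)
      also have "\<dots> = y powr (\<alpha> - 1) * (1 - y) powr (- \<alpha> - 1)"
      proof -
        have "- (\<alpha> - 1) + - 2 = - \<alpha> - 1" by simp
        then show ?thesis unfolding powr_add[symmetric] by (simp only:)
      qed
      finally show ?thesis unfolding \<phi>'_def by (metis mult.assoc)
    qed
    ultimately show "(\<phi> has_real_derivative \<phi>' y) (at y)" by simp
    show "0 \<le> \<phi>' y" using \<alpha> by (simp add: \<phi>'_def)
  next
    show "continuous_on {a n..b n} \<phi>'"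
      unfolding \<phi>'_def using ab[of n] by (intro continuous_intros) auto
  qed (use ab in auto)
  have L: "(\<lambda>n. \<integral>\<^sup>+w. f w * indicator {\<phi> (a n)..\<phi> (b n)} w \<partial>lborel) \<longlonglongrightarrow> (\<integral>\<^sup>+w. f w * indicator {0<..} w \<partial>lborel)"
  proof (rule nn_integral_LIMSEQ)
    show "incseq (\<lambda>n w. f w * indicator {\<phi> (a n)..\<phi> (b n)} w)"
    proof (rule incseq_indicator_interval)
      show "decseq (\<lambda>n. \<phi> (a n))" "incseq (\<lambda>n. \<phi> (b n))"
        using mono ab \<phi>_mono unfolding decseq_def incseq_def by (meson less_trans)+
    qed
    show "(\<lambda>n. f w * indicator {\<phi> (a n)..\<phi> (b n)} w) \<longlonglongrightarrow> f w * indicator {0<..} w" for w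
    proof (cases "0 < w")
      case True
      have "(\<lambda>n. f w * indicator {a n..b n} (Y w)) \<longlonglongrightarrow> f w * 1"
        by (rule tendsto_eventually) (use ev[OF Y[OF True]] in eventually_elim, simp)
      then show ?thesis using True by (simp add: ind)
    next
      case False
      then show ?thesis by (simp add: ind)
    qed
  qed measurable
  have R: "(\<lambda>n. \<integral>\<^sup>+y. f (\<phi> y) * \<phi>' y * indicator {a n..b n} y \<partial>lborel) \<longlonglongrightarrow> (\<integral>\<^sup>+y. f (\<phi> y) * \<phi>' y * indicator {0<..<1} y \<partial>lborel)"
  proof (rule nn_integral_LIMSEQ)
    show "incseq (\<lambda>n w. f (\<phi> w) * ennreal (\<phi>' w) * indicator {a n..b n} w)"
      by (rule incseq_indicator_interval mono)+
    show "(\<lambda>n. f (\<phi> y) * \<phi>' y * indicator {a n..b n} y) \<longlonglongrightarrow> f (\<phi> y) * \<phi>' y * indicator {0<..<1} y" for y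
    proof (cases "0 < y \<and> y < 1")
      case True
      show ?thesis
        by (rule tendsto_eventually) (use ev[of y] True in \<open>auto elim!: eventually_mono\<close>)
    next
      case False
      then have "indicator {a n..b n} y = (0 :: ennreal)" for n
        using ab[of n] by (auto simp: indicator_def)
      moreover have "indicator {0<..<1} y = (0 :: ennreal)" using False by (auto simp: indicator_def)
      ultimately show ?thesis by simp
    qed
  qed (unfold \<phi>_def \<phi>'_def, measurable)
  have "(\<integral>\<^sup>+w. f w * indicator {0<..} w \<partial>lborel) = (\<integral>\<^sup>+y. f (\<phi> y) * \<phi>' y * indicator {0<..<1} y \<partial>lborel)"
    using L R unfolding eq by (rule LIMSEQ_unique)
  also have "\<dots> = (\<integral>\<^sup>+y. h (1 - y) * \<phi>' y * indicator {0<..<1} y \<partial>lborel)"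
  proof (intro nn_integral_cong)
    fix y :: real
    have "f (\<phi> y) = h (1 - y)" if "0 < y" "y < 1"
    proof -
      have "\<phi> y powr (1 / \<alpha>) = y / (1 - y)" using that \<alpha> by (simp add: \<phi>_def powr_powr)
      moreover have "1 / (1 + y / (1 - y)) = 1 - y" using that by (simp add: field_simps)
      ultimately have "1 / (1 + \<phi> y powr (1 / \<alpha>)) = 1 - y" by (simp only:)
      then show ?thesis by (simp add: f_def)
    qed
    then show "f (\<phi> y) * \<phi>' y * indicator {0<..<1} y = h (1 - y) * \<phi>' y * indicator {0<..<1} y"
      by (auto simp: indicator_def)
  qed
  also have "\<dots> = ennreal \<bar>-1\<bar> * (\<integral>\<^sup>+v. h (1 - (1 + -1 * v)) * \<phi>' (1 + -1 * v) * indicator {0<..<1} (1 + -1 * v) \<partial>lborel)"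
    unfolding \<phi>'_def by (rule nn_integral_real_affine) simp_all
  also have "\<dots> = (\<integral>\<^sup>+v. h v * ennreal (\<alpha> * v powr (- \<alpha> - 1) * (1 - v) powr (\<alpha> - 1)) * indicator {0<..<1} v \<partial>lborel)"
    by (auto intro!: nn_integral_cong simp: \<phi>'_def indicator_def mult_ac)
  finally show ?thesis by (simp add: f_def)
qed

section \<open>The recursion for size-biased removal\<close>

definition jump_sum :: "real \<Rightarrow> (nat \<Rightarrow> real) \<Rightarrow> real" where
  "jump_sum \<alpha> x = (\<Sum>n. x n powr (- 1 / \<alpha>))"

text \<open>The expectation under the weighted law before division by its total mass. The argument
  \<open>r\<close> is the length of stick still to be broken, over which the normalised points are
  spread.\<close>

definition biased :: "real \<Rightarrow> (real \<Rightarrow> ennreal) \<Rightarrow> nat \<Rightarrow> real \<Rightarrow> ennreal" where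
  "biased \<alpha> g k r = (\<integral>\<^sup>+u. ennreal (jump_sum \<alpha> (arrivals u) powr (- (real k * \<alpha>))) *
     gprod (\<lambda>y. g (r * (y powr (- 1 / \<alpha>) / jump_sum \<alpha> (arrivals u)))) (arrivals u) \<partial>exp_seq)"

lemma measurable_jump_sum [measurable]: "jump_sum \<alpha> \<in> borel_measurable seq_borel"
  unfolding jump_sum_def by measurable

lemma measurable_biased [measurable]:
  assumes [measurable]: "g \<in> borel_measurable borel"
  shows "biased \<alpha> g k \<in> borel_measurable borel"
  unfolding biased_def gprod_def by measurable

lemma jump_sum_pos:
  assumes "summable (\<lambda>n. x n powr (- 1 / \<alpha>))" "\<And>n. 0 < x n"
  shows "0 < jump_sum \<alpha> x"
  unfolding jump_sum_def
proof (rule suminf_pos)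
  show "0 < x n powr (- 1 / \<alpha>)" for n using assms(2)[of n] by simp
qed (rule assms(1))

lemma jump_sum_delete_at:
  assumes "summable (\<lambda>n. x n powr (- 1 / \<alpha>))"
  shows "jump_sum \<alpha> x = x i powr (- 1 / \<alpha>) + jump_sum \<alpha> (delete_at i x)"
proof -
  let ?f = "\<lambda>n. x n powr (- 1 / \<alpha>)"
  have "(\<lambda>n. ?f (n + Suc i)) sums (suminf ?f - (\<Sum>n<Suc i. ?f n))"
    using assms by (intro sums_split_initial_segment summable_sums)
  then have "(\<lambda>n. delete_at i x (n + i) powr (- 1 / \<alpha>)) sums (suminf ?f - (\<Sum>n<Suc i. ?f n))"
    by (simp add: delete_at_def)
  then have "(\<lambda>n. delete_at i x n powr (- 1 / \<alpha>)) sums (suminf ?f - (\<Sum>n<Suc i. ?f n) + (\<Sum>n<i. delete_at i x n powr (- 1 / \<alpha>)))"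
    by (subst (asm) sums_iff_shift) 
  moreover have "(\<Sum>n<i. delete_at i x n powr (- 1 / \<alpha>)) = (\<Sum>n<i. ?f n)"
    by (intro sum.cong) (auto simp: delete_at_def)
  ultimately show ?thesis by (simp add: jump_sum_def sums_iff)
qed

lemma AE_arrivals_good:
  assumes "0 < \<alpha>" "\<alpha> < 1"
  shows "AE u in exp_seq. (\<forall>n. 0 < arrivals u n) \<and> decseq (\<lambda>n. arrivals u n powr (- 1 / \<alpha>)) \<and> summable (\<lambda>n. arrivals u n powr (- 1 / \<alpha>)) \<and> 0 < jump_sum \<alpha> (arrivals u)"
  using AE_exp_seq_pos AE_summable_arrivals[OF assms]
proof eventually_elim
  case (elim u)
  then have pos: "\<forall>n. 0 < arrivals u n" by (auto simp: arrivals_def intro!: sum_pos)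
  have "decseq (\<lambda>n. arrivals u n powr (- 1 / \<alpha>))"
  proof (rule decseq_SucI)
    fix n
    have "arrivals u n \<le> arrivals u (Suc n)" using elim by (simp add: arrivals_def less_imp_le)
    then show "arrivals u (Suc n) powr (- 1 / \<alpha>) \<le> arrivals u n powr (- 1 / \<alpha>)"
      using pos assms by (intro powr_mono2') auto
  qed
  then show ?case using elim pos by (auto intro!: jump_sum_pos)
qed

text \<open>Insert \<open>1 = (\<Sum>i. p i)\<close>, where \<open>p\<close> are the normalised points, and apply the Mecke formula;
  the substitution \<open>v = q / (q + T)\<close> separates the removed point from the rescaled remaining ones.\<close>

lemma biased_rec:
  assumes \<alpha>: "0 < \<alpha>" "\<alpha> < 1" and g [measurable]: "g \<in> borel_measurable borel" and g_le: "\<And>q. g q \<le> 1"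
  shows "biased \<alpha> g k r = (\<integral>\<^sup>+v. ennreal (\<alpha> * v powr (- \<alpha>) * (1 - v) powr (real (Suc k) * \<alpha> - 1)) * indicator {0<..<1} v *
      (g (r * v) * biased \<alpha> g (Suc k) (r * (1 - v))) \<partial>lborel)"
proof -
  let ?J = "\<lambda>v. ennreal (\<alpha> * v powr (- \<alpha> - 1) * (1 - v) powr (\<alpha> - 1))"
  define p where "p = - 1 / \<alpha>"
  \<comment> \<open>Here \<open>x\<close> is the configuration without the removed arrival
    \<open>\<gamma>\<close>, so the full sum \<open>T\<close> has to be reassembled. The first
    factor is the probability of choosing this point.\<close>
  define G where "G \<gamma> x = (let T = \<gamma> powr p + jump_sum \<alpha> x in
      ennreal (\<gamma> powr p / T) * ennreal (T powr (- (real k * \<alpha>))) * g (r * (\<gamma> powr p / T)) *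
      gprod (\<lambda>y. g (r * (y powr p / T))) x)" for \<gamma> x
  have [measurable]: "case_prod G \<in> borel_measurable (borel \<Otimes>\<^sub>M seq_borel)"
    unfolding G_def Let_def gprod_def case_prod_unfold by measurable
  define D where "D v = ennreal (\<alpha> * v powr (- \<alpha>) * (1 - v) powr (real (Suc k) * \<alpha> - 1)) * indicator {0<..<1} v" for v
  have [measurable]: "D \<in> borel_measurable borel" unfolding D_def by measurable
  define Q where "Q x s = ennreal (jump_sum \<alpha> x powr (- (real (Suc k) * \<alpha>))) * gprod (\<lambda>y. g (s * (y powr p / jump_sum \<alpha> x))) x" for x s
  have [measurable]: "case_prod Q \<in> borel_measurable (seq_borel \<Otimes>\<^sub>M borel)"
    unfolding Q_def gprod_def case_prod_unfold by measurable
  have "biased \<alpha> g k r = (\<integral>\<^sup>+u. (\<Sum>i. G (arrivals u i) (delete_at i (arrivals u))) \<partial>exp_seq)"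
    unfolding biased_def
  proof (rule nn_integral_cong_AE)
    show "AE u in exp_seq. ennreal (jump_sum \<alpha> (arrivals u) powr (- (real k * \<alpha>))) *
        gprod (\<lambda>y. g (r * (y powr (- 1 / \<alpha>) / jump_sum \<alpha> (arrivals u)))) (arrivals u) =
        (\<Sum>i. G (arrivals u i) (delete_at i (arrivals u)))"
      using AE_arrivals_good[OF \<alpha>]
    proof eventually_elim
      case (elim u)
      define x where "x = arrivals u"
      define T where "T = jump_sum \<alpha> x"
      have T: "0 < T" "summable (\<lambda>n. x n powr p)" using elim by (auto simp: T_def x_def p_def)
      have "G (x i) (delete_at i x) = ennreal (x i powr p / T) *
          (ennreal (T powr (- (real k * \<alpha>))) * gprod (\<lambda>y. g (r * (y powr p / T))) x)" for i
        unfolding G_def Let_def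
        using jump_sum_delete_at[of x \<alpha> i] T(2) g_le gprod_delete_at[of "\<lambda>y. g (r * (y powr p / T))" x i]
        by (simp add: T_def p_def mult_ac)
      then have "(\<Sum>i. G (x i) (delete_at i x)) = (\<Sum>i. ennreal (x i powr p / T)) *
          (ennreal (T powr (- (real k * \<alpha>))) * gprod (\<lambda>y. g (r * (y powr p / T))) x)"
        by simp
      also have "(\<Sum>i. ennreal (x i powr p / T)) = ennreal (\<Sum>i. x i powr p / T)"
        using T by (intro suminf_ennreal2 summable_divide) auto
      also have "(\<Sum>i. x i powr p / T) = 1"
        using T suminf_divide[OF T(2), of T] by (simp add: T_def jump_sum_def p_def)
      finally show ?case by (simp add: x_def T_def p_def)
    qed
  qed
  also have "\<dots> = (\<integral>\<^sup>+u. \<integral>\<^sup>+\<gamma>. G \<gamma> (arrivals u) * indicator {0<..} \<gamma> \<partial>lborel \<partial>exp_seq)"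
    by (rule Mecke_arrivals) measurable
  also have "\<dots> = (\<integral>\<^sup>+u. \<integral>\<^sup>+v. D v * (g (r * v) * Q (arrivals u) (r * (1 - v))) \<partial>lborel \<partial>exp_seq)"
  proof (rule nn_integral_cong_AE)
    show "AE u in exp_seq. (\<integral>\<^sup>+\<gamma>. G \<gamma> (arrivals u) * indicator {0<..} \<gamma> \<partial>lborel) =
        (\<integral>\<^sup>+v. D v * (g (r * v) * Q (arrivals u) (r * (1 - v))) \<partial>lborel)"
      using AE_arrivals_good[OF \<alpha>]
    proof eventually_elim
      case (elim u)
      define x where "x = arrivals u"
      define T where "T = jump_sum \<alpha> x"
      have T: "0 < T" using elim by (auto simp: T_def x_def)
      \<comment> \<open>With \<open>\<gamma> = c * w\<close> the removed jump is
        \<open>T * w powr p\<close>, so its share of the total is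
        \<open>1 / (1 + w powr (1 / \<alpha>))\<close> whatever \<open>T\<close> is. The Jacobian
        \<open>c\<close> raises the weight from exponent \<open>k\<close> to
        \<open>Suc k\<close>.\<close>
      define c where "c = T powr (- \<alpha>)"
      have c: "0 < c" using T by (simp add: c_def)
      have cp: "(c * w) powr p = T * w powr p" if "0 < w" for w
        using that T \<alpha> by (simp add: c_def p_def powr_mult powr_powr)
      \<comment> \<open>If the removed point takes the share \<open>v\<close>, the full sum is
        \<open>T / (1 - v)\<close>. Dividing the other points by it amounts to normalising them by
        \<open>T\<close> and scaling by \<open>1 - v\<close>.\<close>
      define h where "h v = ennreal v * ennreal ((T / (1 - v)) powr (- (real k * \<alpha>))) * g (r * v) *
          gprod (\<lambda>y. g (r * (1 - v) * (y powr p / T))) x" for v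
      have [measurable]: "h \<in> borel_measurable borel"
        unfolding h_def gprod_def by measurable
      have "(\<integral>\<^sup>+\<gamma>. G \<gamma> x * indicator {0<..} \<gamma> \<partial>lborel) =
          ennreal \<bar>c\<bar> * (\<integral>\<^sup>+w. G (0 + c * w) x * indicator {0<..} (0 + c * w) \<partial>lborel)"
        using c by (intro nn_integral_real_affine) simp_all
      also have "(\<integral>\<^sup>+w. G (0 + c * w) x * indicator {0<..} (0 + c * w) \<partial>lborel) =
          (\<integral>\<^sup>+w. h (1 / (1 + w powr (1 / \<alpha>))) * indicator {0<..} w \<partial>lborel)"
      proof (intro nn_integral_cong)
        fix w :: real
        show "G (0 + c * w) x * indicator {0<..} (0 + c * w) = h (1 / (1 + w powr (1 / \<alpha>))) * indicator {0<..} w"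
        proof (cases "0 < w")
          case True
          define v where "v = 1 / (1 + w powr (1 / \<alpha>))"
          have wp: "w powr p = 1 / w powr (1 / \<alpha>)" "0 < w powr (1 / \<alpha>)"
            using True by (auto simp: p_def powr_minus_divide)
          have v: "0 < v" "v < 1" using wp by (auto simp: v_def add_pos_pos)
          have v': "1 - v = w powr (1 / \<alpha>) / (1 + w powr (1 / \<alpha>))"
          proof -
            have "1 + w powr (1 / \<alpha>) \<noteq> 0" using wp by linarith
            then show ?thesis by (simp add: v_def field_simps)
          qed
          have e: "T / (1 - v) = T * (1 + w powr (1 / \<alpha>)) / w powr (1 / \<alpha>)"
            unfolding v' by simp
          have T': "(c * w) powr p + jump_sum \<alpha> x = T / (1 - v)"
          proof -
            have "T / (1 - v) = T * w powr p + T" unfolding e using wp by (simp add: field_simps)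
            then show ?thesis by (simp add: cp[OF True] T_def)
          qed
          have q: "(c * w) powr p / (T / (1 - v)) = v"
          proof -
            have "v * (T / (1 - v)) = (v * (1 + w powr (1 / \<alpha>))) * (T / w powr (1 / \<alpha>))"
              unfolding e by simp
            also have "v * (1 + w powr (1 / \<alpha>)) = 1"
            proof -
              have "1 + w powr (1 / \<alpha>) \<noteq> 0" using wp by linarith
              then show ?thesis by (simp add: v_def)
            qed
            finally have "v * (T / (1 - v)) = T * w powr p" using wp by simp
            moreover have "T / (1 - v) \<noteq> 0" using T v by simp
            ultimately show ?thesis by (simp only: cp[OF True]) (metis nonzero_mult_div_cancel_right)
          qed
          have "r * (y powr p / (T / (1 - v))) = r * (1 - v) * (y powr p / T)" for y by simp
          then have "G (c * w) x = h v"
            unfolding G_def Let_def h_def T' q by (simp only:)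
          then show ?thesis using True c by (simp add: v_def)
        next
          case False
          then show ?thesis using c by (simp add: zero_less_mult_iff)
        qed
      qed
      also have "\<dots> = (\<integral>\<^sup>+v. h v * ?J v * indicator {0<..<1} v \<partial>lborel)"
        using \<alpha> by (intro nn_integral_substitution_ratio) measurable
      also have "ennreal \<bar>c\<bar> * \<dots> = (\<integral>\<^sup>+v. ennreal \<bar>c\<bar> * (h v * ?J v * indicator {0<..<1} v) \<partial>lborel)"
        by (rule nn_integral_cmult[symmetric]) measurable
      also have "\<dots> = (\<integral>\<^sup>+v. D v * (g (r * v) * Q x (r * (1 - v))) \<partial>lborel)"
      proof (intro nn_integral_cong)
        fix v :: real
        show "ennreal \<bar>c\<bar> * (h v * ?J v * indicator {0<..<1} v) =
            D v * (g (r * v) * Q x (r * (1 - v)))"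
        proof (cases "0 < v \<and> v < 1")
          case True
          have "c * (v * (T / (1 - v)) powr (- (real k * \<alpha>)) * (\<alpha> * v powr (- \<alpha> - 1) * (1 - v) powr (\<alpha> - 1))) =
              \<alpha> * v powr (- \<alpha>) * (1 - v) powr (real (Suc k) * \<alpha> - 1) * T powr (- (real (Suc k) * \<alpha>))"
          proof -
            have 1: "(T / (1 - v)) powr (- (real k * \<alpha>)) = T powr (- (real k * \<alpha>)) * (1 - v) powr (real k * \<alpha>)"
              using T True by (simp add: powr_divide powr_minus_divide)
            have 2: "v * v powr (- \<alpha> - 1) = v powr (- \<alpha>)"
              using True powr_mult_base[of v "- \<alpha> - 1"] by simp
            have 3: "(1 - v) powr (real k * \<alpha>) * (1 - v) powr (\<alpha> - 1) = (1 - v) powr (real (Suc k) * \<alpha> - 1)"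
              by (subst powr_add[symmetric]) (simp add: algebra_simps)
            have 4: "c * T powr (- (real k * \<alpha>)) = T powr (- (real (Suc k) * \<alpha>))"
              unfolding c_def by (subst powr_add[symmetric]) (simp add: algebra_simps)
            show ?thesis unfolding 1 2[symmetric] 3[symmetric] 4[symmetric] by (simp only: ac_simps)
          qed
          then have "ennreal c * ennreal v * ennreal ((T / (1 - v)) powr (- (real k * \<alpha>))) *
              ?J v =
              ennreal (\<alpha> * v powr (- \<alpha>) * (1 - v) powr (real (Suc k) * \<alpha> - 1)) * ennreal (T powr (- (real (Suc k) * \<alpha>)))"
            using c True \<alpha> by (simp add: ennreal_mult[symmetric] mult.assoc)
          note E = this
          have L: "c' * (v' * A * gv * gp * B * 1) = (c' * v' * A * B) * (gv * gp)" for c' v' A gv gp B :: ennreal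
            by (simp add: mult_ac)
          have R: "E' * 1 * (gv * (F * gp)) = (E' * F) * (gv * gp)" for E' F gv gp :: ennreal
            by (simp add: mult_ac)
          have i: "indicator {0<..<1} v = (1 :: ennreal)" "\<bar>c\<bar> = c" using True c by auto
          show ?thesis
            unfolding h_def D_def Q_def T_def[symmetric] i L R E ..
        next
          case False
          then show ?thesis by (auto simp: D_def indicator_def)
        qed
      qed
      finally show ?case by (simp add: x_def)
    qed
  qed
  also have "\<dots> = (\<integral>\<^sup>+v. \<integral>\<^sup>+u. D v * (g (r * v) * Q (arrivals u) (r * (1 - v))) \<partial>exp_seq \<partial>lborel)"
  proof -
    interpret pair_sigma_finite lborel exp_seq ..
    show ?thesis by (rule Fubini') measurable
  qed
  also have "\<dots> = (\<integral>\<^sup>+v. D v * (g (r * v) * biased \<alpha> g (Suc k) (r * (1 - v))) \<partial>lborel)"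
    unfolding biased_def Q_def p_def gprod_def by (intro nn_integral_cong) (simp add: nn_integral_cmult)
  finally show ?thesis by (simp add: D_def)
qed

section \<open>Integrals against beta distributions\<close>

lemma Beta_pos: "0 < a \<Longrightarrow> 0 < b \<Longrightarrow> 0 < Beta a (b :: real)"
  by (simp add: Beta_def Gamma_real_pos)

lemma sets_beta_distribution [measurable_cong, simp]: "sets (beta_distribution a b) = sets borel"
  by (simp add: beta_distribution_def)

lemma space_beta_distribution [simp]: "space (beta_distribution a b) = UNIV"
  by (simp add: beta_distribution_def)

lemma nn_integral_Beta:
  assumes "0 < a" "0 < b"
  shows "(\<integral>\<^sup>+x. ennreal (x powr (a - 1) * (1 - x) powr (b - 1)) * indicator {0<..<1} x \<partial>lborel) = ennreal (Beta a b)"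
proof -
  have "((\<lambda>t. t powr (a - 1) * (1 - t) powr (b - 1)) has_integral Beta a b) {0<..<1}"
    using has_integral_Beta_real[OF assms] by (simp add: has_integral_Icc_iff_Ioo)
  from nn_integral_has_integral_lebesgue[OF _ this] show ?thesis
    by (auto simp: ennreal_mult' ennreal_indicator mult.commute intro!: nn_integral_cong)
qed

lemma nn_integral_beta_distribution:
  assumes "0 < a" "0 < b" and [measurable]: "f \<in> borel_measurable borel"
  shows "ennreal (Beta a b) * (\<integral>\<^sup>+x. f x \<partial>beta_distribution a b) =
    (\<integral>\<^sup>+x. ennreal (x powr (a - 1) * (1 - x) powr (b - 1)) * indicator {0<..<1} x * f x \<partial>lborel)"
proof -
  let ?d = "\<lambda>x. ennreal (indicator {0<..<1} x * (x powr (a - 1) * (1 - x) powr (b - 1) / Beta a b))"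
  have "ennreal (Beta a b) * (\<integral>\<^sup>+x. f x \<partial>beta_distribution a b) = (\<integral>\<^sup>+x. ennreal (Beta a b) * (?d x * f x) \<partial>lborel)"
    unfolding beta_distribution_def by (subst nn_integral_density) (auto simp: nn_integral_cmult)
  also have "\<dots> = (\<integral>\<^sup>+x. ennreal (x powr (a - 1) * (1 - x) powr (b - 1)) * indicator {0<..<1} x * f x \<partial>lborel)"
  proof (intro nn_integral_cong)
    fix x :: real
    have "ennreal (Beta a b) * ?d x = ennreal (x powr (a - 1) * (1 - x) powr (b - 1)) * indicator {0<..<1} x"
      using Beta_pos[OF assms(1,2)] by (auto simp: indicator_def ennreal_mult'[symmetric])
    then show "ennreal (Beta a b) * (?d x * f x) = ennreal (x powr (a - 1) * (1 - x) powr (b - 1)) * indicator {0<..<1} x * f x"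
      by (simp add: mult.assoc[symmetric])
  qed
  finally show ?thesis .
qed

lemma prob_space_beta_distribution:
  assumes "0 < a" "0 < b"
  shows "prob_space (beta_distribution a b)"
proof
  have "ennreal (Beta a b) * (\<integral>\<^sup>+x. 1 \<partial>beta_distribution a b) = ennreal (Beta a b) * 1"
    using nn_integral_beta_distribution[OF assms, of "\<lambda>_. 1"] nn_integral_Beta[OF assms] by simp
  then have "(\<integral>\<^sup>+x. 1 \<partial>beta_distribution a b) = 1"
    using Beta_pos[OF assms] by (subst (asm) ennreal_mult_cancel_left) auto
  then show "emeasure (beta_distribution a b) (space (beta_distribution a b)) = 1" by simp
qed

lemma AE_beta_distribution: "AE x in beta_distribution a b. 0 < x \<and> x < 1"
  unfolding beta_distribution_def by (subst AE_density) (auto simp: indicator_def)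

lemma nn_integral_beta_distribution_one_minus:
  assumes "0 < a" "0 < b"
  shows "(\<integral>\<^sup>+x. ennreal (1 - x) \<partial>beta_distribution a b) = ennreal (b / (a + b))"
proof -
  have "ennreal (Beta a b) * (\<integral>\<^sup>+x. ennreal (1 - x) \<partial>beta_distribution a b) =
      (\<integral>\<^sup>+x. ennreal (x powr (a - 1) * (1 - x) powr ((b + 1) - 1)) * indicator {0<..<1} x \<partial>lborel)"
  proof (subst nn_integral_beta_distribution[OF assms])
    show "(\<integral>\<^sup>+x. ennreal (x powr (a - 1) * (1 - x) powr (b - 1)) * indicator {0<..<1} x * ennreal (1 - x) \<partial>lborel) =
      (\<integral>\<^sup>+x. ennreal (x powr (a - 1) * (1 - x) powr ((b + 1) - 1)) * indicator {0<..<1} x \<partial>lborel)"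
    proof (intro nn_integral_cong)
      fix x :: real
      have "(1 - x) powr (b - 1) * (1 - x) = (1 - x) powr b" if "x < 1"
        using that powr_mult_base[of "1 - x" "b - 1"] by (simp add: mult.commute)
      then show "ennreal (x powr (a - 1) * (1 - x) powr (b - 1)) * indicator {0<..<1} x * ennreal (1 - x) =
          ennreal (x powr (a - 1) * (1 - x) powr ((b + 1) - 1)) * indicator {0<..<1} x"
        by (auto simp: indicator_def ennreal_mult'[symmetric] mult.assoc)
    qed
  qed measurable
  also have "\<dots> = ennreal (Beta a (b + 1))"
    using assms by (intro nn_integral_Beta) auto
  also have "Beta a (b + 1) = Beta a b * (b / (a + b))"
  proof -
    have "b \<notin> \<int>\<^sub>\<le>\<^sub>0" using assms(2) by (auto elim!: nonpos_Ints_cases)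
    from Beta_plus1_right[OF this, of a] show ?thesis using assms by (simp add: field_simps)
  qed
  also have "ennreal \<dots> = ennreal (Beta a b) * ennreal (b / (a + b))"
    using assms Beta_pos[OF assms] by (intro ennreal_mult) auto
  finally show ?thesis
    using Beta_pos[OF assms] by (subst (asm) ennreal_mult_cancel_left) auto
qed

definition rest_mass :: "(nat \<Rightarrow> real) \<Rightarrow> nat \<Rightarrow> real" where
  "rest_mass u k = (\<Prod>j<k. 1 - u j)"

lemma measurable_rest_mass [measurable]: "(\<lambda>u. rest_mass u k) \<in> borel_measurable seq_borel"
  unfolding rest_mass_def by measurable

lemma measurable_stick_breaking [measurable]: "stick_breaking \<in> measurable seq_borel seq_borel"
  by (rule measurable_PiM_single') (auto simp: stick_breaking_def)

lemma stick_breaking_rest_mass: "stick_breaking u k = rest_mass u k * u k"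
  by (simp add: stick_breaking_def rest_mass_def)

section \<open>Iterating the recursion along the sticks\<close>

context
  fixes \<alpha> :: real
  assumes \<alpha>: "0 < \<alpha>" "\<alpha> < 1"
begin

text \<open>The summand 0 is the parameter \<open>\<theta>\<close>; it stays so that the factors of
  \<open>stick_variables \<alpha> 0\<close> match literally.\<close>

definition stick_law :: "nat \<Rightarrow> real measure" where
  "stick_law i = beta_distribution (1 - \<alpha>) (0 + real (i + 1) * \<alpha>)"

abbreviation sticks :: "(nat \<Rightarrow> real) measure" where
  "sticks \<equiv> stick_variables \<alpha> 0"

lemma stick_variables_eq: "sticks = PiM UNIV stick_law"
  unfolding stick_variables_def stick_law_def ..

lemma sets_stick_law [measurable_cong, simp]: "sets (stick_law i) = sets borel"
  by (simp add: stick_law_def)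

lemma params_pos: "0 < 1 - \<alpha>" "0 < 0 + real (i + 1) * \<alpha>"
  using \<alpha> by auto

lemma prob_space_stick_law: "prob_space (stick_law i)"
  unfolding stick_law_def by (intro prob_space_beta_distribution params_pos)

lemma sets_stick_variables [measurable_cong, simp]: "sets (sticks) = sets seq_borel"
  unfolding stick_variables_eq by (rule sets_PiM_cong) auto

lemma space_stick_variables [simp]: "space (sticks) = UNIV"
  using sets_eq_imp_space_eq[OF sets_stick_variables] by (simp add: space_PiM)

interpretation V: prob_space sticks
  unfolding stick_variables_eq by (rule prob_space_PiM) (rule prob_space_stick_law)

interpretation VP: product_prob_space stick_law "UNIV :: nat set"
  by (intro product_prob_spaceI prob_space_stick_law)

lemma prob_space_stick_variables: "prob_space (sticks)"
  by (rule V.prob_space_axioms)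

lemma AE_stick_variables: "AE u in sticks. \<forall>i. 0 < u i \<and> u i < 1"
  unfolding stick_variables_eq AE_all_countable
proof (intro allI VP.AE_component)
  show "AE x in stick_law i. 0 < x \<and> x < 1" for i
    unfolding stick_law_def by (rule AE_beta_distribution)
qed simp

text \<open>The mean remaining mass is a product of beta means, bounded by the exponential of minus
  \<open>1 - \<alpha>\<close> times a harmonic number, hence tends to 0. The remaining mass
  decreases and is nonnegative, so its infimum has mean 0.\<close>

lemma AE_rest_mass_tendsto_0: "AE u in sticks. rest_mass u \<longlonglongrightarrow> 0"
proof -
  \<comment> \<open>The mean of \<open>1 - u j\<close> under \<open>stick_law j\<close>.\<close>
  define b where "b j = real (j + 1) * \<alpha> / (1 - \<alpha> + real (j + 1) * \<alpha>)" for j :: nat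
  have E: "(\<integral>\<^sup>+u. ennreal (rest_mass u k) \<partial>sticks) = ennreal (\<Prod>j<k. b j)" for k
  proof -
    have "(\<integral>\<^sup>+u. ennreal (rest_mass u k) \<partial>sticks) = (\<integral>\<^sup>+u. (\<Prod>j<k. ennreal (1 - u j)) \<partial>sticks)"
      using AE_stick_variables
      by (intro nn_integral_cong_AE) (elim eventually_mono, auto simp: rest_mass_def prod_ennreal less_imp_le)
    also have "\<dots> = (\<integral>\<^sup>+u. (\<Prod>j<k. ennreal (1 - u j)) \<partial>PiM {..<k} stick_law)"
      unfolding stick_variables_eq
      by (subst VP.distr_PiM_restrict_finite[symmetric, of "{..<k}"]) (auto simp: nn_integral_distr intro!: nn_integral_cong)
    also have "\<dots> = (\<Prod>j<k. ennreal (b j))"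
    proof -
      have "(\<integral>\<^sup>+x. ennreal (1 - x) \<partial>stick_law j) = ennreal (b j)" for j
        unfolding stick_law_def b_def using nn_integral_beta_distribution_one_minus[OF params_pos, of j] by simp
      then show ?thesis by (subst VP.product_nn_integral_prod) auto
    qed
    also have "\<dots> = ennreal (\<Prod>j<k. b j)"
      using \<alpha> by (intro prod_ennreal) (auto simp: b_def)
    finally show ?thesis .
  qed
  have "(\<lambda>k. \<Prod>j<k. b j) \<longlonglongrightarrow> 0"
  proof (rule tendsto_sandwich)
    define c where "c = 1 - \<alpha>"
    have c: "0 < c" "c < 1" using \<alpha> by (auto simp: c_def)
    have "b j \<le> exp (- (c * (1 / real (Suc j))))" for j
    proof -
      have d: "0 < 1 - \<alpha> + real (j + 1) * \<alpha>" using \<alpha> by (intro add_pos_pos) auto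
      \<comment> \<open>The denominator of \<open>b j\<close> equals
        \<open>1 + j * \<alpha>\<close>, at most \<open>j + 1\<close>, so \<open>b j\<close> falls
        short of 1 by at least \<open>c / (j + 1)\<close>: the divergence of the harmonic series is
        what counts.\<close>
      have "real j * \<alpha> \<le> real j" using \<alpha> by (intro mult_left_le) auto
      then have "1 - \<alpha> + real (j + 1) * \<alpha> \<le> real (Suc j)" by (simp add: algebra_simps)
      then have "c / real (Suc j) \<le> c / (1 - \<alpha> + real (j + 1) * \<alpha>)"
        using c d by (intro divide_left_mono) auto
      moreover have "b j = 1 - c / (1 - \<alpha> + real (j + 1) * \<alpha>)"
        using d by (simp add: b_def c_def field_simps)
      ultimately have "b j \<le> 1 + - (c * (1 / real (Suc j)))" by simp
      also have "\<dots> \<le> exp (- (c * (1 / real (Suc j))))" by (rule exp_ge_add_one_self)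
      finally show ?thesis .
    qed
    moreover have b0: "0 \<le> b j" for j using \<alpha> by (auto simp: b_def)
    ultimately have "(\<Prod>j<k. b j) \<le> (\<Prod>j<k. exp (- (c * (1 / real (Suc j)))))" for k
      by (intro prod_mono) auto
    also have "(\<Prod>j<k. exp (- (c * (1 / real (Suc j))))) = exp (- c * harm k)" for k
      by (simp add: exp_sum[symmetric] sum_negf sum_distrib_left harm_altdef divide_inverse)
    finally show "eventually (\<lambda>k. (\<Prod>j<k. b j) \<le> exp (- c * harm k)) sequentially" by simp
    show "eventually (\<lambda>k. 0 \<le> (\<Prod>j<k. b j)) sequentially" using b0 by (simp add: prod_nonneg)
    have "filterlim (\<lambda>k. - c * harm k) at_bot sequentially"
      using c harm_at_top by (intro filterlim_tendsto_neg_mult_at_bot[OF tendsto_const]) auto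
    then show "(\<lambda>k. exp (- c * harm k)) \<longlonglongrightarrow> 0"
      by (rule filterlim_compose[OF exp_at_bot])
  qed simp
  then have b0: "(\<lambda>k. ennreal (\<Prod>j<k. b j)) \<longlonglongrightarrow> 0"
    using tendsto_ennrealI by fastforce
  have "(\<integral>\<^sup>+u. (INF k. ennreal (rest_mass u k)) \<partial>sticks) \<le> ennreal (\<Prod>j<k. b j)" for k
    unfolding E[symmetric] by (intro nn_integral_mono INF_lower) simp
  then have "(\<integral>\<^sup>+u. (INF k. ennreal (rest_mass u k)) \<partial>sticks) \<le> 0"
    using b0 by (intro LIMSEQ_le_const[OF b0]) auto
  then have "(\<integral>\<^sup>+u. (INF k. ennreal (rest_mass u k)) \<partial>sticks) = 0" by simp
  then have "AE u in sticks. (INF k. ennreal (rest_mass u k)) = 0"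
    by (subst (asm) nn_integral_0_iff_AE) auto
  then show ?thesis using AE_stick_variables
  proof eventually_elim
    case (elim u)
    have nn: "0 \<le> rest_mass u k" for k
      using elim(2) by (auto simp: rest_mass_def less_imp_le intro!: prod_nonneg)
    have "rest_mass u (Suc k) \<le> rest_mass u k" for k
    proof -
      have "rest_mass u k * (1 - u k) \<le> rest_mass u k * 1"
        using elim(2) nn by (intro mult_left_mono) (auto intro: less_imp_le)
      then show ?thesis by (simp add: rest_mass_def)
    qed
    then have "decseq (\<lambda>k. ennreal (rest_mass u k))" by (intro decseq_SucI ennreal_leI)
    from LIMSEQ_INF[OF this] have "(\<lambda>k. ennreal (rest_mass u k)) \<longlonglongrightarrow> ennreal 0"
      unfolding elim(1) by simp
    then show ?case using nn by (subst (asm) tendsto_ennreal_iff) auto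
  qed
qed

definition biased_mass :: "nat \<Rightarrow> ennreal" where
  "biased_mass k = biased \<alpha> (\<lambda>_. 1) k 1"

lemma biased_one: "biased \<alpha> (\<lambda>_. 1) k r = biased_mass k"
  by (simp add: biased_mass_def biased_def)

abbreviation beta_factor :: "nat \<Rightarrow> ennreal" where
  "beta_factor k \<equiv> ennreal (\<alpha> * Beta (1 - \<alpha>) (0 + real (k + 1) * \<alpha>))"

text \<open>The kernel in \<open>biased_rec\<close> is \<open>\<alpha>\<close> times the
  unnormalised density of \<open>stick_law k\<close>; \<open>beta_factor k\<close> collects its
  total mass.\<close>

lemma biased_rec_beta:
  assumes [measurable]: "g \<in> borel_measurable borel" and g_le: "\<And>q. g q \<le> 1"
  shows "biased \<alpha> g k r = beta_factor k *
    (\<integral>\<^sup>+v. g (r * v) * biased \<alpha> g (Suc k) (r * (1 - v)) \<partial>stick_law k)"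
proof -
  have "biased \<alpha> g k r = (\<integral>\<^sup>+v. ennreal \<alpha> * (ennreal (v powr ((1 - \<alpha>) - 1) * (1 - v) powr ((0 + real (k + 1) * \<alpha>) - 1)) *
      indicator {0<..<1} v * (g (r * v) * biased \<alpha> g (Suc k) (r * (1 - v)))) \<partial>lborel)"
    using \<alpha> by (subst biased_rec[OF \<alpha> assms])
      (auto intro!: nn_integral_cong simp: ennreal_mult' mult.assoc)
  also have "\<dots> = ennreal \<alpha> * (ennreal (Beta (1 - \<alpha>) (0 + real (k + 1) * \<alpha>)) *
      (\<integral>\<^sup>+v. g (r * v) * biased \<alpha> g (Suc k) (r * (1 - v)) \<partial>stick_law k))"
    unfolding stick_law_def nn_integral_beta_distribution[OF params_pos, of "\<lambda>v. g (r * v) * biased \<alpha> g (Suc k) (r * (1 - v))", simplified]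
    by (subst nn_integral_beta_distribution[OF params_pos]) (auto simp: nn_integral_cmult)
  finally show ?thesis using \<alpha> by (simp add: ennreal_mult' mult.assoc)
qed

lemma biased_mass_0: "biased_mass 0 = 1"
proof -
  have "biased_mass 0 = (\<integral>\<^sup>+u. 1 \<partial>exp_seq)"
    unfolding biased_mass_def biased_def using AE_arrivals_good[OF \<alpha>]
    by (intro nn_integral_cong_AE) (elim eventually_mono, auto simp: gprod_def)
  then show ?thesis by simp
qed

lemma biased_mass_Suc:
  "biased_mass k = beta_factor k * biased_mass (Suc k)"
  using biased_rec_beta[of "\<lambda>_. 1" k 1] prob_space.emeasure_space_1[OF prob_space_stick_law, of k]
  by (simp add: biased_one)

text \<open>No negative moment of the jump sum has to be estimated: the mass is 1 for
  \<open>k = 0\<close>, and consecutive masses differ by a positive finite factor.\<close>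

lemma biased_mass_pos_finite: "0 < biased_mass k \<and> biased_mass k < \<infinity>"
proof (induction k)
  case 0
  then show ?case by (simp add: biased_mass_0)
next
  case (Suc k)
  have "0 < \<alpha> * Beta (1 - \<alpha>) (0 + real (k + 1) * \<alpha>)"
    using \<alpha> Beta_pos[OF params_pos] by simp
  then show ?case using Suc unfolding biased_mass_Suc[of k]
    by (auto simp: ennreal_mult_less_top ennreal_zero_less_mult_iff)
qed

definition biased_mean :: "(real \<Rightarrow> ennreal) \<Rightarrow> nat \<Rightarrow> real \<Rightarrow> ennreal" where
  "biased_mean g k r = biased \<alpha> g k r / biased_mass k"

lemma measurable_biased_mean [measurable]:
  "g \<in> borel_measurable borel \<Longrightarrow> biased_mean g k \<in> borel_measurable borel"
  unfolding biased_mean_def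
  by (intro borel_measurable_divide_ennreal measurable_biased borel_measurable_const)

lemma biased_mean_rec:
  assumes [measurable]: "g \<in> borel_measurable borel" and g_le: "\<And>q. g q \<le> 1"
  shows "biased_mean g k r = (\<integral>\<^sup>+v. g (r * v) * biased_mean g (Suc k) (r * (1 - v)) \<partial>stick_law k)"
proof -
  define B where "B = beta_factor k"
  have B: "0 < B" "B < \<infinity>"
    using \<alpha> Beta_pos[OF params_pos, of k] by (auto simp: B_def)
  have "biased_mean g k r = (B * (\<integral>\<^sup>+v. g (r * v) * biased \<alpha> g (Suc k) (r * (1 - v)) \<partial>stick_law k)) / (B * biased_mass (Suc k))"
    unfolding biased_mean_def biased_rec_beta[OF assms, of k r] biased_mass_Suc[of k] B_def ..
  also have "\<dots> = (\<integral>\<^sup>+v. g (r * v) * biased \<alpha> g (Suc k) (r * (1 - v)) \<partial>stick_law k) / biased_mass (Suc k)"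
    using B by (subst (1 2) mult.commute[of B], subst divide_mult_eq) auto
  also have "\<dots> = (\<integral>\<^sup>+v. g (r * v) * biased_mean g (Suc k) (r * (1 - v)) \<partial>stick_law k)"
    unfolding biased_mean_def by (subst nn_integral_divide[symmetric]) (auto simp: ennreal_times_divide)
  finally show ?thesis .
qed

text \<open>Normalised points are at most 1, so after scaling by \<open>r < \<epsilon>\<close> all
  of them lie where \<open>g\<close> is 1.\<close>

lemma biased_mean_small:
  assumes "\<And>q. q < \<epsilon> \<Longrightarrow> g q = 1" "0 \<le> r" "r < \<epsilon>"
  shows "biased_mean g k r = 1"
proof -
  have "biased \<alpha> g k r = biased_mass k"
    unfolding biased_one[of k r, symmetric] unfolding biased_def
  proof (rule nn_integral_cong_AE)
    show "AE u in exp_seq. ennreal (jump_sum \<alpha> (arrivals u) powr - (real k * \<alpha>)) *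
        gprod (\<lambda>y. g (r * (y powr (- 1 / \<alpha>) / jump_sum \<alpha> (arrivals u)))) (arrivals u) =
        ennreal (jump_sum \<alpha> (arrivals u) powr - (real k * \<alpha>)) * gprod (\<lambda>y. 1) (arrivals u)"
      using AE_arrivals_good[OF \<alpha>]
    proof eventually_elim
      case (elim u)
      have "g (r * (arrivals u i powr (- 1 / \<alpha>) / jump_sum \<alpha> (arrivals u))) = 1" for i
      proof (rule assms(1))
        have "arrivals u i powr (- 1 / \<alpha>) \<le> jump_sum \<alpha> (arrivals u)"
          using sum_le_suminf[of "\<lambda>n. arrivals u n powr (- 1 / \<alpha>)" "{i}"] elim by (simp add: jump_sum_def)
        then have "r * (arrivals u i powr (- 1 / \<alpha>) / jump_sum \<alpha> (arrivals u)) \<le> r * 1"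
          using elim assms(2) by (intro mult_left_mono) auto
        then show "r * (arrivals u i powr (- 1 / \<alpha>) / jump_sum \<alpha> (arrivals u)) < \<epsilon>" using assms(3) by simp
      qed
      then show ?case by (simp add: gprod_def)
    qed
  qed
  then show ?thesis
    using biased_mass_pos_finite[of k] by (auto simp: biased_mean_def)
qed

lemma biased_mean_le_1:
  assumes "\<And>q. g q \<le> 1"
  shows "biased_mean g k r \<le> 1"
proof -
  have "biased \<alpha> g k r \<le> biased_mass k"
    unfolding biased_one[of k r, symmetric] unfolding biased_def gprod_def
    using assms by (intro nn_integral_mono mult_left_mono INF_mono) (auto intro!: prod_le_1_ennreal)
  then show ?thesis
    unfolding biased_mean_def using biased_mass_pos_finite[of k] divide_right_mono_ennreal[of _ _ "biased_mass k"]
    by fastforce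
qed

text \<open>The expectation does not depend on \<open>k\<close>. Neither the first \<open>k\<close>
  pieces nor \<open>rest_mass u k\<close> involve \<open>u k\<close>, so this coordinate can be
  integrated on its own, and \<open>biased_mean_rec\<close> undoes one break.\<close>

lemma biased_mean_iterate:
  assumes [measurable]: "g \<in> borel_measurable borel" and g_le: "\<And>q. g q \<le> 1"
  shows "(\<integral>\<^sup>+u. (\<Prod>j<k. g (stick_breaking u j)) * biased_mean g k (rest_mass u k) \<partial>sticks) = biased_mean g 0 1"
proof (induction k)
  case 0
  then show ?case by (simp add: rest_mass_def V.emeasure_space_1[simplified])
next
  case (Suc k)
  interpret K: prob_space "stick_law k" by (rule prob_space_stick_law)
  have mg: "(\<lambda>u. g (stick_breaking u j)) \<in> borel_measurable seq_borel" for j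
    unfolding stick_breaking_def by measurable
  define H where "H u = (\<Prod>j<Suc k. g (stick_breaking u j)) * biased_mean g (Suc k) (rest_mass u (Suc k))" for u
  have mH: "H \<in> borel_measurable seq_borel"
    unfolding H_def by (intro borel_measurable_times_ennreal borel_measurable_prod_ennreal mg) measurable
  have upd: "stick_breaking (u(k := v)) j = stick_breaking u j" if "j < k" for u v j
    using that by (auto simp: stick_breaking_def intro!: prod.cong)
  have upd': "rest_mass (u(k := v)) k = rest_mass u k" for u v
    by (auto simp: rest_mass_def intro!: prod.cong)
  have "(\<integral>\<^sup>+u. H u \<partial>sticks) = (\<integral>\<^sup>+u. \<integral>\<^sup>+v. H (u(k := v)) \<partial>stick_law k \<partial>sticks)"
    unfolding stick_variables_eq
    using mH by (intro nn_integral_PiM_update prob_space_stick_law)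
      (simp add: stick_variables_eq[symmetric] measurable_cong_sets[OF sets_stick_variables refl])
  also have "\<dots> = (\<integral>\<^sup>+u. (\<Prod>j<k. g (stick_breaking u j)) * biased_mean g k (rest_mass u k) \<partial>sticks)"
  proof (intro nn_integral_cong)
    fix u
    have "H (u(k := v)) = (\<Prod>j<k. g (stick_breaking u j)) * (g (rest_mass u k * v) * biased_mean g (Suc k) (rest_mass u k * (1 - v)))" for v
    proof -
      have "rest_mass (u(k := v)) (Suc k) = rest_mass u k * (1 - v)"
        using upd'[of u v] by (simp add: rest_mass_def)
      moreover have "stick_breaking (u(k := v)) k = rest_mass u k * v"
        by (simp add: stick_breaking_rest_mass upd')
      ultimately show ?thesis by (simp add: H_def upd mult.assoc)
    qed
    then show "(\<integral>\<^sup>+v. H (u(k := v)) \<partial>stick_law k) = (\<Prod>j<k. g (stick_breaking u j)) * biased_mean g k (rest_mass u k)"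
      by (simp add: nn_integral_cmult biased_mean_rec[OF assms, of k])
  qed
  finally show ?case using Suc.IH by (simp only: H_def)
qed

text \<open>The limit of \<open>biased_mean_iterate\<close> for growing \<open>k\<close>: once the
  remaining mass is below \<open>\<epsilon>\<close> the second factor is 1, and what is left
  converges to the infinite product over the pieces, with bound 1.\<close>

theorem gprod_normalised_arrivals:
  assumes [measurable]: "g \<in> borel_measurable borel" and g_le: "\<And>q. g q \<le> 1"
    and \<epsilon>: "0 < \<epsilon>" "\<And>q. q < \<epsilon> \<Longrightarrow> g q = 1"
  shows "(\<integral>\<^sup>+u. gprod g (\<lambda>n. arrivals u n powr (- 1 / \<alpha>) / jump_sum \<alpha> (arrivals u)) \<partial>exp_seq) =
    (\<integral>\<^sup>+u. gprod g (stick_breaking u) \<partial>sticks)"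
proof -
  let ?X = "\<lambda>k u. (\<Prod>j<k. g (stick_breaking u j)) * biased_mean g k (rest_mass u k)"
  have "(\<integral>\<^sup>+u. gprod g (\<lambda>n. arrivals u n powr (- 1 / \<alpha>) / jump_sum \<alpha> (arrivals u)) \<partial>exp_seq) = biased \<alpha> g 0 1"
    unfolding biased_def using AE_arrivals_good[OF \<alpha>]
    by (intro nn_integral_cong_AE) (elim eventually_mono, auto simp: gprod_def)
  then have lhs: "(\<integral>\<^sup>+u. gprod g (\<lambda>n. arrivals u n powr (- 1 / \<alpha>) / jump_sum \<alpha> (arrivals u)) \<partial>exp_seq) = biased_mean g 0 1"
    by (simp add: biased_mean_def biased_mass_0 divide_ennreal_def)
  have mg: "(\<lambda>u. g (stick_breaking u j)) \<in> borel_measurable seq_borel" for j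
    unfolding stick_breaking_def by measurable
  have "(\<lambda>k. \<integral>\<^sup>+u. ?X k u \<partial>sticks)
      \<longlonglongrightarrow> (\<integral>\<^sup>+u. gprod g (stick_breaking u) \<partial>sticks)"
  proof (rule nn_integral_dominated_convergence[where w="\<lambda>_. 1"])
    show "(\<lambda>u. ?X k u) \<in> borel_measurable (sticks)" for k
      unfolding measurable_cong_sets[OF sets_stick_variables refl]
      by (intro borel_measurable_times_ennreal borel_measurable_prod_ennreal mg) measurable
    show "AE u in sticks. ?X k u \<le> 1" for k
    proof (rule AE_I2)
      fix u
      have "(\<Prod>j<k. g (stick_breaking u j)) \<le> 1" using g_le by (intro prod_le_1_ennreal)
      from mult_mono[OF this biased_mean_le_1[where g=g, OF g_le]]
      show "?X k u \<le> 1" by simp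
    qed
    show "AE u in sticks. (\<lambda>k. ?X k u) \<longlonglongrightarrow> gprod g (stick_breaking u)"
      using AE_rest_mass_tendsto_0 AE_stick_variables
    proof eventually_elim
      case (elim u)
      have nn: "0 \<le> rest_mass u k" for k
        using elim(2) by (auto simp: rest_mass_def less_imp_le intro!: prod_nonneg)
      have "eventually (\<lambda>k. rest_mass u k < \<epsilon>) sequentially"
        using elim(1) \<epsilon>(1) by (rule order_tendstoD)
      then have "eventually (\<lambda>k. (\<Prod>j<k. g (stick_breaking u j)) = ?X k u) sequentially"
        by eventually_elim (use biased_mean_small[OF \<epsilon>(2) nn] in simp)
      with gprod_LIMSEQ[where g=g and x="stick_breaking u", OF g_le] show ?case
        by (rule Lim_transform_eventually)
    qed
  qed (auto simp: V.emeasure_space_1[simplified])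
  then have "(\<integral>\<^sup>+u. gprod g (stick_breaking u) \<partial>sticks) = biased_mean g 0 1"
    unfolding biased_mean_iterate[OF assms(1,2)] by (intro LIMSEQ_unique[OF _ tendsto_const])
  then show ?thesis using lhs by simp
qed

end

section \<open>The propagation process\<close>

lemma nn_integral_power_poisson:
  fixes C :: "'w \<Rightarrow> nat"
  assumes "prob_space M" and C: "C \<in> measurable M (count_space UNIV)"
    and P: "\<And>k. measure M {w \<in> space M. C w = k} = a ^ k / fact k * exp (- a)"
    and a: "0 \<le> a" and z: "0 \<le> z"
  shows "(\<integral>\<^sup>+w. ennreal z ^ C w \<partial>M) = ennreal (exp (- (a * (1 - z))))"
proof -
  interpret prob_space M by fact
  have P': "(\<integral>\<^sup>+w. 1 * indicator {n} (C w) \<partial>M) = ennreal (a ^ n / fact n * exp (- a))" for n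
  proof -
    have "(\<integral>\<^sup>+w. 1 * indicator {n} (C w) \<partial>M) = (\<integral>\<^sup>+w. indicator {w \<in> space M. C w = n} w \<partial>M)"
      by (intro nn_integral_cong) (auto simp: indicator_def)
    also have "\<dots> = ennreal (measure M {w \<in> space M. C w = n})"
      using C by (subst nn_integral_indicator) (auto simp: emeasure_eq_measure)
    finally show ?thesis by (simp only: P)
  qed
  have "(\<integral>\<^sup>+w. ennreal z ^ C w \<partial>M) = (\<Sum>n. ennreal (a ^ n / fact n * exp (- a)) * ennreal z ^ n)"
    using nn_integral_weighted_nat[OF C, of "\<lambda>_. 1" "\<lambda>n. ennreal z ^ n"] unfolding P' by simp
  also have "\<dots> = (\<Sum>n. ennreal (exp (- a) * ((a * z) ^ n /\<^sub>R fact n)))"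
    using a z by (intro suminf_cong) (simp add: ennreal_power ennreal_mult[symmetric] power_mult_distrib field_simps)
  also have "\<dots> = ennreal (exp (- a) * exp (a * z))"
    using a z exp_converges[of "a * z"]
    by (subst suminf_ennreal2) (auto simp: sums_iff suminf_mult intro!: summable_mult)
  also have "exp (- a) * exp (a * z) = exp (- (a * (1 - z)))"
    by (simp add: exp_add[symmetric] algebra_simps)
  finally show ?thesis .
qed

text \<open>The partial products decrease in the number of factors and in \<open>k\<close>, so both
  limits are infima, and infima may be exchanged.\<close>

lemma gprod_decseq_limit:
  fixes G :: "nat \<Rightarrow> 'a \<Rightarrow> ennreal"
  assumes "\<And>x. decseq (\<lambda>k. G k x)" "\<And>x. (\<lambda>k. G k x) \<longlonglongrightarrow> g x" "\<And>k x. G k x \<le> 1"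
  shows "(\<lambda>k. gprod (G k) x) \<longlonglongrightarrow> gprod g x"
proof -
  have g_le: "g y \<le> 1" for y
    using assms(2)[of y] assms(3) by (intro LIMSEQ_le_const2) auto
  have fin: "y < top" if "y \<le> 1" for y :: ennreal
    using that by (rule le_less_trans) simp
  have mono: "gprod (G l) x \<le> gprod (G k) x" if "k \<le> l" for k l
    unfolding gprod_def using assms(1) that
    by (intro INF_mono' prod_mono_ennreal) (auto simp: decseq_def)
  then have dec: "decseq (\<lambda>k. gprod (G k) x)" by (auto simp: decseq_def)
  have prods: "(\<lambda>k. \<Prod>i<n. G k (x i)) \<longlonglongrightarrow> (\<Prod>i<n. g (x i))" for n
  proof (induction n)
    case (Suc n)
    have "(\<Prod>i<n. g (x i)) < top" by (intro fin prod_le_1_ennreal g_le)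
    then show ?case using fin[OF g_le, of "x n"] Suc assms(2)[of "x n"]
      unfolding prod.lessThan_Suc by (intro tendsto_mult_ennreal) auto
  qed simp
  have INFs: "(INF k. \<Prod>i<n. G k (x i)) = (\<Prod>i<n. g (x i))" for n
  proof (rule LIMSEQ_unique[OF LIMSEQ_INF prods])
    show "decseq (\<lambda>k. \<Prod>i<n. G k (x i))"
      using assms(1) by (auto simp: decseq_def intro!: prod_mono_ennreal)
  qed
  have "(INF k. gprod (G k) x) = gprod g x"
    unfolding gprod_def by (subst INF_commute) (simp only: INFs)
  with LIMSEQ_INF[OF dec] show ?thesis by simp
qed

lemma gprod_simple:
  fixes f :: "'a \<Rightarrow> real"
  assumes bij: "bij_betw x UNIV P" and f: "\<And>y. 0 \<le> f y" "\<And>y. f y \<le> 1"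
    and fin: "finite (range f)" "\<And>y. 0 < y \<Longrightarrow> finite (P \<inter> f -` {y})"
  shows "gprod (\<lambda>y. ennreal (1 - f y)) x = (\<Prod>y\<in>range f - {0}. ennreal (1 - y) ^ card (P \<inter> f -` {y}))"
proof -
  define V where "V = range f - {0}"
  have V: "finite V" "\<And>y. y \<in> V \<Longrightarrow> 0 < y" using fin(1) f(1) by (auto simp: V_def less_le)
  define F where "F = (\<Union>y\<in>V. P \<inter> f -` {y})"
  have finF: "finite F" unfolding F_def by (intro finite_UN_I V(1) fin(2) V(2))
  have inj: "inj x" and P: "P = range x" using bij by (auto simp: bij_betw_def)
  have "finite (x -` F)" using finF inj by (rule finite_vimageI)
  then obtain N where N: "x -` F \<subseteq> {..<N}" using finite_nat_iff_bounded by blast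
  have out: "f (x i) = 0" if "i \<notin> x -` F" for i
    using that by (auto simp: F_def V_def P)
  have "gprod (\<lambda>y. ennreal (1 - f y)) x = (\<Prod>i<N. ennreal (1 - f (x i)))"
  proof (rule gprod_eq_prod)
    show "ennreal (1 - f (x n)) = 1" if "N \<le> n" for n
      using N that out[of n] by (cases "n \<in> x -` F") auto
  qed (use f in auto)
  also have "\<dots> = (\<Prod>i\<in>x -` F. ennreal (1 - f (x i)))"
    by (rule prod.mono_neutral_right) (use N out in auto)
  also have "\<dots> = (\<Prod>y\<in>x ` (x -` F). ennreal (1 - f y))"
    by (subst prod.reindex) (use inj in \<open>auto simp: inj_on_def\<close>)
  also have "x ` (x -` F) = F" by (auto simp: F_def P)
  also have "(\<Prod>y\<in>F. ennreal (1 - f y)) = (\<Prod>y\<in>V. \<Prod>z\<in>P \<inter> f -` {y}. ennreal (1 - f z))"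
    unfolding F_def using V fin(2) by (intro prod.UNION_disjoint) auto
  also have "\<dots> = (\<Prod>y\<in>V. ennreal (1 - y) ^ card (P \<inter> f -` {y}))"
    by (intro prod.cong) auto
  finally show ?thesis by (simp add: V_def)
qed

text \<open>The level sets of \<open>f\<close> at its nonzero values are disjoint and, by
  integrability, of finite measure. Their counts are independent Poisson variables, and the product
  grouped by the value of \<open>f\<close> factorises over them.\<close>

lemma Laplace_poisson_simple:
  fixes \<Phi> :: "'w \<Rightarrow> 'a::euclidean_space set" and f :: "'a \<Rightarrow> real"
  assumes "prob_space M" and lam: "0 < lam" and \<Phi>: "homogeneous_poisson_process M lam \<Phi>"
    and bij: "AE w in M. bij_betw (\<lambda>n. X n w) UNIV (\<Phi> w)"
    and f: "simple_function borel f" "\<And>y. 0 \<le> f y" "\<And>y. f y \<le> 1" and int: "integrable lborel f"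
  shows "(\<integral>\<^sup>+w. gprod (\<lambda>y. ennreal (1 - f y)) (\<lambda>n. X n w) \<partial>M) = ennreal (exp (- (lam * (\<integral>y. f y \<partial>lborel))))"
proof -
  interpret prob_space M by fact
  define V where "V = range f - {0}"
  have V: "finite V" "\<And>y. y \<in> V \<Longrightarrow> 0 < y" "\<And>y. y \<in> V \<Longrightarrow> y \<le> 1"
    using f by (auto simp: V_def less_le simple_function_def)
  have mf: "f -` {y} \<in> sets borel" for y
    using simple_functionD(2)[OF f(1), of "{y}"] by simp
  have finm: "emeasure lborel (f -` {y}) < \<infinity>" if "0 < y" for y
  proof -
    have "ennreal y * emeasure lborel (f -` {y}) = (\<integral>\<^sup>+x. ennreal y * indicator (f -` {y}) x \<partial>lborel)"
      using mf by (subst nn_integral_cmult_indicator) auto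
    also have "\<dots> \<le> (\<integral>\<^sup>+x. ennreal (f x) \<partial>lborel)"
      by (intro nn_integral_mono) (auto simp: indicator_def)
    also have "\<dots> < \<infinity>"
      using int f(2) by (simp add: integrable_iff_bounded)
    finally show ?thesis using that by (auto simp: ennreal_mult_less_top)
  qed
  obtain v m where v: "bij_betw v {..<m::nat} V"
    using ex_bij_betw_nat_finite[OF V(1)] by (auto simp: atLeast0LessThan)
  have vV: "v i \<in> V" if "i < m" for i using v that by (auto simp: bij_betw_def)
  have vinj: "v i = v j \<longleftrightarrow> i = j" if "i < m" "j < m" for i j
    using v that by (auto simp: bij_betw_def inj_on_def)
  \<comment> \<open>Padded with empty sets, because independence of the counts is given for infinite
    sequences of disjoint sets.\<close>
  define A where "A i = (if i < m then f -` {v i} else {})" for i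
  have A: "A i \<in> sets borel" "emeasure lborel (A i) < \<infinity>" for i
    using mf finm V(2) vV by (auto simp: A_def)
  have disj: "disjoint_family A"
    using vinj by (auto simp: disjoint_family_on_def A_def)
  define N where "N i w = card (\<Phi> w \<inter> A i)" for i w
  have fin: "AE w in M. finite (\<Phi> w \<inter> A i)"
    and N: "N i \<in> measurable M (count_space UNIV)"
    and P: "measure M {w \<in> space M. N i w = k} = (lam * measure lborel (A i)) ^ k / fact k * exp (- (lam * measure lborel (A i)))" for i k
    using \<Phi> A unfolding homogeneous_poisson_process_def N_def[abs_def] by blast+
  have indep: "indep_vars (\<lambda>_. count_space UNIV) N UNIV"
    using \<Phi> A disj unfolding homogeneous_poisson_process_def N_def[abs_def] by blast
  have "(\<integral>\<^sup>+w. gprod (\<lambda>y. ennreal (1 - f y)) (\<lambda>n. X n w) \<partial>M) = (\<integral>\<^sup>+w. (\<Prod>i<m. ennreal (1 - v i) ^ N i w) \<partial>M)"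
  proof (rule nn_integral_cong_AE)
    have "AE w in M. \<forall>i. finite (\<Phi> w \<inter> A i)" using fin by (simp add: AE_all_countable)
    with bij show "AE w in M. gprod (\<lambda>y. ennreal (1 - f y)) (\<lambda>n. X n w) = (\<Prod>i<m. ennreal (1 - v i) ^ N i w)"
    proof eventually_elim
      case (elim w)
      have *: "finite (\<Phi> w \<inter> f -` {y})" if "0 < y" for y
      proof (cases "y \<in> V")
        case True
        then obtain i where "i < m" "v i = y" using v by (auto simp: bij_betw_def)
        then show ?thesis using elim(2)[rule_format, of i] by (simp add: A_def)
      next
        case False
        then have "f -` {y} = {}" using that by (auto simp: V_def)
        then show ?thesis by simp
      qed
      have "gprod (\<lambda>y. ennreal (1 - f y)) (\<lambda>n. X n w) = (\<Prod>y\<in>V. ennreal (1 - y) ^ card (\<Phi> w \<inter> f -` {y}))"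
        unfolding V_def using elim(1) f *
        by (intro gprod_simple) (auto simp: simple_function_def)
      also have "\<dots> = (\<Prod>i<m. ennreal (1 - v i) ^ card (\<Phi> w \<inter> f -` {v i}))"
        by (rule prod.reindex_bij_betw[OF v, symmetric])
      also have "\<dots> = (\<Prod>i<m. ennreal (1 - v i) ^ N i w)"
        by (intro prod.cong) (auto simp: N_def A_def)
      finally show ?case .
    qed
  qed
  also have "\<dots> = (\<Prod>i<m. \<integral>\<^sup>+w. ennreal (1 - v i) ^ N i w \<partial>M)"
  proof (rule indep_vars_nn_integral)
    show "indep_vars (\<lambda>_. borel) (\<lambda>i w. ennreal (1 - v i) ^ N i w) {..<m}"
      by (rule indep_vars_compose2[OF indep_vars_subset[OF indep]]) auto
  qed auto
  also have "\<dots> = (\<Prod>i<m. ennreal (exp (- (lam * measure lborel (A i) * (1 - (1 - v i))))))"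
    using lam V(3) vV by (intro prod.cong refl nn_integral_power_poisson[OF \<open>prob_space M\<close> N P]) auto
  also have "\<dots> = ennreal (exp (- (lam * (\<Sum>i<m. v i * measure lborel (A i)))))"
    by (simp add: prod_ennreal exp_sum[symmetric] sum_negf sum_distrib_left mult_ac)
  also have "(\<Sum>i<m. v i * measure lborel (A i)) = (\<Sum>i<m. v i * measure lborel (f -` {v i}))"
    by (intro sum.cong) (auto simp: A_def)
  also have "\<dots> = (\<Sum>y\<in>V. y * measure lborel (f -` {y}))"
    by (rule sum.reindex_bij_betw[OF v])
  also have "\<dots> = (\<integral>x. (\<Sum>y\<in>V. y * indicator (f -` {y}) x) \<partial>lborel)"
    using mf finm V by (subst Bochner_Integration.integral_sum) (auto intro!: integrable_mult_right)
  also have "(\<lambda>x. \<Sum>y\<in>V. y * indicator (f -` {y}) x) = f"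
  proof
    fix x
    show "(\<Sum>y\<in>V. y * indicator (f -` {y}) x) = f x"
    proof (cases "f x = 0")
      case True
      then show ?thesis using V(2) by (auto intro!: sum.neutral simp: indicator_def)
    next
      case False
      then have "(\<Sum>y\<in>V. y * indicator (f -` {y}) x) = (\<Sum>y\<in>{f x}. y * indicator (f -` {y}) x)"
        using V(1) by (intro sum.mono_neutral_right) (auto simp: V_def indicator_def)
      then show ?thesis by simp
    qed
  qed
  finally show ?thesis .
qed

text \<open>Simple functions increasing to \<open>f\<close> make the factors decrease, so
  \<open>gprod_decseq_limit\<close> applies on one side and dominated convergence of the integrals
  on the other.\<close>

lemma Laplace_poisson:
  fixes \<Phi> :: "'w \<Rightarrow> 'a::euclidean_space set" and f :: "'a \<Rightarrow> real"
  assumes "prob_space M" and lam: "0 < lam" and \<Phi>: "homogeneous_poisson_process M lam \<Phi>"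
    and X [measurable]: "\<And>n. X n \<in> borel_measurable M"
    and bij: "AE w in M. bij_betw (\<lambda>n. X n w) UNIV (\<Phi> w)"
    and f: "\<And>y. 0 \<le> f y" "\<And>y. f y \<le> 1" and int: "integrable lborel f" and mf [measurable]: "f \<in> borel_measurable borel"
  shows "(\<integral>\<^sup>+w. gprod (\<lambda>y. ennreal (1 - f y)) (\<lambda>n. X n w) \<partial>M) = ennreal (exp (- (lam * (\<integral>y. f y \<partial>lborel))))"
proof -
  interpret prob_space M by fact
  obtain U where U: "\<And>i. simple_function borel (U i)" "incseq U" "\<And>i x. U i x < top" "\<And>x. (SUP i. U i x) = ennreal (f x)"
    by (rule borel_measurable_implies_simple_function_sequence'[of "\<lambda>x. ennreal (f x)" borel]) auto
  define h where "h i x = enn2real (U i x)" for i x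
  have Uh: "U i x = ennreal (h i x)" for i x
    using U(3)[of i x] by (simp add: h_def)
  have h0: "0 \<le> h i x" for i x by (simp add: h_def)
  have hf: "h i x \<le> f x" for i x
  proof -
    have "U i x \<le> ennreal (f x)" unfolding U(4)[symmetric] by (rule SUP_upper) simp
    then show ?thesis using f(1) by (simp add: Uh)
  qed
  have hs: "simple_function borel (h i)" for i
    unfolding h_def using U(1) by (rule simple_function_compose1)
  have [measurable]: "h i \<in> borel_measurable borel" for i
    using hs by (rule borel_measurable_simple_function)
  have hinc: "h i x \<le> h j x" if "i \<le> j" for i j x
    using U(2) that h0 by (auto simp: incseq_def le_fun_def Uh)
  have hlim: "(\<lambda>i. h i x) \<longlonglongrightarrow> f x" for x
  proof -
    have "(\<lambda>i. U i x) \<longlonglongrightarrow> ennreal (f x)"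
      unfolding U(4)[symmetric] using U(2) by (intro LIMSEQ_SUP) (auto simp: incseq_def le_fun_def)
    then show ?thesis unfolding Uh using h0 f(1) by (subst (asm) tendsto_ennreal_iff) auto
  qed
  have hint: "integrable lborel (h i)" for i
    by (rule Bochner_Integration.integrable_bound[OF int]) (use h0 hf f in \<open>auto simp: abs_of_nonneg\<close>)
  have eq: "(\<integral>\<^sup>+w. gprod (\<lambda>y. ennreal (1 - h i y)) (\<lambda>n. X n w) \<partial>M) = ennreal (exp (- (lam * (\<integral>y. h i y \<partial>lborel))))" for i
    using order_trans[OF hf f(2)] h0
    by (intro Laplace_poisson_simple[OF \<open>prob_space M\<close> lam \<Phi> bij hs _ _ hint]) auto
  have meas: "(\<lambda>w. gprod g (\<lambda>n. X n w)) \<in> borel_measurable M" if "g \<in> borel_measurable borel" for g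
    using that unfolding gprod_def by measurable
  have "(\<lambda>i. \<integral>\<^sup>+w. gprod (\<lambda>y. ennreal (1 - h i y)) (\<lambda>n. X n w) \<partial>M) \<longlonglongrightarrow>
      (\<integral>\<^sup>+w. gprod (\<lambda>y. ennreal (1 - f y)) (\<lambda>n. X n w) \<partial>M)"
  proof (rule nn_integral_dominated_convergence[where w="\<lambda>_. 1"])
    show "AE w in M. (\<lambda>i. gprod (\<lambda>y. ennreal (1 - h i y)) (\<lambda>n. X n w)) \<longlonglongrightarrow> gprod (\<lambda>y. ennreal (1 - f y)) (\<lambda>n. X n w)"
    proof (intro AE_I2 gprod_decseq_limit)
      show "decseq (\<lambda>k. ennreal (1 - h k x))" for x
        using hinc by (auto simp: decseq_def intro!: ennreal_leI)
      show "(\<lambda>k. ennreal (1 - h k x)) \<longlonglongrightarrow> ennreal (1 - f x)" for x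
        by (intro tendsto_ennrealI tendsto_diff tendsto_const hlim)
    qed (use h0 in simp)
  qed (auto intro!: meas simp: gprod_le_1 emeasure_space_1)
  moreover have "(\<lambda>i. ennreal (exp (- (lam * (\<integral>y. h i y \<partial>lborel))))) \<longlonglongrightarrow> ennreal (exp (- (lam * (\<integral>y. f y \<partial>lborel))))"
  proof (intro tendsto_ennrealI tendsto_exp tendsto_minus tendsto_mult tendsto_const)
    show "(\<lambda>i. \<integral>y. h i y \<partial>lborel) \<longlonglongrightarrow> (\<integral>y. f y \<partial>lborel)"
      by (rule integral_dominated_convergence[where w=f]) (use int h0 hf hlim in \<open>auto simp: abs_of_nonneg\<close>)
  qed
  ultimately show ?thesis unfolding eq by (rule LIMSEQ_unique)
qed

abbreviation indep_seqs :: "'w measure \<Rightarrow> (nat \<Rightarrow> 'w \<Rightarrow> 'a::topological_space) \<Rightarrow> (nat \<Rightarrow> 'w \<Rightarrow> 'b::topological_space) \<Rightarrow> bool" where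
  "indep_seqs M X R \<equiv> prob_space.indep_set M
          (sets (vimage_algebra (space M) (\<lambda>w n. X n w) (PiM UNIV (\<lambda>_. borel))))
          (sets (vimage_algebra (space M) (\<lambda>w n. R n w) (PiM UNIV (\<lambda>_. borel))))"

text \<open>Given the points, every mark is integrated out separately. This is Fubini for finitely
  many factors; the infinite product follows by bounded convergence.\<close>

lemma gprod_iid_marks:
  fixes X :: "nat \<Rightarrow> 'w \<Rightarrow> 'a::euclidean_space" and R :: "nat \<Rightarrow> 'w \<Rightarrow> real"
  assumes "prob_space M" and X [measurable]: "\<And>n. X n \<in> borel_measurable M"
    and R: "\<And>n. R n \<in> borel_measurable M" "\<And>n. distr M borel (R n) = \<mu>" "prob_space.indep_vars M (\<lambda>_. borel) R UNIV"
    and indep: "indep_seqs M X R"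
    and g [measurable]: "g \<in> borel_measurable (borel \<Otimes>\<^sub>M borel)" and g_le: "\<And>q. g q \<le> 1"
  shows "(\<integral>\<^sup>+w. gprod g (\<lambda>n. (X n w, R n w)) \<partial>M) = (\<integral>\<^sup>+w. gprod (\<lambda>x. \<integral>\<^sup>+s. g (x, s) \<partial>\<mu>) (\<lambda>n. X n w) \<partial>M)"
proof -
  interpret prob_space M by fact
  note [measurable] = R(1)
  have sets_\<mu> [measurable_cong]: "sets \<mu> = sets borel" using R(2)[of 0] by auto
  interpret \<mu>: prob_space \<mu> unfolding R(2)[of 0, symmetric] by (rule prob_space_distr) (rule R)
  let ?PX = "PiM UNIV (\<lambda>_. borel) :: (nat \<Rightarrow> 'a) measure"
  define XX where "XX w = (\<lambda>n. X n w)" for w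
  define RR where "RR w = (\<lambda>n. R n w)" for w
  have XX [measurable]: "XX \<in> measurable M ?PX"
    by (rule measurable_PiM_single') (auto simp: XX_def)
  have RR [measurable]: "RR \<in> measurable M seq_borel"
    by (rule measurable_PiM_single') (auto simp: RR_def)
  interpret PX: prob_space "distr M ?PX XX" by (rule prob_space_distr) measurable
  interpret PR: prob_space "distr M seq_borel RR" by (rule prob_space_distr) measurable
  have joint: "distr M ?PX XX \<Otimes>\<^sub>M distr M seq_borel RR = distr M (?PX \<Otimes>\<^sub>M seq_borel) (\<lambda>w. (XX w, RR w))"
  proof (rule pair_measure_eqI)
    fix A B assume A: "A \<in> sets (distr M ?PX XX)" and B: "B \<in> sets (distr M seq_borel RR)"
    then have AB: "A \<in> sets ?PX" "B \<in> sets seq_borel" by auto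
    have "XX -` A \<inter> space M \<in> sets (vimage_algebra (space M) (\<lambda>w n. X n w) ?PX)"
      "RR -` B \<inter> space M \<in> sets (vimage_algebra (space M) (\<lambda>w n. R n w) seq_borel)"
      using AB by (auto simp: sets_vimage_algebra XX_def[abs_def] RR_def[abs_def])
    from indep_setD[OF indep this]
    have "prob ((XX -` A \<inter> space M) \<inter> (RR -` B \<inter> space M)) = prob (XX -` A \<inter> space M) * prob (RR -` B \<inter> space M)" .
    moreover have "(XX -` A \<inter> space M) \<inter> (RR -` B \<inter> space M) = (\<lambda>w. (XX w, RR w)) -` (A \<times> B) \<inter> space M"
      by auto
    ultimately show "emeasure (distr M ?PX XX) A * emeasure (distr M seq_borel RR) B =
        emeasure (distr M (?PX \<Otimes>\<^sub>M seq_borel) (\<lambda>w. (XX w, RR w))) (A \<times> B)"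
      using AB by (simp add: emeasure_distr emeasure_eq_measure ennreal_mult[symmetric])
  qed (simp_all add: PX.sigma_finite_measure_axioms PR.sigma_finite_measure_axioms)
  have RR_law: "distr M seq_borel RR = PiM UNIV (\<lambda>_. \<mu>)"
    using R(3) indep_vars_iff_distr_eq_PiM[of UNIV R "\<lambda>_. borel"] R(1) by (simp add: R(2) RR_def[abs_def] restrict_UNIV)
  interpret S: product_prob_space "\<lambda>_. \<mu>" "UNIV :: nat set"
    by (intro product_prob_spaceI \<mu>.prob_space_axioms)
  have fin: "(\<integral>\<^sup>+w. (\<Prod>i<n. g (X i w, R i w)) \<partial>M) = (\<integral>\<^sup>+w. (\<Prod>i<n. \<integral>\<^sup>+s. g (X i w, s) \<partial>\<mu>) \<partial>M)" for n
  proof -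
    have [measurable]: "(\<lambda>p. \<Prod>i<n. g (fst p i, snd p i)) \<in> borel_measurable (?PX \<Otimes>\<^sub>M seq_borel)"
      by measurable
    have "(\<integral>\<^sup>+w. (\<Prod>i<n. g (X i w, R i w)) \<partial>M) = (\<integral>\<^sup>+p. (\<Prod>i<n. g (fst p i, snd p i)) \<partial>distr M (?PX \<Otimes>\<^sub>M seq_borel) (\<lambda>w. (XX w, RR w)))"
      by (subst nn_integral_distr, measurable) (simp add: XX_def RR_def)
    also have "\<dots> = (\<integral>\<^sup>+x. \<integral>\<^sup>+r. (\<Prod>i<n. g (x i, r i)) \<partial>distr M seq_borel RR \<partial>distr M ?PX XX)"
      unfolding joint[symmetric] by (subst PR.nn_integral_fst[symmetric]) auto
    also have "\<dots> = (\<integral>\<^sup>+x. (\<Prod>i<n. \<integral>\<^sup>+s. g (x i, s) \<partial>\<mu>) \<partial>distr M ?PX XX)"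
    proof (intro nn_integral_cong)
      fix x :: "nat \<Rightarrow> 'a"
      have "(\<integral>\<^sup>+r. (\<Prod>i<n. g (x i, r i)) \<partial>distr M seq_borel RR) = (\<integral>\<^sup>+r. (\<Prod>i<n. g (x i, r i)) \<partial>PiM {..<n} (\<lambda>_. \<mu>))"
        unfolding RR_law
        by (subst S.distr_PiM_restrict_finite[symmetric, of "{..<n}"]) (auto simp: nn_integral_distr intro!: nn_integral_cong)
      also have "\<dots> = (\<Prod>i<n. \<integral>\<^sup>+s. g (x i, s) \<partial>\<mu>)"
        by (subst S.product_nn_integral_prod) auto
      finally show "(\<integral>\<^sup>+r. (\<Prod>i<n. g (x i, r i)) \<partial>distr M seq_borel RR) = (\<Prod>i<n. \<integral>\<^sup>+s. g (x i, s) \<partial>\<mu>)" .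
    qed
    also have "\<dots> = (\<integral>\<^sup>+w. (\<Prod>i<n. \<integral>\<^sup>+s. g (X i w, s) \<partial>\<mu>) \<partial>M)"
      by (subst nn_integral_distr, measurable) (simp add: XX_def)
    finally show ?thesis .
  qed
  have le: "(\<integral>\<^sup>+s. g (x, s) \<partial>\<mu>) \<le> 1" for x
  proof -
    have "(\<integral>\<^sup>+s. g (x, s) \<partial>\<mu>) \<le> (\<integral>\<^sup>+s. 1 \<partial>\<mu>)" by (intro nn_integral_mono g_le)
    then show ?thesis by (simp add: \<mu>.emeasure_space_1)
  qed
  have "(\<lambda>n. \<integral>\<^sup>+w. (\<Prod>i<n. g (X i w, R i w)) \<partial>M) \<longlonglongrightarrow> (\<integral>\<^sup>+w. gprod g (\<lambda>n. (X n w, R n w)) \<partial>M)"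
  proof (rule nn_integral_dominated_convergence[where w="\<lambda>_. 1"])
    show "(\<lambda>w. gprod g (\<lambda>n. (X n w, R n w))) \<in> borel_measurable M" unfolding gprod_def by measurable
  qed (auto intro!: prod_le_1_ennreal gprod_LIMSEQ[where g=g] g_le simp: emeasure_space_1)
  moreover have "(\<lambda>n. \<integral>\<^sup>+w. (\<Prod>i<n. \<integral>\<^sup>+s. g (X i w, s) \<partial>\<mu>) \<partial>M) \<longlonglongrightarrow> (\<integral>\<^sup>+w. gprod (\<lambda>x. \<integral>\<^sup>+s. g (x, s) \<partial>\<mu>) (\<lambda>n. X n w) \<partial>M)"
  proof (rule nn_integral_dominated_convergence[where w="\<lambda>_. 1"])
    show "(\<lambda>w. gprod (\<lambda>x. \<integral>\<^sup>+s. g (x, s) \<partial>\<mu>) (\<lambda>n. X n w)) \<in> borel_measurable M" unfolding gprod_def by measurable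
  qed (auto intro!: prod_le_1_ennreal gprod_LIMSEQ[where g="\<lambda>x. \<integral>\<^sup>+s. g (x, s) \<partial>\<mu>"] le simp: emeasure_space_1)
  ultimately show ?thesis unfolding fin by (rule LIMSEQ_unique)
qed

section \<open>The path losses transported to a unit-rate process on the half-line\<close>

context
  fixes \<mu> :: "real measure" and lam K \<beta> \<alpha> a :: real
  assumes \<mu>: "prob_space \<mu>" and sets_\<mu> [measurable_cong]: "sets \<mu> = sets borel"
    and \<mu>_pos: "AE s in \<mu>. 0 < s" and \<mu>_int: "integrable \<mu> (\<lambda>s. s powr \<alpha>)"
    and lam: "0 < lam" and K: "0 < K" and \<beta>: "2 < \<beta>" and \<alpha>_eq: "\<alpha> = 2 / \<beta>"
    and a_eq: "a = lam * pi * (\<integral>s. s powr \<alpha> \<partial>\<mu>) / K\<^sup>2"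
begin

interpretation \<mu>: prob_space \<mu> by (rule \<mu>)

interpretation pair: pair_sigma_finite "lborel :: (real^2) measure" \<mu> ..

lemma scale_pos: "0 < a"
proof -
  have "0 \<le> (\<integral>s. s powr \<alpha> \<partial>\<mu>)" by (intro integral_nonneg_AE) auto
  moreover have "(\<integral>s. s powr \<alpha> \<partial>\<mu>) \<noteq> 0"
  proof
    assume "(\<integral>s. s powr \<alpha> \<partial>\<mu>) = 0"
    then have "AE s in \<mu>. s powr \<alpha> = 0"
      using \<mu>_int by (subst (asm) integral_nonneg_eq_0_iff_AE) auto
    with \<mu>_pos have "AE s in \<mu>. False" by eventually_elim auto
    then show False by simp
  qed
  ultimately have "0 < (\<integral>s. s powr \<alpha> \<partial>\<mu>)" by linarith
  then show ?thesis using lam K by (simp add: a_eq)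
qed

text \<open>As \<open>\<beta> * \<alpha> = 2\<close>, the power \<open>\<alpha>\<close> turns the
  loss into a multiple of the squared distance, whose level sets are discs with area linear in the
  level. The constant \<open>a\<close> is the mean number of points with loss at most 1, so that
  multiplying by it gives rate 1.\<close>

definition scaled_loss :: "real^2 \<Rightarrow> real \<Rightarrow> real" where
  "scaled_loss x s = a * (path_loss K \<beta> (norm x) / s) powr \<alpha>"

lemma measurable_scaled_loss [measurable]: "case_prod scaled_loss \<in> borel_measurable (borel \<Otimes>\<^sub>M borel)"
  unfolding scaled_loss_def path_loss_def case_prod_unfold by measurable

lemma scaled_loss_eq:
  assumes "0 < s"
  shows "scaled_loss x s = a * K\<^sup>2 / s powr \<alpha> * (norm x)\<^sup>2"
proof -
  have "\<beta> * \<alpha> = 2" using \<beta> by (simp add: \<alpha>_eq)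
  moreover have "0 \<le> K * norm x" using K by simp
  ultimately have "((K * norm x) powr \<beta>) powr \<alpha> = (K * norm x)\<^sup>2"
    by (simp add: powr_powr powr_numeral)
  then show ?thesis
    unfolding scaled_loss_def path_loss_def using assms by (simp add: powr_divide power_mult_distrib)
qed

text \<open>For a fixed mark \<open>s\<close> the points with value at most \<open>t\<close> fill a
  disc of area \<open>pi * t * s powr \<alpha>\<close> divided by \<open>a\<close> and the square of
  \<open>K\<close>. Averaging over \<open>s\<close> and multiplying by \<open>lam\<close> gives
  exactly \<open>t\<close>, and half-lines determine the measure.\<close>

lemma scaled_loss_law:
  "distr (density (lborel \<Otimes>\<^sub>M \<mu>) (\<lambda>_. ennreal lam)) borel (case_prod scaled_loss) =
    density lborel (indicator {0..})" (is "?N = ?L")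
proof (rule measure_eqI_generator_eq[where E="range (\<lambda>t. {..t})" and \<Omega>=UNIV and A="\<lambda>n. {..real n}"])
  have N: "emeasure ?N {..t} = ennreal (max 0 t)" for t
  proof -
    have ball: "emeasure lborel {x. scaled_loss x s \<le> t} = ennreal (pi * max 0 t / (a * K\<^sup>2) * s powr \<alpha>)" if "0 < s" for s
    proof -
      define d where "d = a * K\<^sup>2 / s powr \<alpha>"
      have d: "0 < d" using scale_pos K that by (simp add: d_def)
      show ?thesis
      proof (cases "0 \<le> t")
        case True
        have "{x :: real^2. scaled_loss x s \<le> t} = cball 0 (sqrt (t / d))"
        proof (rule set_eqI)
          fix x :: "real^2"
          have "scaled_loss x s \<le> t \<longleftrightarrow> (norm x)\<^sup>2 \<le> t / d"
            using d unfolding scaled_loss_eq[OF that] d_def[symmetric] by (simp add: field_simps)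
          also have "\<dots> \<longleftrightarrow> norm x \<le> sqrt (t / d)"
            by (metis norm_ge_zero real_le_rsqrt real_sqrt_le_iff real_sqrt_abs abs_norm_cancel)
          finally show "x \<in> {x. scaled_loss x s \<le> t} \<longleftrightarrow> x \<in> cball 0 (sqrt (t / d))" by simp
        qed
        moreover have "pi * (t / d) = pi * max 0 t / (a * K\<^sup>2) * s powr \<alpha>"
          using True by (simp add: d_def)
        ultimately show ?thesis
          using True d by (simp add: emeasure_cball unit_ball_vol_2)
      next
        case False
        have "\<not> scaled_loss x s \<le> t" for x :: "real^2"
        proof -
          have "0 \<le> d * (norm x)\<^sup>2" using d by simp
          then show ?thesis using False unfolding scaled_loss_eq[OF that] d_def[symmetric] by linarith
        qed
        then show ?thesis using False by (simp add: max_def)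
      qed
    qed
    have "{p. case_prod scaled_loss p \<le> t} \<in> sets (lborel \<Otimes>\<^sub>M \<mu>)"
    proof -
      have "{p \<in> space (lborel \<Otimes>\<^sub>M \<mu>). case_prod scaled_loss p \<le> t} \<in> sets (lborel \<Otimes>\<^sub>M \<mu>)" by measurable
      then show ?thesis using sets_eq_imp_space_eq[OF sets_\<mu>] by (simp add: space_pair_measure)
    qed
    note B = this
    have "emeasure ?N {..t} = (\<integral>\<^sup>+p. ennreal lam * indicator {p. case_prod scaled_loss p \<le> t} p \<partial>(lborel \<Otimes>\<^sub>M \<mu>))"
      using sets_eq_imp_space_eq[OF sets_\<mu>] B
      by (subst emeasure_distr) (auto simp: emeasure_density space_pair_measure vimage_def)
    also have "\<dots> = ennreal lam * emeasure (lborel \<Otimes>\<^sub>M \<mu>) {p. case_prod scaled_loss p \<le> t}"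
      using B by (rule nn_integral_cmult_indicator)
    also have "emeasure (lborel \<Otimes>\<^sub>M \<mu>) {p. case_prod scaled_loss p \<le> t} = (\<integral>\<^sup>+s. emeasure lborel {x. scaled_loss x s \<le> t} \<partial>\<mu>)"
      using B by (subst pair.emeasure_pair_measure_alt2) (auto simp: vimage_def)
    also have "\<dots> = (\<integral>\<^sup>+s. ennreal (pi * max 0 t / (a * K\<^sup>2)) * ennreal (s powr \<alpha>) \<partial>\<mu>)"
    proof (rule nn_integral_cong_AE)
      show "AE s in \<mu>. emeasure lborel {x. scaled_loss x s \<le> t} = ennreal (pi * max 0 t / (a * K\<^sup>2)) * ennreal (s powr \<alpha>)"
        using \<mu>_pos
      proof eventually_elim
        case (elim s)
        show ?case unfolding ball[OF elim] using scale_pos by (intro ennreal_mult) auto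
      qed
    qed
    also have "\<dots> = ennreal (pi * max 0 t / (a * K\<^sup>2)) * ennreal (\<integral>s. s powr \<alpha> \<partial>\<mu>)"
      using \<mu>_int by (subst nn_integral_cmult) (auto simp: nn_integral_eq_integral)
    also have "ennreal lam * \<dots> = ennreal (lam * (pi * max 0 t / (a * K\<^sup>2) * (\<integral>s. s powr \<alpha> \<partial>\<mu>)))"
      using lam scale_pos by (simp add: ennreal_mult'[symmetric] integral_nonneg_AE)
    also have "lam * (pi * max 0 t / (a * K\<^sup>2) * (\<integral>s. s powr \<alpha> \<partial>\<mu>)) = max 0 t"
    proof -
      have "a * K\<^sup>2 = lam * pi * (\<integral>s. s powr \<alpha> \<partial>\<mu>)" using K by (simp add: a_eq)
      moreover have "0 < a * K\<^sup>2" using scale_pos K by simp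
      ultimately show ?thesis by (auto simp: field_simps)
    qed
    finally show ?thesis .
  qed
  have L: "emeasure ?L {..t} = ennreal (max 0 t)" for t
  proof -
    have "emeasure ?L {..t} = emeasure lborel {0..t}"
      by (subst emeasure_density) (auto simp: indicator_inter_arith[symmetric] Int_def intro!: arg_cong[where f="emeasure _"])
    then show ?thesis by (simp add: emeasure_lborel_Icc_eq max_def)
  qed
  show "emeasure ?N X = emeasure ?L X" if "X \<in> range (\<lambda>t. {..t})" for X
    using that N L by auto
  show "emeasure ?N {..real n} \<noteq> \<infinity>" for n by (simp add: N)
  show "Int_stable (range (\<lambda>t. {..t :: real}))"
    by (auto simp: Int_stable_def)
  show "sets ?N = sigma_sets UNIV (range (\<lambda>t. {..t}))" "sets ?L = sigma_sets UNIV (range (\<lambda>t. {..t}))"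
    by (simp_all add: borel_eq_atMost)
  show "(\<Union>n. {..real n}) = UNIV" using real_arch_simple by auto
qed auto

lemma integral_scaled_loss:
  fixes f :: "real \<Rightarrow> real"
  assumes [measurable]: "f \<in> borel_measurable borel" and f: "\<And>y. 0 \<le> f y" "\<And>y. f y \<le> 1" "\<And>y. b < y \<Longrightarrow> f y = 0"
  defines "F \<equiv> \<lambda>x. \<integral>s. f (scaled_loss x s) \<partial>\<mu>"
  shows "integrable lborel F" "lam * (\<integral>x. F x \<partial>lborel) = (\<integral>y. f y * indicator {0<..} y \<partial>lborel)"
proof -
  have F0: "0 \<le> F x" for x unfolding F_def using f by (intro integral_nonneg_AE) auto
  have [measurable]: "F \<in> borel_measurable borel" unfolding F_def by measurable
  have FF: "ennreal (F x) = (\<integral>\<^sup>+s. ennreal (f (scaled_loss x s)) \<partial>\<mu>)" for x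
    unfolding F_def using f
    by (intro nn_integral_eq_integral[symmetric] \<mu>.integrable_const_bound[where B=1]) auto
  have int_f: "integrable lborel (\<lambda>x. f x * indicator {0<..} x)"
    by (rule integrable_bounded_support[OF _ f]) measurable
  have "ennreal lam * (\<integral>\<^sup>+x. ennreal (F x) \<partial>lborel) = ennreal lam * (\<integral>\<^sup>+p. ennreal (f (case_prod scaled_loss p)) \<partial>(lborel \<Otimes>\<^sub>M \<mu>))"
    unfolding FF by (subst \<mu>.nn_integral_fst[symmetric]) auto
  also have "\<dots> = (\<integral>\<^sup>+y. ennreal (f y) \<partial>distr (density (lborel \<Otimes>\<^sub>M \<mu>) (\<lambda>_. ennreal lam)) borel (case_prod scaled_loss))"
    by (subst nn_integral_distr) (auto simp: nn_integral_density nn_integral_cmult)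
  also have "\<dots> = (\<integral>\<^sup>+y. indicator {0..} y * ennreal (f y) \<partial>lborel)"
    unfolding scaled_loss_law by (subst nn_integral_density) auto
  also have "\<dots> = (\<integral>\<^sup>+y. ennreal (f y * indicator {0<..} y) \<partial>lborel)"
    using AE_lborel_singleton[of "0::real"] by (intro nn_integral_cong_AE) (auto simp: indicator_def)
  also have "\<dots> = ennreal (\<integral>y. f y * indicator {0<..} y \<partial>lborel)"
    using int_f f by (intro nn_integral_eq_integral) auto
  finally have *: "ennreal lam * (\<integral>\<^sup>+x. ennreal (F x) \<partial>lborel) = ennreal (\<integral>y. f y * indicator {0<..} y \<partial>lborel)" .
  then have "ennreal lam * (\<integral>\<^sup>+x. ennreal (F x) \<partial>lborel) < \<infinity>" by simp
  then have "(\<integral>\<^sup>+x. ennreal (F x) \<partial>lborel) < \<infinity>" using lam by (auto simp: ennreal_mult_less_top)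
  then show int: "integrable lborel F" using F0 by (simp add: integrable_iff_bounded)
  have "ennreal (lam * (\<integral>x. F x \<partial>lborel)) = ennreal (\<integral>y. f y * indicator {0<..} y \<partial>lborel)"
    using * lam int F0 by (simp add: nn_integral_eq_integral ennreal_mult')
  then show "lam * (\<integral>x. F x \<partial>lborel) = (\<integral>y. f y * indicator {0<..} y \<partial>lborel)"
    using lam F0 f by (subst (asm) ennreal_inj) (auto intro!: mult_nonneg_nonneg integral_nonneg_AE)
qed

text \<open>Integrating out the marks replaces \<open>f\<close> by its average \<open>F\<close> over
  the mark, the planar functional applies to \<open>F\<close>, and the image measure turns its
  integral into one over the half-line. The result is the value found in
  \<open>Laplace_arrivals\<close>.\<close>

theorem Laplace_propagation:
  fixes \<Phi> :: "'w \<Rightarrow> (real^2) set" and f :: "real \<Rightarrow> real"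
  assumes "prob_space M" and \<Phi>: "homogeneous_poisson_process M lam \<Phi>"
    and X [measurable]: "\<And>n. X n \<in> borel_measurable M"
    and bij: "AE w in M. bij_betw (\<lambda>n. X n w) UNIV (\<Phi> w)"
    and R: "\<And>n. R n \<in> borel_measurable M" "\<And>n. distr M borel (R n) = \<mu>" "prob_space.indep_vars M (\<lambda>_. borel) R UNIV"
    and indep: "indep_seqs M X R"
    and f [measurable]: "f \<in> borel_measurable borel" and f01: "\<And>y. 0 \<le> f y" "\<And>y. f y \<le> 1" "\<And>y. b < y \<Longrightarrow> f y = 0"
  shows "(\<integral>\<^sup>+w. gprod (\<lambda>y. ennreal (1 - f y)) (\<lambda>n. scaled_loss (X n w) (R n w)) \<partial>M) =
    ennreal (exp (- (\<integral>y. f y * indicator {0<..} y \<partial>lborel)))"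
proof -
  define F where "F x = (\<integral>s. f (scaled_loss x s) \<partial>\<mu>)" for x
  have int: "integrable \<mu> (\<lambda>s. f (scaled_loss x s))" for x
    using f01 by (intro \<mu>.integrable_const_bound[where B=1]) auto
  have F: "0 \<le> F x" "F x \<le> 1" for x
  proof -
    show "0 \<le> F x" unfolding F_def using f01 by (intro integral_nonneg_AE) auto
    have "F x \<le> (\<integral>s. 1 \<partial>\<mu>)" unfolding F_def using f01 int by (intro integral_mono) auto
    then show "F x \<le> 1" by (simp add: \<mu>.prob_space)
  qed
  have "(\<integral>\<^sup>+w. gprod (\<lambda>y. ennreal (1 - f y)) (\<lambda>n. scaled_loss (X n w) (R n w)) \<partial>M) =
      (\<integral>\<^sup>+w. gprod (\<lambda>p. ennreal (1 - f (case_prod scaled_loss p))) (\<lambda>n. (X n w, R n w)) \<partial>M)"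
    by (simp add: gprod_def)
  also have "\<dots> = (\<integral>\<^sup>+w. gprod (\<lambda>x. \<integral>\<^sup>+s. ennreal (1 - f (case_prod scaled_loss (x, s))) \<partial>\<mu>) (\<lambda>n. X n w) \<partial>M)"
    using f01 by (intro gprod_iid_marks[OF \<open>prob_space M\<close> X R indep]) auto
  also have "(\<lambda>x. \<integral>\<^sup>+s. ennreal (1 - f (case_prod scaled_loss (x, s))) \<partial>\<mu>) = (\<lambda>x. ennreal (1 - F x))"
  proof
    fix x
    have "(\<integral>\<^sup>+s. ennreal (1 - f (scaled_loss x s)) \<partial>\<mu>) = ennreal (\<integral>s. 1 - f (scaled_loss x s) \<partial>\<mu>)"
      using int f01 by (intro nn_integral_eq_integral) auto
    also have "(\<integral>s. 1 - f (scaled_loss x s) \<partial>\<mu>) = 1 - F x"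
      unfolding F_def using int by (subst Bochner_Integration.integral_diff) (auto simp: \<mu>.prob_space)
    finally show "(\<integral>\<^sup>+s. ennreal (1 - f (case_prod scaled_loss (x, s))) \<partial>\<mu>) = ennreal (1 - F x)" by simp
  qed
  also have "(\<integral>\<^sup>+w. gprod (\<lambda>x. ennreal (1 - F x)) (\<lambda>n. X n w) \<partial>M) = ennreal (exp (- (lam * (\<integral>x. F x \<partial>lborel))))"
    using integral_scaled_loss(1)[OF f f01] F
    by (intro Laplace_poisson[OF \<open>prob_space M\<close> lam \<Phi> X bij]) (auto simp: F_def[abs_def])
  also have "lam * (\<integral>x. F x \<partial>lborel) = (\<integral>y. f y * indicator {0<..} y \<partial>lborel)"
    unfolding F_def by (rule integral_scaled_loss(2)[OF f f01])
  finally show ?thesis .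
qed

end

section \<open>The law of the STIR process\<close>

text \<open>The \<open>ennreal\<close> sum depends only on the points and not on their order, and
  \<open>enn2real\<close> gives 0 on divergence, as \<open>interference\<close> does.\<close>

definition normalise :: "(nat \<Rightarrow> real) \<Rightarrow> nat \<Rightarrow> real" where
  "normalise v n = v n / enn2real (\<Sum>n. ennreal (v n))"

lemma measurable_normalise [measurable]: "normalise \<in> measurable seq_borel seq_borel"
  by (rule measurable_PiM_single') (auto simp: normalise_def)

lemma suminf_points: "(\<Sum>n. ennreal (v n)) = (\<integral>\<^sup>+y. ennreal y \<partial>points UNIV v)"
  unfolding points_def by (subst nn_integral_distr) (auto simp: nn_integral_count_space_nat)

text \<open>The total is an integral against the counting measure, so a sequence and its arrangement
  are divided by the same nonnegative number. Hence normalising after ranking is harmless.\<close>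

lemma decreasing_arrangement_normalise:
  assumes "decreasing_arrangement v (points UNIV f)"
  shows "decreasing_arrangement (normalise v) (points UNIV (normalise f))"
proof -
  define c where "c = enn2real (\<Sum>n. ennreal (f n))"
  have pts: "points UNIV v = points UNIV f" and dec: "decseq v"
    using assms by (auto simp: decreasing_arrangement_def)
  have c: "enn2real (\<Sum>n. ennreal (v n)) = c"
    unfolding c_def suminf_points pts ..
  have "points UNIV (normalise v) = distr (points UNIV v) borel (\<lambda>y. y / c)"
    by (subst distr_points) (auto simp: normalise_def[abs_def] c)
  also have "\<dots> = points UNIV (normalise f)"
    unfolding pts by (subst distr_points) (auto simp: normalise_def[abs_def] c_def)
  finally have "points UNIV (normalise v) = points UNIV (normalise f)" .
  moreover have "decseq (normalise v)"
    using dec unfolding decseq_def normalise_def by (auto intro!: divide_right_mono)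
  ultimately show ?thesis by (simp add: decreasing_arrangement_def)
qed

lemma normalise_scale:
  assumes "0 < c"
  shows "normalise (\<lambda>n. c * v n) = normalise v"
  using assms by (auto simp: normalise_def fun_eq_iff ennreal_mult' enn2real_mult)

lemma stir_eq:
  assumes bij: "bij_betw x UNIV P"
    and v: "\<And>n. v n = inverse (path_loss K \<beta> (norm (x n)) / s (x n))" "\<And>n. 0 \<le> v n"
  shows "stir (propagation K \<beta> P s) = points UNIV (normalise v)"
proof -
  define y where "y n = path_loss K \<beta> (norm (x n)) / s (x n)" for n
  have vy: "v = (\<lambda>n. inverse (y n))" using v(1) by (auto simp: y_def)
  have \<Theta>: "propagation K \<beta> P s = points UNIV y"
    unfolding propagation_def y_def[abs_def] by (rule points_bij[OF bij, symmetric])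
  have "interference (points UNIV y) = (\<integral>n. inverse (y n) \<partial>count_space UNIV)"
    unfolding interference_def points_def by (rule integral_distr) auto
  also have "\<dots> = enn2real (\<integral>\<^sup>+n. ennreal (inverse (y n)) \<partial>count_space UNIV)"
    using v(2) unfolding vy by (intro integral_eq_nn_integral) auto
  also have "\<dots> = enn2real (\<Sum>n. ennreal (v n))"
    unfolding nn_integral_count_space_nat v(1) y_def ..
  finally have I: "interference (points UNIV y) = enn2real (\<Sum>n. ennreal (v n))" .
  show ?thesis
    unfolding \<Theta> stinr_def I
    by (subst distr_points, measurable) (simp add: normalise_def[abs_def] vy)
qed

text \<open>Arrivals increase, so the normalised jumps are already decreasing and ranking leaves
  them unchanged. \<open>ranked_law_eq\<close> then compares them with the sticks, whose functionals
  agree by \<open>gprod_normalised_arrivals\<close>.\<close>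

lemma distr_ranked_normalised_arrivals:
  assumes \<alpha>: "0 < \<alpha>" "\<alpha> < 1"
  shows "distr exp_seq seq_borel (\<lambda>u. normalise (\<lambda>n. arrivals u n powr (- 1 / \<alpha>))) = PD \<alpha> 0"
proof -
  define Q where "Q u n = arrivals u n powr (- 1 / \<alpha>)" for u n
  have Q [measurable]: "Q \<in> measurable seq_borel seq_borel"
    by (rule measurable_PiM_single') (auto simp: Q_def)
  have good: "AE u in exp_seq. (\<forall>n. 0 < normalise (Q u) n) \<and> decseq (normalise (Q u)) \<and>
      (\<forall>n. normalise (Q u) n = arrivals u n powr (- 1 / \<alpha>) / jump_sum \<alpha> (arrivals u))"
    using AE_arrivals_good[OF \<alpha>]
  proof eventually_elim
    case (elim u)
    have "(\<Sum>n. ennreal (Q u n)) = ennreal (jump_sum \<alpha> (arrivals u))"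
      unfolding jump_sum_def Q_def using elim by (intro suminf_ennreal2) auto
    then have eq: "normalise (Q u) n = arrivals u n powr (- 1 / \<alpha>) / jump_sum \<alpha> (arrivals u)" for n
      using elim by (simp add: normalise_def Q_def)
    have "decseq (normalise (Q u))"
      unfolding decseq_def eq using elim by (auto simp: decseq_def less_imp_le intro!: divide_right_mono)
    moreover have "0 < normalise (Q u) n" for n
      unfolding eq using elim by (metis divide_pos_pos powr_gt_zero less_irrefl)
    ultimately show ?case using eq by blast
  qed
  have "distr exp_seq seq_borel (\<lambda>u. normalise (Q u)) = distr exp_seq seq_borel (\<lambda>u. ranked (normalise (Q u)))"
    using good by (intro distr_cong_AE) (auto simp: ranked_decseq)
  also have "\<dots> = distr (stick_variables \<alpha> 0) seq_borel (\<lambda>u. ranked (stick_breaking u))"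
  proof (rule ranked_law_eq)
    show "prob_space exp_seq" by (rule prob_space_exp_seq)
    show "prob_space (stick_variables \<alpha> 0)" by (rule prob_space_stick_variables[OF \<alpha>])
    show "(\<lambda>u. normalise (Q u)) \<in> measurable exp_seq seq_borel" by measurable
    show "stick_breaking \<in> measurable (stick_variables \<alpha> 0) seq_borel"
      unfolding measurable_cong_sets[OF sets_stick_variables[OF \<alpha>] refl] by (rule measurable_stick_breaking)
    show "AE u in exp_seq. \<forall>n. 0 < normalise (Q u) n" using good by eventually_elim blast
    show "AE u in stick_variables \<alpha> 0. \<forall>n. 0 < stick_breaking u n"
      using AE_stick_variables[OF \<alpha>] by eventually_elim (auto simp: stick_breaking_def intro!: mult_pos_pos prod_pos)
    show "AE u in stick_variables \<alpha> 0. stick_breaking u \<longlonglongrightarrow> 0"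
      using AE_stick_variables[OF \<alpha>] AE_rest_mass_tendsto_0[OF \<alpha>]
    proof eventually_elim
      case (elim u)
      have nn: "0 \<le> rest_mass u n" for n
        using elim by (auto simp: rest_mass_def less_imp_le intro!: prod_nonneg)
      show ?case
      proof (rule tendsto_sandwich[OF _ _ tendsto_const elim(2)])
        show "\<forall>\<^sub>F n in sequentially. 0 \<le> stick_breaking u n"
          using elim(1) nn by (auto simp: stick_breaking_rest_mass less_imp_le intro!: always_eventually mult_nonneg_nonneg)
        show "\<forall>\<^sub>F n in sequentially. stick_breaking u n \<le> rest_mass u n"
          using elim(1) nn by (auto simp: stick_breaking_rest_mass less_imp_le intro!: always_eventually mult_left_le)
      qed
    qed
    fix g :: "real \<Rightarrow> ennreal" and \<epsilon> :: real
    assume g: "g \<in> borel_measurable borel" "\<And>q. g q \<le> 1" "0 < \<epsilon>" "\<And>q. q < \<epsilon> \<Longrightarrow> g q = 1"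
    have "(\<integral>\<^sup>+u. gprod g (normalise (Q u)) \<partial>exp_seq) =
        (\<integral>\<^sup>+u. gprod g (\<lambda>n. arrivals u n powr (- 1 / \<alpha>) / jump_sum \<alpha> (arrivals u)) \<partial>exp_seq)"
      using good by (intro nn_integral_cong_AE) (elim eventually_mono, auto simp: gprod_def)
    also have "\<dots> = (\<integral>\<^sup>+u. gprod g (stick_breaking u) \<partial>stick_variables \<alpha> 0)"
      by (rule gprod_normalised_arrivals[OF \<alpha> g])
    finally show "(\<integral>\<^sup>+u. gprod g (normalise (Q u)) \<partial>exp_seq) = (\<integral>\<^sup>+u. gprod g (stick_breaking u) \<partial>stick_variables \<alpha> 0)" .
  qed
  also have "\<dots> = PD \<alpha> 0"
    by (simp add: PD_def ranked_def)
  finally show ?thesis by (simp add: Q_def[abs_def])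
qed

text \<open>The second conjunct provides a measurable arrangement, so the first is not vacuous; the
  first follows from it since arrangements are unique.\<close>

theorem proposition3:
  fixes M :: "'w measure"
    and \<Phi> :: "'w \<Rightarrow> (real^2) set"
    and S :: "'w \<Rightarrow> real^2 \<Rightarrow> real"
    and \<mu> :: "real measure"
    and lam K \<beta> :: real
    and \<Psi>' :: "'w \<Rightarrow> real measure"
  assumes "prob_space M"
    and "0 < lam" and "0 < K" and "2 < \<beta>"
    and "homogeneous_poisson_process M lam \<Phi>"
    and "prob_space \<mu>" and "sets \<mu> = sets borel"
    and "AE s in \<mu>. 0 < s" and "integrable \<mu> (\<lambda>s. s powr (2 / \<beta>))"
    and "iid_marks M \<Phi> S \<mu>"
    and "\<Psi>' = (\<lambda>\<omega>. stir (propagation K \<beta> (\<Phi> \<omega>) (S \<omega>)))"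
  shows "(\<forall>Z' \<in> measurable M (PiM UNIV (\<lambda>_. borel)).
            (AE \<omega> in M. decreasing_arrangement (Z' \<omega>) (\<Psi>' \<omega>)) \<longrightarrow>
            distr M (PiM UNIV (\<lambda>_. borel)) Z' = PD (2 / \<beta>) 0)
       \<and> PD_point_process M \<Psi>' (2 / \<beta>) 0"
proof -
  interpret prob_space M by fact
  obtain X :: "nat \<Rightarrow> 'w \<Rightarrow> real^2" where X:
    "\<And>n. X n \<in> borel_measurable M" "AE \<omega> in M. bij_betw (\<lambda>n. X n \<omega>) UNIV (\<Phi> \<omega>)"
    "\<And>n. distr M borel (\<lambda>\<omega>. S \<omega> (X n \<omega>)) = \<mu>"
    "prob_space.indep_vars M (\<lambda>_. borel) (\<lambda>n \<omega>. S \<omega> (X n \<omega>)) UNIV"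
    "indep_seqs M X (\<lambda>n \<omega>. S \<omega> (X n \<omega>))"
    using assms(10) unfolding iid_marks_def by blast
  note pos = assms(2-4) and \<Phi> = assms(5) and \<mu> = assms(6-9) and \<Psi>' = assms(11)
  note bij = X(2) and law = X(3) and iid = X(4) and indep = X(5)
  define \<alpha> where "\<alpha> = 2 / \<beta>"
  have \<alpha>: "0 < \<alpha>" "\<alpha> < 1" using pos by (auto simp: \<alpha>_def)
  define a where "a = lam * pi * (\<integral>s. s powr \<alpha> \<partial>\<mu>) / K\<^sup>2"
  note model = \<mu>(1-3) \<mu>(4)[folded \<alpha>_def] pos \<alpha>_def a_def
  have a: "0 < a" by (rule scale_pos[OF model])
  define R where "R n w = S w (X n w)" for n w
  have R [measurable]: "R n \<in> borel_measurable M" for n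
    using iid by (auto simp: indep_vars_def R_def[abs_def])
  note [measurable] = X(1)
  define Y where "Y n w = path_loss K \<beta> (norm (X n w)) / R n w" for n w
  define \<gamma> where "\<gamma> n w = scaled_loss K \<beta> \<alpha> a (X n w) (R n w)" for n w
  have \<gamma>_eq: "\<gamma> n w = a * Y n w powr \<alpha>" for n w
    unfolding \<gamma>_def scaled_loss_def[OF model] Y_def ..
  have [measurable]: "Y n \<in> borel_measurable M" for n
    unfolding Y_def path_loss_def by measurable
  have [measurable]: "\<gamma> n \<in> borel_measurable M" for n
    unfolding \<gamma>_eq by measurable
  \<comment> \<open>Almost surely \<open>P w n\<close> is \<open>inverse (Y n w)\<close> times the
    constant \<open>a powr (- 1 / \<alpha>)\<close>, which cancels on normalising.\<close>
  define P where "P w n = \<gamma> n w powr (- 1 / \<alpha>)" for w n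
  have P [measurable]: "P \<in> measurable M seq_borel"
    by (rule measurable_PiM_single') (auto simp: P_def)
  define Q where "Q u n = arrivals u n powr (- 1 / \<alpha>)" for u n
  have Q [measurable]: "Q \<in> measurable seq_borel seq_borel"
    by (rule measurable_PiM_single') (auto simp: Q_def)
  have R_pos: "AE w in M. \<forall>n. 0 < R n w"
    unfolding AE_all_countable
  proof
    fix n
    have *: "distr M borel (R n) = \<mu>" using law[of n] unfolding R_def[abs_def] .
    have "AE s in distr M borel (R n). 0 < s" unfolding * by (rule \<mu>(3))
    then show "AE w in M. 0 < R n w" by (rule AE_distrD[OF R])
  qed
  \<comment> \<open>A point at the origin would have loss 0. The singleton is a null set, so its
    Poisson count is almost surely 0, and finiteness turns \<open>card\<close> equal to 0 into
    emptiness.\<close>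
  have no_0: "AE w in M. 0 \<notin> \<Phi> w"
  proof -
    have fin: "AE w in M. finite (\<Phi> w \<inter> {0})"
      and C: "(\<lambda>w. card (\<Phi> w \<inter> {0})) \<in> measurable M (count_space UNIV)"
      and p: "measure M {w \<in> space M. card (\<Phi> w \<inter> {0}) = k} =
             (lam * measure lborel {0 :: real^2}) ^ k / fact k * exp (- (lam * measure lborel {0 :: real^2}))" for k
      using \<Phi>[unfolded homogeneous_poisson_process_def, THEN conjunct1, rule_format, of "{0}"] by auto
    have "AE w in M. w \<in> {w \<in> space M. card (\<Phi> w \<inter> {0}) = 0}"
      by (rule AE_prob_1, unfold p) (simp add: measure_def)
    with fin show ?thesis by eventually_elim auto
  qed
  have Y_pos: "AE w in M. \<forall>n. 0 < Y n w"
    using R_pos no_0 bij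
  proof eventually_elim
    case (elim w)
    have "X n w \<noteq> 0" for n using elim by (metis bij_betwE UNIV_I)
    then show ?case using elim(1) pos(2) by (auto simp: Y_def path_loss_def)
  qed
  have P_eq: "AE w in M. P w = (\<lambda>n. a powr (- 1 / \<alpha>) * inverse (Y n w))"
    using Y_pos
  proof eventually_elim
    case (elim w)
    show ?case
    proof
      fix n
      have "\<alpha> * (- 1 / \<alpha>) = - 1" using \<alpha> by simp
      then have "(Y n w powr \<alpha>) powr (- 1 / \<alpha>) = inverse (Y n w)"
        unfolding powr_powr using elim by (simp add: powr_minus less_imp_le)
      then show "P w n = a powr (- 1 / \<alpha>) * inverse (Y n w)"
        unfolding P_def \<gamma>_eq using a elim by (simp add: powr_mult)
    qed
  qed
  have P_pos: "AE w in M. \<forall>n. 0 < P w n"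
    using P_eq Y_pos by eventually_elim (use a in simp)
  have Q_pos: "AE u in exp_seq. \<forall>n. 0 < Q u n"
    using AE_arrivals_good[OF \<alpha>]
  proof eventually_elim
    case (elim u)
    then show ?case unfolding Q_def by (metis powr_gt_zero less_irrefl)
  qed
  have Q_0: "AE u in exp_seq. Q u \<longlonglongrightarrow> 0"
    using AE_arrivals_good[OF \<alpha>]
    by eventually_elim (unfold Q_def[abs_def], intro summable_LIMSEQ_zero, blast)
  have Q_dec: "AE u in exp_seq. decseq (Q u)"
    using AE_arrivals_good[OF \<alpha>] by eventually_elim (simp add: Q_def[abs_def])
  have functionals: "(\<integral>\<^sup>+w. gprod g (P w) \<partial>M) = (\<integral>\<^sup>+u. gprod g (Q u) \<partial>exp_seq)"
    if g: "g \<in> borel_measurable borel" "\<And>q. g q \<le> 1" "0 < \<epsilon>" "\<And>q. q < \<epsilon> \<Longrightarrow> g q = 1" for g \<epsilon>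
  proof -
    note [measurable] = g(1)
    \<comment> \<open>The test function on the scale of the arrivals. As
      \<open>y powr (- 1 / \<alpha>)\<close> decreases in \<open>y\<close>, being 1 below
      \<open>\<epsilon>\<close> becomes vanishing of \<open>f\<close> beyond
      \<open>\<epsilon> powr (- \<alpha>)\<close>.\<close>
    define f where "f y = 1 - enn2real (g (y powr (- 1 / \<alpha>)))" for y
    have gf: "ennreal (1 - f y) = g (y powr (- 1 / \<alpha>))" for y
      using le_less_trans[OF g(2) ennreal_one_less_top] by (simp add: f_def)
    have f: "0 \<le> f y" "f y \<le> 1" for y
      using enn2real_mono[OF g(2)[of "y powr (- 1 / \<alpha>)"]] by (auto simp: f_def)
    have f0: "f y = 0" if "\<epsilon> powr (- \<alpha>) < y" for y
    proof -
      have "y powr (- 1 / \<alpha>) < (\<epsilon> powr (- \<alpha>)) powr (- 1 / \<alpha>)"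
        using that g(3) \<alpha> by (intro powr_less_mono2_neg) auto
      also have "\<dots> = \<epsilon>" using g(3) \<alpha> by (simp add: powr_powr)
      finally show ?thesis by (simp add: f_def g(4))
    qed
    have [measurable]: "f \<in> borel_measurable borel" unfolding f_def by measurable
    have "(\<integral>\<^sup>+w. gprod g (P w) \<partial>M) = (\<integral>\<^sup>+w. gprod (\<lambda>y. ennreal (1 - f y)) (\<lambda>n. \<gamma> n w) \<partial>M)"
      by (simp add: gprod_def gf P_def)
    also have "\<dots> = ennreal (exp (- (\<integral>y. f y * indicator {0<..} y \<partial>lborel)))"
      unfolding \<gamma>_def
      by (rule Laplace_propagation[OF model \<open>prob_space M\<close> \<Phi> X(1) bij R _ _ _ _ f f0])
         (use law iid indep in \<open>simp_all add: R_def[abs_def]\<close>)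
    also have "\<dots> = (\<integral>\<^sup>+u. gprod (\<lambda>y. ennreal (1 - f y)) (arrivals u) \<partial>exp_seq)"
      by (rule Laplace_arrivals[OF _ f f0, symmetric]) measurable
    also have "\<dots> = (\<integral>\<^sup>+u. gprod g (Q u) \<partial>exp_seq)"
      by (simp add: gprod_def gf Q_def)
    finally show ?thesis .
  qed
  have Qm: "Q \<in> measurable exp_seq seq_borel" by measurable
  note laws = \<open>prob_space M\<close> prob_space_exp_seq P Qm P_pos Q_pos Q_0 functionals
  have P_0: "AE w in M. P w \<longlonglongrightarrow> 0"
    by (rule AE_tendsto_0[OF laws])
  have P_ranked: "distr M seq_borel (\<lambda>w. ranked (P w)) = distr exp_seq seq_borel (\<lambda>u. ranked (Q u))"
    by (rule ranked_law_eq[OF laws])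
  \<comment> \<open>Ranking precedes normalisation, so that the law of \<open>Z\<close> is a
    measurable image of the law in \<open>P_ranked\<close>.\<close>
  define Z where "Z w = normalise (ranked (P w))" for w
  have Z [measurable]: "Z \<in> measurable M seq_borel" unfolding Z_def by measurable
  have "AE w in M. decreasing_arrangement (Z w) (\<Psi>' w)"
    using P_0 P_pos P_eq Y_pos bij
  proof eventually_elim
    case (elim w)
    have "decreasing_arrangement (Z w) (points UNIV (normalise (P w)))"
      unfolding Z_def using elim(1,2)
      by (intro decreasing_arrangement_normalise decreasing_arrangement_ranked_tendsto) auto
    also have "normalise (P w) = normalise (\<lambda>n. inverse (Y n w))"
      unfolding elim(3) using a by (intro normalise_scale) simp
    also have "points UNIV \<dots> = \<Psi>' w"
      unfolding \<Psi>'
    proof (rule stir_eq[OF elim(5), symmetric])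
      show "inverse (Y n w) = inverse (path_loss K \<beta> (norm (X n w)) / S w (X n w))" for n
        by (simp add: Y_def R_def)
      show "0 \<le> inverse (Y n w)" for n using elim(4) by (simp add: less_imp_le)
    qed
    finally show ?case .
  qed
  moreover have "distr M seq_borel Z = PD \<alpha> 0"
  proof -
    have "distr M seq_borel Z = distr (distr M seq_borel (\<lambda>w. ranked (P w))) seq_borel normalise"
      by (subst distr_distr) (auto simp: comp_def Z_def[abs_def])
    also have "\<dots> = distr exp_seq seq_borel (\<lambda>u. normalise (ranked (Q u)))"
      unfolding P_ranked by (subst distr_distr) (auto simp: comp_def)
    also have "\<dots> = distr exp_seq seq_borel (\<lambda>u. normalise (Q u))"
      using Q_dec by (intro distr_cong_AE) (auto simp: ranked_decseq)
    also have "\<dots> = PD \<alpha> 0"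
      using distr_ranked_normalised_arrivals[OF \<alpha>] by (simp add: Q_def[abs_def])
    finally show ?thesis .
  qed
  ultimately have Z: "Z \<in> measurable M seq_borel" "AE w in M. decreasing_arrangement (Z w) (\<Psi>' w)"
      "distr M seq_borel Z = PD (2 / \<beta>) 0"
    using Z by (auto simp: \<alpha>_def)
  have "distr M seq_borel Z' = PD (2 / \<beta>) 0"
    if Z': "Z' \<in> measurable M seq_borel" "AE w in M. decreasing_arrangement (Z' w) (\<Psi>' w)" for Z'
  proof -
    have "AE w in M. Z' w = Z w"
      using Z(2) Z'(2) by eventually_elim (rule decreasing_arrangement_unique)
    then have "distr M seq_borel Z' = distr M seq_borel Z"
      using Z(1) Z'(1) by (intro distr_cong_AE) auto
    then show ?thesis using Z(3) by simp
  qed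
  then show ?thesis using Z unfolding PD_point_process_def by blast
qed

end
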